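(* Let $\mathcal{A}$ be an abelian category with a generator, small direct sums and exact small products, and let $S$ be an inverse sequence in $\mathcal{A}$. Then the following statements are equivalent: (1) $\lim^1 S=0$; (2) $\lim \mathrm{Coker}(S\to \widehat S^\lambda)=0$ for any limit ordinal $\lambda$; (3) for any limit ordinal $\lambda$: if the cofinality of $\lambda$ is countable, then $S$ is $\lambda$-complete; if the cofinality of $\lambda$ is uncountable, then $\lim \mathrm{Coker}(S\to \widehat S^{\lambda})=0$.
   Context: A generator of $\mathcal{A}$ is an object $G$ such that the functor $\mathcal{A}(G,-)$ is faithful. An inverse sequence $S$ in $\mathcal{A}$ consists of objects $S_i$ and morphisms $f_i:S_{i+1}\to S_i$, $i\in\omega=\{0,1,2,\dots\}$, i.e. it is a functor $\omega^{\mathrm{op}}\to\mathcal{A}$. Inverse sequences form an abelian category $\mathcal{A}^{\omega^{\mathrm{op}}}$, in which kernels, cokernels, images and limits are computed componentwise. The objects $\lim S$ and $\lim^1 S$ (the limit and its first right derived functor) are the kernel and the cokernel of $1-F:\prod_i S_i\to\prod_i S_i$, where $\mathrm{pr}_jF=f_j\,\mathrm{pr}_{j+1}$. Transfinite image filtration: $I(S)\rightarrowtail S$ is the inverse sequence of images $I(S)_i=\mathrm{Im}(f_i:S_{i+1}\to S_i)$. For ordinals: $I^0(S)=S$, $I^{\alpha+1}(S)=I(I^\alpha(S))$, and $I^\lambda(S)=\lim_{\alpha<\lambda}I^\alpha(S)$ for a (nonzero) limit ordinal $\lambda$ (a limit in $\mathcal{A}^{\omega^{\mathrm{op}}}$).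 The canonical maps $I^\alpha(S)\to S$ are monomorphisms; put $S^\alpha=\mathrm{Coker}(I^\alpha(S)\rightarrowtail S)$. For a limit ordinal $\lambda$ the $\lambda$-completion of $S$ is the inverse sequence $\widehat S^\lambda=\lim_{\beta<\lambda}S^\beta$ (a limit in $\mathcal{A}^{\omega^{\mathrm{op}}}$), and $S\to\widehat S^\lambda$ is the map induced by the projections $S\to S^\beta$. $S$ is called $\lambda$-complete if $S\to\widehat S^\lambda$ is an epimorphism. *)

theory Defs
  imports "HOL-Library.Equipollence" "HOL-Library.Countable_Set" "HOL-Algebra.Group"
begin

section \<open>Ordinals and smallness\<close>

text \<open>
  Every HOL type is a set, so a universe has to be fixed to give meaning to the words
  ``small'' and ``any ordinal''. It is a well-ordered type \<open>'u\<close> whose order type is an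
  uncountable inaccessible cardinal. A set is small if it has fewer elements than \<open>'u\<close>,
  and the elements of \<open>'u\<close> are the small ordinals: \<open>\<alpha>\<close> stands for the order type of
  \<open>{..<\<alpha>}\<close>. Up to bijection the small sets are exactly those of the Grothendieck universe
  given by the cardinal.
\<close>

definition small :: "'u itself \<Rightarrow> 'a set \<Rightarrow> bool" where
  "small _ I \<longleftrightarrow> I \<prec> (UNIV :: 'u set)"

definition universe :: "'u::wellorder itself \<Rightarrow> bool" where
  "universe U \<longleftrightarrow>
     uncountable (UNIV :: 'u set) \<and>
     (\<forall>\<alpha>::'u. small U {..<\<alpha>}) \<and>
     (\<forall>I::'u set. small U I \<longrightarrow> (\<exists>\<alpha>. I \<subseteq> {..<\<alpha>})) \<and>
     (\<forall>\<alpha>::'u. small U (Pow {..<\<alpha>}))"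

definition ord_zero :: "'u::wellorder" where
  "ord_zero = (LEAST \<alpha>. True)"

definition ord_pred :: "'u::wellorder \<Rightarrow> 'u \<Rightarrow> bool" where
  "ord_pred \<beta> \<alpha> \<longleftrightarrow> \<beta> < \<alpha> \<and> (\<forall>\<gamma>. \<gamma> < \<alpha> \<longrightarrow> \<gamma> \<le> \<beta>)"

definition limit_ordinal :: "'u::wellorder \<Rightarrow> bool" where
  "limit_ordinal \<mu> \<longleftrightarrow> \<mu> \<noteq> ord_zero \<and> (\<nexists>\<beta>. ord_pred \<beta> \<mu>)"

definition cofinality :: "'u::wellorder \<Rightarrow> 'u" where
  "cofinality \<mu> =
     (LEAST \<alpha>. \<exists>C. C \<subseteq> {..<\<mu>} \<and> (\<forall>\<beta><\<mu>. \<exists>\<gamma>\<in>C. \<beta> \<le> \<gamma>) \<and> C \<approx> {..<\<alpha>})"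


section \<open>Abelian categories\<close>

text \<open>
  The addition and the zero morphisms are part of the data. The field \<open>arr_add\<close> is only
  meaningful for two parallel arrows, and \<open>g \<cdot>\<^bsub>C\<^esub> f\<close> only for \<open>tgt C f = src C g\<close>.
\<close>

record ('o, 'm) precat =
  objs :: "'o set"
  arrs :: "'m set"
  src :: "'m \<Rightarrow> 'o"
  tgt :: "'m \<Rightarrow> 'o"
  ident :: "'o \<Rightarrow> 'm"
  arr_comp :: "'m \<Rightarrow> 'm \<Rightarrow> 'm" (infixr "\<cdot>\<index>" 70)
  arr_add :: "'m \<Rightarrow> 'm \<Rightarrow> 'm"
  arr_zero :: "'o \<Rightarrow> 'o \<Rightarrow> 'm"

definition homs :: "('o, 'm) precat \<Rightarrow> 'o \<Rightarrow> 'o \<Rightarrow> 'm set" where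
  "homs C X Y = {f \<in> arrs C. src C f = X \<and> tgt C f = Y}"

definition hom_group :: "('o, 'm) precat \<Rightarrow> 'o \<Rightarrow> 'o \<Rightarrow> 'm monoid" where
  "hom_group C X Y = \<lparr>carrier = homs C X Y, mult = arr_add C, one = arr_zero C X Y\<rparr>"

definition arr_diff :: "('o, 'm) precat \<Rightarrow> 'm \<Rightarrow> 'm \<Rightarrow> 'm" where
  "arr_diff C f g = arr_add C f (inv\<^bsub>hom_group C (src C g) (tgt C g)\<^esub> g)"

locale category =
  fixes C :: "('o, 'm) precat" (structure)
  assumes src_tgt: "f \<in> arrs C \<Longrightarrow> src C f \<in> objs C \<and> tgt C f \<in> objs C"
    and ident_hom: "X \<in> objs C \<Longrightarrow> ident C X \<in> homs C X X"
    and comp_hom: "f \<in> homs C X Y \<Longrightarrow> g \<in> homs C Y Z \<Longrightarrow> g \<cdot> f \<in> homs C X Z"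
    and ident_left: "f \<in> homs C X Y \<Longrightarrow> ident C Y \<cdot> f = f"
    and ident_right: "f \<in> homs C X Y \<Longrightarrow> f \<cdot> ident C X = f"
    and comp_assoc: "f \<in> homs C W X \<Longrightarrow> g \<in> homs C X Y \<Longrightarrow> h \<in> homs C Y Z \<Longrightarrow>
      (h \<cdot> g) \<cdot> f = h \<cdot> (g \<cdot> f)"

locale preadditive_category = category C for C :: "('o, 'm) precat" (structure) +
  assumes hom_comm_group: "X \<in> objs C \<Longrightarrow> Y \<in> objs C \<Longrightarrow> comm_group (hom_group C X Y)"
    and comp_add_right: "f \<in> homs C X Y \<Longrightarrow> f' \<in> homs C X Y \<Longrightarrow> g \<in> homs C Y Z \<Longrightarrow>
      g \<cdot> arr_add C f f' = arr_add C (g \<cdot> f) (g \<cdot> f')"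
    and comp_add_left: "f \<in> homs C X Y \<Longrightarrow> g \<in> homs C Y Z \<Longrightarrow> g' \<in> homs C Y Z \<Longrightarrow>
      arr_add C g g' \<cdot> f = arr_add C (g \<cdot> f) (g' \<cdot> f)"

definition is_mono :: "('o, 'm) precat \<Rightarrow> 'm \<Rightarrow> bool" where
  "is_mono C f \<longleftrightarrow> f \<in> arrs C \<and>
     (\<forall>X. \<forall>g\<in>homs C X (src C f). \<forall>h\<in>homs C X (src C f). f \<cdot>\<^bsub>C\<^esub> g = f \<cdot>\<^bsub>C\<^esub> h \<longrightarrow> g = h)"

definition is_epi :: "('o, 'm) precat \<Rightarrow> 'm \<Rightarrow> bool" where
  "is_epi C f \<longleftrightarrow> f \<in> arrs C \<and>
     (\<forall>X. \<forall>g\<in>homs C (tgt C f) X. \<forall>h\<in>homs C (tgt C f) X. g \<cdot>\<^bsub>C\<^esub> f = h \<cdot>\<^bsub>C\<^esub> f \<longrightarrow> g = h)"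

definition is_zero_object :: "('o, 'm) precat \<Rightarrow> 'o \<Rightarrow> bool" where
  "is_zero_object C Z \<longleftrightarrow> Z \<in> objs C \<and>
     (\<forall>X\<in>objs C. (\<exists>!f. f \<in> homs C X Z) \<and> (\<exists>!f. f \<in> homs C Z X))"

definition is_kernel :: "('o, 'm) precat \<Rightarrow> 'm \<Rightarrow> 'm \<Rightarrow> bool" where
  "is_kernel C f k \<longleftrightarrow> f \<in> arrs C \<and> k \<in> arrs C \<and> tgt C k = src C f \<and>
     f \<cdot>\<^bsub>C\<^esub> k = arr_zero C (src C k) (tgt C f) \<and>
     (\<forall>X. \<forall>g\<in>homs C X (src C f). f \<cdot>\<^bsub>C\<^esub> g = arr_zero C X (tgt C f) \<longrightarrow>
        (\<exists>!h. h \<in> homs C X (src C k) \<and> k \<cdot>\<^bsub>C\<^esub> h = g))"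

definition is_cokernel :: "('o, 'm) precat \<Rightarrow> 'm \<Rightarrow> 'm \<Rightarrow> bool" where
  "is_cokernel C f p \<longleftrightarrow> f \<in> arrs C \<and> p \<in> arrs C \<and> src C p = tgt C f \<and>
     p \<cdot>\<^bsub>C\<^esub> f = arr_zero C (src C f) (tgt C p) \<and>
     (\<forall>X. \<forall>g\<in>homs C (tgt C f) X. g \<cdot>\<^bsub>C\<^esub> f = arr_zero C (src C f) X \<longrightarrow>
        (\<exists>!h. h \<in> homs C (tgt C p) X \<and> h \<cdot>\<^bsub>C\<^esub> p = g))"

definition is_biproduct ::
  "('o, 'm) precat \<Rightarrow> 'o \<Rightarrow> 'o \<Rightarrow> 'o \<Rightarrow> 'm \<Rightarrow> 'm \<Rightarrow> 'm \<Rightarrow> 'm \<Rightarrow> bool" where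
  "is_biproduct C X Y B i j p q \<longleftrightarrow> B \<in> objs C \<and>
     i \<in> homs C X B \<and> j \<in> homs C Y B \<and> p \<in> homs C B X \<and> q \<in> homs C B Y \<and>
     p \<cdot>\<^bsub>C\<^esub> i = ident C X \<and> q \<cdot>\<^bsub>C\<^esub> j = ident C Y \<and>
     arr_add C (i \<cdot>\<^bsub>C\<^esub> p) (j \<cdot>\<^bsub>C\<^esub> q) = ident C B"

locale abelian_category = preadditive_category C for C :: "('o, 'm) precat" (structure) +
  assumes zero_object: "\<exists>Z. is_zero_object C Z"
    and biproducts: "X \<in> objs C \<Longrightarrow> Y \<in> objs C \<Longrightarrow> \<exists>B i j p q. is_biproduct C X Y B i j p q"
    and kernels: "f \<in> arrs C \<Longrightarrow> \<exists>k. is_kernel C f k"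
    and cokernels: "f \<in> arrs C \<Longrightarrow> \<exists>p. is_cokernel C f p"
    and mono_normal: "is_mono C k \<Longrightarrow> \<exists>f. is_kernel C f k"
    and epi_normal: "is_epi C p \<Longrightarrow> \<exists>f. is_cokernel C f p"

definition short_exact :: "('o, 'm) precat \<Rightarrow> 'm \<Rightarrow> 'm \<Rightarrow> bool" where
  "short_exact C f g \<longleftrightarrow> is_kernel C g f \<and> is_cokernel C f g"

definition ker :: "('o, 'm) precat \<Rightarrow> 'm \<Rightarrow> 'm" where
  "ker C f = (SOME k. is_kernel C f k)"

definition coker :: "('o, 'm) precat \<Rightarrow> 'm \<Rightarrow> 'm" where
  "coker C f = (SOME p. is_cokernel C f p)"

definition im :: "('o, 'm) precat \<Rightarrow> 'm \<Rightarrow> 'm" where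
  "im C f = ker C (coker C f)"

definition factor_mono :: "('o, 'm) precat \<Rightarrow> 'm \<Rightarrow> 'm \<Rightarrow> 'm" where
  "factor_mono C m g = (THE h. h \<in> homs C (src C g) (src C m) \<and> m \<cdot>\<^bsub>C\<^esub> h = g)"

definition factor_epi :: "('o, 'm) precat \<Rightarrow> 'm \<Rightarrow> 'm \<Rightarrow> 'm" where
  "factor_epi C p g = (THE h. h \<in> homs C (tgt C p) (tgt C g) \<and> h \<cdot>\<^bsub>C\<^esub> p = g)"

definition is_generator :: "('o, 'm) precat \<Rightarrow> 'o \<Rightarrow> bool" where
  "is_generator C G \<longleftrightarrow> G \<in> objs C \<and>
     (\<forall>X Y. \<forall>f\<in>homs C X Y. \<forall>g\<in>homs C X Y.
        (\<forall>h\<in>homs C G X. f \<cdot>\<^bsub>C\<^esub> h = g \<cdot>\<^bsub>C\<^esub> h) \<longrightarrow> f = g)"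

definition locally_small :: "'u itself \<Rightarrow> ('o, 'm) precat \<Rightarrow> bool" where
  "locally_small U C \<longleftrightarrow> (\<forall>X\<in>objs C. \<forall>Y\<in>objs C. small U (homs C X Y))"


section \<open>Products, coproducts and limits\<close>

definition is_product ::
  "('o, 'm) precat \<Rightarrow> 'i set \<Rightarrow> ('i \<Rightarrow> 'o) \<Rightarrow> 'o \<Rightarrow> ('i \<Rightarrow> 'm) \<Rightarrow> bool" where
  "is_product C I X P \<pi> \<longleftrightarrow> P \<in> objs C \<and> (\<forall>i\<in>I. \<pi> i \<in> homs C P (X i)) \<and>
     (\<forall>Y\<in>objs C. \<forall>f. (\<forall>i\<in>I. f i \<in> homs C Y (X i)) \<longrightarrow>
        (\<exists>!h. h \<in> homs C Y P \<and> (\<forall>i\<in>I. \<pi> i \<cdot>\<^bsub>C\<^esub> h = f i)))"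

definition is_coproduct ::
  "('o, 'm) precat \<Rightarrow> 'i set \<Rightarrow> ('i \<Rightarrow> 'o) \<Rightarrow> 'o \<Rightarrow> ('i \<Rightarrow> 'm) \<Rightarrow> bool" where
  "is_coproduct C I X P \<iota> \<longleftrightarrow> P \<in> objs C \<and> (\<forall>i\<in>I. \<iota> i \<in> homs C (X i) P) \<and>
     (\<forall>Y\<in>objs C. \<forall>f. (\<forall>i\<in>I. f i \<in> homs C (X i) Y) \<longrightarrow>
        (\<exists>!h. h \<in> homs C P Y \<and> (\<forall>i\<in>I. h \<cdot>\<^bsub>C\<^esub> \<iota> i = f i)))"

text \<open>Every small set is in bijection with a subset of \<open>'u\<close>, so index sets in \<open>'u\<close> suffice.\<close>

definition has_small_products :: "'u itself \<Rightarrow> ('o, 'm) precat \<Rightarrow> bool" where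
  "has_small_products U C \<longleftrightarrow>
     (\<forall>(I::'u set) X. small U I \<longrightarrow> (\<forall>i\<in>I. X i \<in> objs C) \<longrightarrow> (\<exists>P \<pi>. is_product C I X P \<pi>))"

definition has_small_coproducts :: "'u itself \<Rightarrow> ('o, 'm) precat \<Rightarrow> bool" where
  "has_small_coproducts U C \<longleftrightarrow>
     (\<forall>(I::'u set) X. small U I \<longrightarrow> (\<forall>i\<in>I. X i \<in> objs C) \<longrightarrow> (\<exists>P \<iota>. is_coproduct C I X P \<iota>))"

definition small_products_exact :: "'u itself \<Rightarrow> ('o, 'm) precat \<Rightarrow> bool" where
  "small_products_exact U C \<longleftrightarrow>
     (\<forall>(I::'u set) X Y Z f g P Q R \<pi> \<rho> \<sigma> F G.
        small U I \<longrightarrow>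
        (\<forall>i\<in>I. f i \<in> homs C (X i) (Y i) \<and> g i \<in> homs C (Y i) (Z i) \<and> short_exact C (f i) (g i)) \<longrightarrow>
        is_product C I X P \<pi> \<longrightarrow> is_product C I Y Q \<rho> \<longrightarrow> is_product C I Z R \<sigma> \<longrightarrow>
        F \<in> homs C P Q \<longrightarrow> (\<forall>i\<in>I. \<rho> i \<cdot>\<^bsub>C\<^esub> F = f i \<cdot>\<^bsub>C\<^esub> \<pi> i) \<longrightarrow>
        G \<in> homs C Q R \<longrightarrow> (\<forall>i\<in>I. \<sigma> i \<cdot>\<^bsub>C\<^esub> G = g i \<cdot>\<^bsub>C\<^esub> \<rho> i) \<longrightarrow>
        short_exact C F G)"

text \<open>
  Inverse systems over a set \<open>J\<close> of ordinals: the objects \<open>X \<beta>\<close> and, for \<open>\<beta> \<le> \<gamma>\<close>, the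
  transition morphisms \<open>t \<beta> \<gamma>\<close> from \<open>X \<gamma>\<close> to \<open>X \<beta>\<close>.
\<close>

definition is_cone :: "('o, 'm) precat \<Rightarrow> 'u::wellorder set \<Rightarrow> ('u \<Rightarrow> 'o) \<Rightarrow> ('u \<Rightarrow> 'u \<Rightarrow> 'm) \<Rightarrow>
    'o \<Rightarrow> ('u \<Rightarrow> 'm) \<Rightarrow> bool" where
  "is_cone C J X t Y \<phi> \<longleftrightarrow> Y \<in> objs C \<and> (\<forall>\<beta>\<in>J. \<phi> \<beta> \<in> homs C Y (X \<beta>)) \<and>
     (\<forall>\<beta>\<in>J. \<forall>\<gamma>\<in>J. \<beta> \<le> \<gamma> \<longrightarrow> t \<beta> \<gamma> \<cdot>\<^bsub>C\<^esub> \<phi> \<gamma> = \<phi> \<beta>)"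

definition is_limit :: "('o, 'm) precat \<Rightarrow> 'u::wellorder set \<Rightarrow> ('u \<Rightarrow> 'o) \<Rightarrow> ('u \<Rightarrow> 'u \<Rightarrow> 'm) \<Rightarrow>
    'o \<Rightarrow> ('u \<Rightarrow> 'm) \<Rightarrow> bool" where
  "is_limit C J X t L \<pi> \<longleftrightarrow> is_cone C J X t L \<pi> \<and>
     (\<forall>Y \<phi>. is_cone C J X t Y \<phi> \<longrightarrow>
        (\<exists>!h. h \<in> homs C Y L \<and> (\<forall>\<beta>\<in>J. \<pi> \<beta> \<cdot>\<^bsub>C\<^esub> h = \<phi> \<beta>)))"

definition limit_cone :: "('o, 'm) precat \<Rightarrow> 'u::wellorder set \<Rightarrow> ('u \<Rightarrow> 'o) \<Rightarrow>
    ('u \<Rightarrow> 'u \<Rightarrow> 'm) \<Rightarrow> 'o \<times> ('u \<Rightarrow> 'm)" where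
  "limit_cone C J X t = (SOME c. is_limit C J X t (fst c) (snd c))"


lemma limit_cone_cong:
  assumes "\<And>\<beta>. \<beta> \<in> J \<Longrightarrow> X \<beta> = X' \<beta>"
    and "\<And>\<beta> \<gamma>. \<beta> \<in> J \<Longrightarrow> \<gamma> \<in> J \<Longrightarrow> t \<beta> \<gamma> = t' \<beta> \<gamma>"
  shows "limit_cone C J X t = limit_cone C J X' t'"
proof -
  have "is_cone C J X t = is_cone C J X' t'"
    unfolding is_cone_def fun_eq_iff using assms by simp
  then show ?thesis by (simp add: limit_cone_def is_limit_def)
qed


section \<open>Inverse sequences\<close>

datatype ('o, 'm) inv_seq = Inv_Seq (ob: "nat \<Rightarrow> 'o") (bond: "nat \<Rightarrow> 'm")

datatype ('o, 'm) seq_map =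
  Seq_Map (map_src: "('o, 'm) inv_seq") (map_tgt: "('o, 'm) inv_seq") (component: "nat \<Rightarrow> 'm")

definition inverse_sequence :: "('o, 'm) precat \<Rightarrow> ('o, 'm) inv_seq \<Rightarrow> bool" where
  "inverse_sequence A S \<longleftrightarrow>
     (\<forall>i. ob S i \<in> objs A) \<and> (\<forall>i. bond S i \<in> homs A (ob S (Suc i)) (ob S i))"

definition seq_cat :: "('o, 'm) precat \<Rightarrow> (('o, 'm) inv_seq, ('o, 'm) seq_map) precat" where
  "seq_cat A =
     \<lparr>objs = {S. inverse_sequence A S},
      arrs = {\<phi>. inverse_sequence A (map_src \<phi>) \<and> inverse_sequence A (map_tgt \<phi>) \<and>
        (\<forall>i. component \<phi> i \<in> homs A (ob (map_src \<phi>) i) (ob (map_tgt \<phi>) i)) \<and>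
        (\<forall>i. component \<phi> i \<cdot>\<^bsub>A\<^esub> bond (map_src \<phi>) i = bond (map_tgt \<phi>) i \<cdot>\<^bsub>A\<^esub> component \<phi> (Suc i))},
      src = map_src,
      tgt = map_tgt,
      ident = (\<lambda>S. Seq_Map S S (\<lambda>i. ident A (ob S i))),
      arr_comp = (\<lambda>\<psi> \<phi>. Seq_Map (map_src \<phi>) (map_tgt \<psi>) (\<lambda>i. component \<psi> i \<cdot>\<^bsub>A\<^esub> component \<phi> i)),
      arr_add = (\<lambda>\<phi> \<psi>. Seq_Map (map_src \<phi>) (map_tgt \<phi>) (\<lambda>i. arr_add A (component \<phi> i) (component \<psi> i))),
      arr_zero = (\<lambda>S T. Seq_Map S T (\<lambda>i. arr_zero A (ob S i) (ob T i)))\<rparr>"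

definition seq_product :: "('o, 'm) precat \<Rightarrow> ('o, 'm) inv_seq \<Rightarrow> 'o \<times> (nat \<Rightarrow> 'm)" where
  "seq_product A S = (SOME p. is_product A UNIV (ob S) (fst p) (snd p))"

definition shift_map :: "('o, 'm) precat \<Rightarrow> ('o, 'm) inv_seq \<Rightarrow> 'm" where
  "shift_map A S = (let (P, pr) = seq_product A S in
     THE F. F \<in> homs A P P \<and> (\<forall>j. pr j \<cdot>\<^bsub>A\<^esub> F = bond S j \<cdot>\<^bsub>A\<^esub> pr (Suc j)))"

definition one_minus_shift :: "('o, 'm) precat \<Rightarrow> ('o, 'm) inv_seq \<Rightarrow> 'm" where
  "one_minus_shift A S = arr_diff A (ident A (fst (seq_product A S))) (shift_map A S)"

definition seq_lim :: "('o, 'm) precat \<Rightarrow> ('o, 'm) inv_seq \<Rightarrow> 'o" where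
  "seq_lim A S = src A (ker A (one_minus_shift A S))"

definition seq_lim1 :: "('o, 'm) precat \<Rightarrow> ('o, 'm) inv_seq \<Rightarrow> 'o" where
  "seq_lim1 A S = tgt A (coker A (one_minus_shift A S))"


section \<open>The transfinite image filtration and the completions\<close>

definition image_seq :: "('o, 'm) precat \<Rightarrow> ('o, 'm) inv_seq \<Rightarrow> ('o, 'm) inv_seq" where
  "image_seq A S = Inv_Seq (\<lambda>i. src A (im A (bond S i)))
     (\<lambda>i. factor_mono A (im A (bond S i)) (bond S i \<cdot>\<^bsub>A\<^esub> im A (bond S (Suc i))))"

definition image_incl :: "('o, 'm) precat \<Rightarrow> ('o, 'm) inv_seq \<Rightarrow> ('o, 'm) seq_map" where
  "image_incl A S = Seq_Map (image_seq A S) S (\<lambda>i. im A (bond S i))"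

text \<open>
  The filtration is defined by recursion on \<open>\<alpha>\<close>, together with the canonical map from the
  \<open>\<alpha>\<close>-th term to \<open>S\<close>; the term itself is the source of that map. As these maps are
  monomorphisms, the transition map from the \<open>\<gamma>\<close>-th to the \<open>\<beta>\<close>-th term, for \<open>\<beta> \<le> \<gamma>\<close>, is the
  unique one over \<open>S\<close>. At a limit ordinal the canonical map is the projection to the zeroth
  term, which is \<open>S\<close>. In \<open>filt_step\<close> the argument \<open>D\<close> supplies the canonical maps for the
  ordinals below \<open>\<alpha>\<close>.
\<close>

definition filt_step :: "('o, 'm) precat \<Rightarrow> ('o, 'm) inv_seq \<Rightarrow> 'u::wellorder \<Rightarrow>
    ('u \<Rightarrow> ('o, 'm) seq_map) \<Rightarrow> ('o, 'm) seq_map" where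
  "filt_step A S \<alpha> D =
     (if \<alpha> = ord_zero then ident (seq_cat A) S
      else if \<exists>\<beta>. ord_pred \<beta> \<alpha> then
        (let m = D (THE \<beta>. ord_pred \<beta> \<alpha>) in m \<cdot>\<^bsub>seq_cat A\<^esub> image_incl A (map_src m))
      else
        snd (limit_cone (seq_cat A) {..<\<alpha>} (\<lambda>\<beta>. map_src (D \<beta>))
               (\<lambda>\<beta> \<gamma>. factor_mono (seq_cat A) (D \<beta>) (D \<gamma>))) ord_zero)"

function filt_map :: "('o, 'm) precat \<Rightarrow> ('o, 'm) inv_seq \<Rightarrow> 'u::wellorder \<Rightarrow> ('o, 'm) seq_map" where
  "filt_map A S \<alpha> = filt_step A S \<alpha> (\<lambda>\<beta>. if \<beta> < \<alpha> then filt_map A S \<beta> else undefined)"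
  by pat_completeness auto
termination
  by (relation "inv_image {(\<beta>, \<alpha>). \<beta> < \<alpha>} (\<lambda>(A, S, \<alpha>). \<alpha>)") (auto simp: wf)

declare filt_map.simps [simp del]

lemma filt_map_zero: "filt_map A S ord_zero = ident (seq_cat A) S"
  by (simp add: filt_map.simps filt_step_def)

lemma filt_map_succ:
  assumes "ord_pred \<beta> \<alpha>"
  shows "filt_map A S \<alpha> = filt_map A S \<beta> \<cdot>\<^bsub>seq_cat A\<^esub> image_incl A (map_src (filt_map A S \<beta>))"
proof -
  have "\<beta>' = \<beta>" if "ord_pred \<beta>' \<alpha>" for \<beta>'
    using that assms by (auto simp: ord_pred_def intro: order.antisym)
  then have "(THE \<beta>. ord_pred \<beta> \<alpha>) = \<beta>" using assms by blast
  moreover have "\<alpha> \<noteq> ord_zero"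
    using assms by (auto simp: ord_pred_def ord_zero_def dest: not_less_Least)
  moreover have "\<beta> < \<alpha>" using assms by (simp add: ord_pred_def)
  ultimately show ?thesis
    using assms by (subst filt_map.simps) (auto simp: filt_step_def Let_def)
qed

lemma filt_map_limit:
  assumes "limit_ordinal \<alpha>"
  shows "filt_map A S \<alpha> = snd (limit_cone (seq_cat A) {..<\<alpha>} (\<lambda>\<beta>. map_src (filt_map A S \<beta>))
    (\<lambda>\<beta> \<gamma>. factor_mono (seq_cat A) (filt_map A S \<beta>) (filt_map A S \<gamma>))) ord_zero"
  using assms
  by (subst filt_map.simps)
    (auto simp: filt_step_def limit_ordinal_def
      intro!: arg_cong[where f = "\<lambda>c. snd c ord_zero"] limit_cone_cong)

definition quot_map :: "('o, 'm) precat \<Rightarrow> ('o, 'm) inv_seq \<Rightarrow> 'u::wellorder \<Rightarrow> ('o, 'm) seq_map" where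
  "quot_map A S \<alpha> = coker (seq_cat A) (filt_map A S \<alpha>)"

definition quot :: "('o, 'm) precat \<Rightarrow> ('o, 'm) inv_seq \<Rightarrow> 'u::wellorder \<Rightarrow> ('o, 'm) inv_seq" where
  "quot A S \<alpha> = map_tgt (quot_map A S \<alpha>)"

definition completion_cone :: "('o, 'm) precat \<Rightarrow> ('o, 'm) inv_seq \<Rightarrow> 'u::wellorder \<Rightarrow>
    ('o, 'm) inv_seq \<times> ('u \<Rightarrow> ('o, 'm) seq_map)" where
  "completion_cone A S \<mu> = limit_cone (seq_cat A) {..<\<mu>} (quot A S)
     (\<lambda>\<beta> \<gamma>. factor_epi (seq_cat A) (quot_map A S \<gamma>) (quot_map A S \<beta>))"

definition completion :: "('o, 'm) precat \<Rightarrow> ('o, 'm) inv_seq \<Rightarrow> 'u::wellorder \<Rightarrow> ('o, 'm) inv_seq" where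
  "completion A S \<mu> = fst (completion_cone A S \<mu>)"

definition completion_map :: "('o, 'm) precat \<Rightarrow> ('o, 'm) inv_seq \<Rightarrow> 'u::wellorder \<Rightarrow> ('o, 'm) seq_map" where
  "completion_map A S \<mu> = (THE h. h \<in> homs (seq_cat A) S (completion A S \<mu>) \<and>
     (\<forall>\<beta><\<mu>. snd (completion_cone A S \<mu>) \<beta> \<cdot>\<^bsub>seq_cat A\<^esub> h = quot_map A S \<beta>))"

definition completion_coker :: "('o, 'm) precat \<Rightarrow> ('o, 'm) inv_seq \<Rightarrow> 'u::wellorder \<Rightarrow> ('o, 'm) inv_seq" where
  "completion_coker A S \<mu> = map_tgt (coker (seq_cat A) (completion_map A S \<mu>))"

definition complete_at :: "('o, 'm) precat \<Rightarrow> ('o, 'm) inv_seq \<Rightarrow> 'u::wellorder \<Rightarrow> bool" where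
  "complete_at A S \<mu> \<longleftrightarrow> is_epi (seq_cat A) (completion_map A S \<mu>)"

end

theory Submission imports Defs
begin

text \<open>
  Call a morphism universal if it factors through every epimorphism onto its target. The covers of
  \<open>X\<close> by coproducts of copies of the generator, indexed by subsets of \<open>Hom(G, X)\<close>, are cofinal
  among all epimorphisms onto \<open>X\<close> and form a small family; as products are exact, their fibre product
  over \<open>X\<close> is an epimorphism onto \<open>X\<close>, and it is universal. A universal map lifts along an epimorphism to a
  universal map, so recursive lifting shows that \<open>lim\<^sup>1\<close> vanishes on sequences of epimorphisms
  (Roos' theorem), and generalized elements can be chased as if there were enough projectives.

  By induction on \<open>\<alpha>\<close>, \<open>lim S\<^sup>\<alpha> = 0\<close>: at successors \<open>S\<^sup>\<alpha>\<close> changes by a sequence with zero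
  bonding maps. Hence the limit of every completion is zero, and the short exact sequence
  from \<open>S\<^sup>\<mu>\<close> to the \<open>\<mu>\<close>-completion to its cokernel \<open>C\<close> embeds \<open>lim C\<close> in \<open>lim\<^sup>1 S\<^sup>\<mu>\<close>,
  a quotient of \<open>lim\<^sup>1 S\<close>.
  Conversely, if \<open>lim\<close> and \<open>lim\<^sup>1\<close> vanish on all \<open>S\<^sup>\<beta>\<close> with \<open>\<beta> < \<mu>\<close>, then the shift equation has unique
  solutions there and so also in the completion; thus \<open>lim\<^sup>1 S\<^sup>\<alpha> = 0\<close> for all \<open>\<alpha>\<close>. The filtration
  becomes stationary at some \<open>\<alpha>\<close>, where Roos' theorem gives \<open>lim\<^sup>1 I\<^sup>\<alpha>(S) = 0\<close>, so \<open>lim\<^sup>1 S = 0\<close>.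
  For countable cofinality the cokernel has epimorphic bonding maps, so it is zero once its limit is.
\<close>

section \<open>Additive and abelian categories\<close>

text \<open>The obstacle is that C has neither elements nor enough projectives. Lifting a map along
  an epimorphism usually costs a new cover of its source, and an infinite recursion would ask for
  infinitely many covers in succession. Universality is a property relative to one target only, but
  it survives postcomposition with any map. So one cover of a test object T serves all components of
  a sequence and all ordinals at once. For this reason lim X = 0 and lim^1 X = 0 are restated
  through maps out of T, the second as solvability of x_i = a_i + f_i x_(i+1) after an epimorphism
  onto T. The filtration enters the chases only through the question which maps into S_i are killed
  by S -> S^\<alpha>, that is, factor through I^\<alpha>: all of them at 0, the bond images of the
  earlier ones (up to a cover) at a successor, and the common ones at a limit. The kernel of
  S^(\<beta>+1) -> S^\<beta> is I^\<beta> / I^(\<beta>+1); its bonds vanish because I^(\<beta>+1) is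
  the image of the bonds of I^\<beta>. The filtration becomes stationary because maps from the
  generator into the S_i form a small set. Countable cofinality is special because infinite sums
  converge in a completion along a countable tower.\<close>

context category
begin

lemma homs_objs: "f \<in> homs C X Y \<Longrightarrow> X \<in> objs C" "f \<in> homs C X Y \<Longrightarrow> Y \<in> objs C"
  using src_tgt by (auto simp: homs_def)

lemma arr_hom: "f \<in> arrs C \<Longrightarrow> f \<in> homs C (src C f) (tgt C f)"
  by (simp add: homs_def)

lemma hom_arr: "f \<in> homs C X Y \<Longrightarrow> f \<in> arrs C" "f \<in> homs C X Y \<Longrightarrow> src C f = X"
    "f \<in> homs C X Y \<Longrightarrow> tgt C f = Y"
  by (simp_all add: homs_def)

lemma mono_iff:
  assumes "f \<in> homs C X Y"
  shows "is_mono C f \<longleftrightarrow> (\<forall>W. \<forall>g\<in>homs C W X. \<forall>h\<in>homs C W X. f \<cdot> g = f \<cdot> h \<longrightarrow> g = h)"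
  using assms by (simp add: is_mono_def homs_def)

lemma epi_iff:
  assumes "f \<in> homs C X Y"
  shows "is_epi C f \<longleftrightarrow> (\<forall>Z. \<forall>g\<in>homs C Y Z. \<forall>h\<in>homs C Y Z. g \<cdot> f = h \<cdot> f \<longrightarrow> g = h)"
  using assms by (simp add: is_epi_def homs_def)

lemma monoD:
  assumes "is_mono C f" "f \<in> homs C X Y" "g \<in> homs C W X" "h \<in> homs C W X" "f \<cdot> g = f \<cdot> h"
  shows "g = h"
  using assms mono_iff by blast

lemma epiD:
  assumes "is_epi C f" "f \<in> homs C X Y" "g \<in> homs C Y Z" "h \<in> homs C Y Z" "g \<cdot> f = h \<cdot> f"
  shows "g = h"
  using assms epi_iff by blast

lemma mono_comp:
  assumes f: "f \<in> homs C X Y" and g: "g \<in> homs C Y Z" and "is_mono C f" "is_mono C g"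
  shows "is_mono C (g \<cdot> f)"
  unfolding mono_iff[OF comp_hom[OF f g]]
proof (intro allI ballI impI)
  fix W a b assume a: "a \<in> homs C W X" and b: "b \<in> homs C W X" and eq: "(g \<cdot> f) \<cdot> a = (g \<cdot> f) \<cdot> b"
  have "g \<cdot> (f \<cdot> a) = g \<cdot> (f \<cdot> b)"
    using eq comp_assoc[OF a f g] comp_assoc[OF b f g] by simp
  then have "f \<cdot> a = f \<cdot> b"
    using monoD[OF assms(4) g] comp_hom[OF a f] comp_hom[OF b f] by blast
  then show "a = b"
    using monoD[OF assms(3) f a b] by blast
qed

lemma epi_comp:
  assumes f: "f \<in> homs C X Y" and g: "g \<in> homs C Y Z" and "is_epi C f" "is_epi C g"
  shows "is_epi C (g \<cdot> f)"
  unfolding epi_iff[OF comp_hom[OF f g]]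
proof (intro allI ballI impI)
  fix W a b assume a: "a \<in> homs C Z W" and b: "b \<in> homs C Z W" and eq: "a \<cdot> (g \<cdot> f) = b \<cdot> (g \<cdot> f)"
  have "(a \<cdot> g) \<cdot> f = (b \<cdot> g) \<cdot> f"
    using eq comp_assoc[OF f g a] comp_assoc[OF f g b] by simp
  then have "a \<cdot> g = b \<cdot> g"
    using epiD[OF assms(3) f] comp_hom[OF g a] comp_hom[OF g b] by blast
  then show "a = b"
    using epiD[OF assms(4) g a b] by blast
qed

lemma epi_of_comp:
  assumes f: "f \<in> homs C X Y" and g: "g \<in> homs C Y Z" and "is_epi C (g \<cdot> f)"
  shows "is_epi C g"
  unfolding epi_iff[OF g]
proof (intro allI ballI impI)
  fix W a b assume a: "a \<in> homs C Z W" and b: "b \<in> homs C Z W" and eq: "a \<cdot> g = b \<cdot> g"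
  have "a \<cdot> (g \<cdot> f) = b \<cdot> (g \<cdot> f)"
    using eq comp_assoc[OF f g a] comp_assoc[OF f g b] by simp
  then show "a = b"
    using epiD[OF assms(3) comp_hom[OF f g] a b] by blast
qed

lemma factor_mono_eq:
  assumes "m \<in> homs C X Y" "is_mono C m" "h \<in> homs C W X" "m \<cdot> h = g"
  shows "factor_mono C m g = h"
proof -
  have g: "g \<in> homs C W Y"
    using comp_hom assms by blast
  show ?thesis
    unfolding factor_mono_def hom_arr(2)[OF assms(1)] hom_arr(2)[OF g]
    using assms monoD by (intro the_equality) auto
qed

lemma factor_epi_eq:
  assumes "p \<in> homs C X Y" "is_epi C p" "h \<in> homs C Y Z" "h \<cdot> p = g"
  shows "factor_epi C p g = h"
proof -
  have g: "g \<in> homs C X Z"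
    using comp_hom assms by blast
  show ?thesis
    unfolding factor_epi_def hom_arr(3)[OF assms(1)] hom_arr(3)[OF g]
    using assms epiD by (intro the_equality) auto
qed

lemma kernelD:
  assumes "is_kernel C f k" "f \<in> homs C X Y"
  shows "k \<in> homs C (src C k) X" "f \<cdot> k = arr_zero C (src C k) Y"
    "\<And>W g. g \<in> homs C W X \<Longrightarrow> f \<cdot> g = arr_zero C W Y \<Longrightarrow> \<exists>!h. h \<in> homs C W (src C k) \<and> k \<cdot> h = g"
  using assms by (auto simp: is_kernel_def homs_def)

lemma cokernelD:
  assumes "is_cokernel C f p" "f \<in> homs C X Y"
  shows "p \<in> homs C Y (tgt C p)" "p \<cdot> f = arr_zero C X (tgt C p)"
    "\<And>Z g. g \<in> homs C Y Z \<Longrightarrow> g \<cdot> f = arr_zero C X Z \<Longrightarrow> \<exists>!h. h \<in> homs C (tgt C p) Z \<and> h \<cdot> p = g"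
  using assms by (auto simp: is_cokernel_def homs_def)

lemma kernelI:
  assumes "f \<in> homs C X Y" "k \<in> homs C K X" "f \<cdot> k = arr_zero C K Y"
    "\<And>W g. g \<in> homs C W X \<Longrightarrow> f \<cdot> g = arr_zero C W Y \<Longrightarrow> \<exists>!h. h \<in> homs C W K \<and> k \<cdot> h = g"
  shows "is_kernel C f k"
  using assms by (auto simp: is_kernel_def homs_def)

lemma cokernelI:
  assumes "f \<in> homs C X Y" "p \<in> homs C Y P" "p \<cdot> f = arr_zero C X P"
    "\<And>Z g. g \<in> homs C Y Z \<Longrightarrow> g \<cdot> f = arr_zero C X Z \<Longrightarrow> \<exists>!h. h \<in> homs C P Z \<and> h \<cdot> p = g"
  shows "is_cokernel C f p"
  using assms by (auto simp: is_cokernel_def homs_def)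

end

lemma hom_group_simps [simp]:
  "carrier (hom_group C X Y) = homs C X Y" "mult (hom_group C X Y) = arr_add C"
  "one (hom_group C X Y) = arr_zero C X Y"
  by (simp_all add: hom_group_def)

context preadditive_category
begin

notation arr_add (infixl "\<^bold>+\<index>" 65)
notation arr_diff (infixl "\<^bold>-\<index>" 65)

text \<open>Inside, the laws of one Hom group are read off from \<open>comm_group\<close>, which
  needs both objects. The versions below without the suffix 0 obtain the objects from membership in
  \<open>homs\<close>, so that later steps only track the typing of arrows.\<close>

context
  fixes X Y assumes X: "X \<in> objs C" and Y: "Y \<in> objs C"
begin

interpretation G: comm_group "hom_group C X Y"
  by (rule hom_comm_group[OF X Y])

lemma zero_hom0: "arr_zero C X Y \<in> homs C X Y"
  using G.one_closed by simp

lemma add_hom0: "f \<in> homs C X Y \<Longrightarrow> g \<in> homs C X Y \<Longrightarrow> f \<^bold>+ g \<in> homs C X Y"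
  using G.m_closed by simp

lemma diff_eq0: "f \<in> homs C X Y \<Longrightarrow> g \<in> homs C X Y \<Longrightarrow>
    f \<^bold>- g = f \<^bold>+ inv\<^bsub>hom_group C X Y\<^esub> g"
  by (simp add: arr_diff_def homs_def)

lemma neg_hom0: "g \<in> homs C X Y \<Longrightarrow> inv\<^bsub>hom_group C X Y\<^esub> g \<in> homs C X Y"
  using G.inv_closed by simp

lemma diff_hom0: "f \<in> homs C X Y \<Longrightarrow> g \<in> homs C X Y \<Longrightarrow> f \<^bold>- g \<in> homs C X Y"
  using diff_eq0 neg_hom0 add_hom0 by simp

lemma add_assoc0: "f \<in> homs C X Y \<Longrightarrow> g \<in> homs C X Y \<Longrightarrow> h \<in> homs C X Y \<Longrightarrow>
    f \<^bold>+ g \<^bold>+ h = f \<^bold>+ (g \<^bold>+ h)"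
  using G.m_assoc by simp

lemma add_comm0: "f \<in> homs C X Y \<Longrightarrow> g \<in> homs C X Y \<Longrightarrow> f \<^bold>+ g = g \<^bold>+ f"
  using G.m_comm by simp

lemma add_zero0: "f \<in> homs C X Y \<Longrightarrow> f \<^bold>+ arr_zero C X Y = f"
  using G.r_one by simp

lemma add_cancel0: "f \<in> homs C X Y \<Longrightarrow> g \<in> homs C X Y \<Longrightarrow> h \<in> homs C X Y \<Longrightarrow>
    f \<^bold>+ h = g \<^bold>+ h \<longleftrightarrow> f = g"
  using G.right_cancel by simp

lemma diff_add0: "f \<in> homs C X Y \<Longrightarrow> g \<in> homs C X Y \<Longrightarrow> f \<^bold>- g \<^bold>+ g = f"
  using G.m_assoc[of f "inv\<^bsub>hom_group C X Y\<^esub> g" g] G.l_inv[of g] G.r_one[of f] neg_hom0[of g]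
  by (simp add: diff_eq0)

end

lemma zero_hom: "X \<in> objs C \<Longrightarrow> Y \<in> objs C \<Longrightarrow> arr_zero C X Y \<in> homs C X Y"
  by (rule zero_hom0)

lemma add_hom: "f \<in> homs C X Y \<Longrightarrow> g \<in> homs C X Y \<Longrightarrow> f \<^bold>+ g \<in> homs C X Y"
  by (meson add_hom0 homs_objs)

lemma diff_hom: "f \<in> homs C X Y \<Longrightarrow> g \<in> homs C X Y \<Longrightarrow> f \<^bold>- g \<in> homs C X Y"
  by (meson diff_hom0 homs_objs)

lemma add_assoc: "f \<in> homs C X Y \<Longrightarrow> g \<in> homs C X Y \<Longrightarrow> h \<in> homs C X Y \<Longrightarrow>
    f \<^bold>+ g \<^bold>+ h = f \<^bold>+ (g \<^bold>+ h)"
  by (meson add_assoc0 homs_objs)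

lemma add_comm: "f \<in> homs C X Y \<Longrightarrow> g \<in> homs C X Y \<Longrightarrow> f \<^bold>+ g = g \<^bold>+ f"
  by (meson add_comm0 homs_objs)

lemma add_zero: "f \<in> homs C X Y \<Longrightarrow> f \<^bold>+ arr_zero C X Y = f"
  by (meson add_zero0 homs_objs)

lemma zero_add: "f \<in> homs C X Y \<Longrightarrow> arr_zero C X Y \<^bold>+ f = f"
  by (metis add_zero add_comm zero_hom homs_objs)

lemma add_cancel: "f \<in> homs C X Y \<Longrightarrow> g \<in> homs C X Y \<Longrightarrow> h \<in> homs C X Y \<Longrightarrow>
    f \<^bold>+ h = g \<^bold>+ h \<longleftrightarrow> f = g"
  by (meson add_cancel0 homs_objs)

lemma diff_add: "f \<in> homs C X Y \<Longrightarrow> g \<in> homs C X Y \<Longrightarrow> f \<^bold>- g \<^bold>+ g = f"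
  by (meson diff_add0 homs_objs)

lemma diff_eq_iff:
  assumes "f \<in> homs C X Y" "g \<in> homs C X Y" "h \<in> homs C X Y"
  shows "f \<^bold>- g = h \<longleftrightarrow> f = h \<^bold>+ g"
  using add_cancel[OF diff_hom[OF assms(1,2)] assms(3,2)] diff_add[OF assms(1,2)] by metis

lemma diff_self: "f \<in> homs C X Y \<Longrightarrow> f \<^bold>- f = arr_zero C X Y"
  using diff_eq_iff[of f X Y f "arr_zero C X Y"] zero_add zero_hom homs_objs by metis

lemma diff_zero_iff:
  assumes "f \<in> homs C X Y" "g \<in> homs C X Y"
  shows "f \<^bold>- g = arr_zero C X Y \<longleftrightarrow> f = g"
  using diff_eq_iff[OF assms zero_hom[OF homs_objs[OF assms(1)]]] zero_add[OF assms(2)] by simp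

lemma zero_iff_idem: "f \<in> homs C X Y \<Longrightarrow> f \<^bold>+ f = f \<longleftrightarrow> f = arr_zero C X Y"
  using add_cancel[of f X Y "arr_zero C X Y" f] zero_add zero_hom homs_objs by metis

text \<open>By bilinearity the composite equals its own double, and in a group only 0 does.\<close>

lemma comp_zero:
  assumes g: "g \<in> homs C Y Z" and X: "X \<in> objs C"
  shows "g \<cdot> arr_zero C X Y = arr_zero C X Z"
proof -
  have z: "arr_zero C X Y \<in> homs C X Y"
    using zero_hom X homs_objs g by blast
  have "g \<cdot> arr_zero C X Y \<^bold>+ g \<cdot> arr_zero C X Y = g \<cdot> arr_zero C X Y"
    using comp_add_right[OF z z g] add_zero[OF z] by simp
  then show ?thesis
    using zero_iff_idem comp_hom[OF z g] by blast
qed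

lemma zero_comp:
  assumes f: "f \<in> homs C X Y" and Z: "Z \<in> objs C"
  shows "arr_zero C Y Z \<cdot> f = arr_zero C X Z"
proof -
  have z: "arr_zero C Y Z \<in> homs C Y Z"
    using zero_hom Z homs_objs f by blast
  have "arr_zero C Y Z \<cdot> f \<^bold>+ arr_zero C Y Z \<cdot> f = arr_zero C Y Z \<cdot> f"
    using comp_add_left[OF f z z] add_zero[OF z] by simp
  then show ?thesis
    using zero_iff_idem comp_hom[OF f z] by blast
qed

lemma comp_diff_right:
  assumes "f \<in> homs C X Y" "f' \<in> homs C X Y" "g \<in> homs C Y Z"
  shows "g \<cdot> (f \<^bold>- f') = g \<cdot> f \<^bold>- g \<cdot> f'"
proof -
  have d: "f \<^bold>- f' \<in> homs C X Y" using diff_hom assms by blast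
  have "g \<cdot> f = g \<cdot> (f \<^bold>- f') \<^bold>+ g \<cdot> f'"
    using comp_add_right[OF d assms(2,3)] diff_add[OF assms(1,2)] by simp
  then show ?thesis
    using diff_eq_iff[OF comp_hom[OF assms(1,3)] comp_hom[OF assms(2,3)] comp_hom[OF d assms(3)]] by simp
qed

lemma comp_diff_left:
  assumes "f \<in> homs C X Y" "g \<in> homs C Y Z" "g' \<in> homs C Y Z"
  shows "(g \<^bold>- g') \<cdot> f = g \<cdot> f \<^bold>- g' \<cdot> f"
proof -
  have d: "g \<^bold>- g' \<in> homs C Y Z" using diff_hom assms by blast
  have "g \<cdot> f = (g \<^bold>- g') \<cdot> f \<^bold>+ g' \<cdot> f"
    using comp_add_left[OF assms(1) d assms(3)] diff_add[OF assms(2,3)] by simp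
  then show ?thesis
    using diff_eq_iff[OF comp_hom[OF assms(1,2)] comp_hom[OF assms(1,3)] comp_hom[OF assms(1) d]] by simp
qed

lemma monoI:
  assumes f: "f \<in> homs C X Y"
    and 0: "\<And>W g. g \<in> homs C W X \<Longrightarrow> f \<cdot> g = arr_zero C W Y \<Longrightarrow> g = arr_zero C W X"
  shows "is_mono C f"
  unfolding mono_iff[OF f]
proof (intro allI ballI impI)
  fix W g h assume gh: "g \<in> homs C W X" "h \<in> homs C W X" "f \<cdot> g = f \<cdot> h"
  then have "f \<cdot> (g \<^bold>- h) = arr_zero C W Y"
    using comp_diff_right[OF gh(1,2) f] diff_self[OF comp_hom[OF gh(1) f]] by simp
  then show "g = h"
    using 0[OF diff_hom[OF gh(1,2)]] diff_zero_iff[OF gh(1,2)] by simp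
qed

lemma epiI:
  assumes f: "f \<in> homs C X Y"
    and 0: "\<And>Z g. g \<in> homs C Y Z \<Longrightarrow> g \<cdot> f = arr_zero C X Z \<Longrightarrow> g = arr_zero C Y Z"
  shows "is_epi C f"
  unfolding epi_iff[OF f]
proof (intro allI ballI impI)
  fix Z g h assume gh: "g \<in> homs C Y Z" "h \<in> homs C Y Z" "g \<cdot> f = h \<cdot> f"
  then have "(g \<^bold>- h) \<cdot> f = arr_zero C X Z"
    using comp_diff_left[OF f gh(1,2)] diff_self[OF comp_hom[OF f gh(1)]] by simp
  then show "g = h"
    using 0[OF diff_hom[OF gh(1,2)]] diff_zero_iff[OF gh(1,2)] by simp
qed

lemma epi_zero:
  assumes "is_epi C f" "f \<in> homs C X Y" "g \<in> homs C Y Z" "g \<cdot> f = arr_zero C X Z"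
  shows "g = arr_zero C Y Z"
  using epiD[OF assms(1-3) zero_hom[OF homs_objs(2)[OF assms(2)] homs_objs(2)[OF assms(3)]]]
    zero_comp[OF assms(2) homs_objs(2)[OF assms(3)]] assms(4) by simp

lemma kernel_mono:
  assumes "is_kernel C f k"
  shows "is_mono C k"
proof -
  have f: "f \<in> homs C (src C f) (tgt C f)"
    using assms arr_hom by (auto simp: is_kernel_def)
  note k = kernelD[OF assms f]
  show ?thesis
  proof (rule monoI[OF k(1)])
    fix W g assume g: "g \<in> homs C W (src C k)" and 0: "k \<cdot> g = arr_zero C W (src C f)"
    have W: "W \<in> objs C" using g homs_objs by blast
    have "f \<cdot> arr_zero C W (src C f) = arr_zero C W (tgt C f)"
      using comp_zero f W by blast
    then have "\<exists>!h. h \<in> homs C W (src C k) \<and> k \<cdot> h = arr_zero C W (src C f)"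
      using k(3)[OF zero_hom[OF W homs_objs(1)[OF f]]] by blast
    moreover have "k \<cdot> arr_zero C W (src C k) = arr_zero C W (src C f)"
      using comp_zero k(1) W by blast
    ultimately show "g = arr_zero C W (src C k)"
      using g 0 zero_hom W homs_objs k(1) by metis
  qed
qed

lemma cokernel_epi:
  assumes "is_cokernel C f p"
  shows "is_epi C p"
proof -
  have f: "f \<in> homs C (src C f) (tgt C f)"
    using assms arr_hom by (auto simp: is_cokernel_def)
  note p = cokernelD[OF assms f]
  show ?thesis
  proof (rule epiI[OF p(1)])
    fix W g assume g: "g \<in> homs C (tgt C p) W" and 0: "g \<cdot> p = arr_zero C (tgt C f) W"
    have W: "W \<in> objs C" using g homs_objs by blast
    have "arr_zero C (tgt C f) W \<cdot> f = arr_zero C (src C f) W"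
      using zero_comp f W by blast
    then have "\<exists>!h. h \<in> homs C (tgt C p) W \<and> h \<cdot> p = arr_zero C (tgt C f) W"
      using p(3)[OF zero_hom[OF homs_objs(2)[OF f] W]] by blast
    moreover have "arr_zero C (tgt C p) W \<cdot> p = arr_zero C (tgt C f) W"
      using zero_comp p(1) W by blast
    ultimately show "g = arr_zero C (tgt C p) W"
      using g 0 zero_hom W homs_objs p(1) by metis
  qed
qed

text \<open>Turns vanishing of an object into an equation between arrows, which can be checked after
  cancelling a mono or an epi. Later objects are shown to be zero in this way.\<close>

lemma zero_object_iff:
  assumes X: "X \<in> objs C"
  shows "is_zero_object C X \<longleftrightarrow> ident C X = arr_zero C X X"
proof
  assume "is_zero_object C X"
  then show "ident C X = arr_zero C X X"
    using X ident_hom zero_hom unfolding is_zero_object_def by metis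
next
  assume eq: "ident C X = arr_zero C X X"
  show "is_zero_object C X"
    unfolding is_zero_object_def
  proof (intro conjI ballI X)
    fix Y assume Y: "Y \<in> objs C"
    have "f = arr_zero C Y X" if "f \<in> homs C Y X" for f
      using that eq ident_left zero_comp X by metis
    then show "\<exists>!f. f \<in> homs C Y X"
      using zero_hom X Y by blast
    have "f = arr_zero C X Y" if "f \<in> homs C X Y" for f
      using that eq ident_right comp_zero X by metis
    then show "\<exists>!f. f \<in> homs C X Y"
      using zero_hom X Y by blast
  qed
qed

lemma zero_object_homs:
  assumes "is_zero_object C X"
  shows "f \<in> homs C Y X \<Longrightarrow> f = arr_zero C Y X" "f \<in> homs C X Y \<Longrightarrow> f = arr_zero C X Y"
proof -
  have X: "X \<in> objs C" using assms by (simp add: is_zero_object_def)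
  then have eq: "ident C X = arr_zero C X X" using zero_object_iff assms by blast
  show "f \<in> homs C Y X \<Longrightarrow> f = arr_zero C Y X"
    using eq ident_left zero_comp X by metis
  show "f \<in> homs C X Y \<Longrightarrow> f = arr_zero C X Y"
    using eq ident_right comp_zero X by metis
qed

end

section \<open>Normality, image factorization and pullbacks of epimorphisms\<close>

context abelian_category
begin

lemma ker_is: "f \<in> arrs C \<Longrightarrow> is_kernel C f (ker C f)"
  unfolding ker_def using kernels by (rule someI_ex)

lemma coker_is: "f \<in> arrs C \<Longrightarrow> is_cokernel C f (coker C f)"
  unfolding coker_def using cokernels by (rule someI_ex)

text \<open>\<open>m\<close> is the kernel of some \<open>f\<close>. As \<open>f\<close> kills
  \<open>m\<close>, it factors through the given cokernel \<open>p\<close>; so whatever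
  \<open>p\<close> kills is killed by \<open>f\<close> and lifts along \<open>m\<close>.\<close>

lemma mono_kernel_cokernel:
  assumes "is_mono C m" "is_cokernel C m p"
  shows "is_kernel C p m"
proof -
  have m: "m \<in> homs C (src C m) (tgt C m)"
    using assms arr_hom by (auto simp: is_mono_def)
  note p = cokernelD[OF assms(2) m]
  obtain f where fk: "is_kernel C f m" using mono_normal assms by blast
  define Z where "Z = tgt C f"
  have f: "f \<in> homs C (tgt C m) Z"
    using fk unfolding is_kernel_def Z_def by (auto simp: homs_def)
  note k = kernelD[OF fk f]
  obtain u where u: "u \<in> homs C (tgt C p) Z" "u \<cdot> p = f"
    using p(3)[OF f k(2)] by blast
  show ?thesis
  proof (rule kernelI[OF p(1) m p(2)])
    fix W g assume g: "g \<in> homs C W (tgt C m)" "p \<cdot> g = arr_zero C W (tgt C p)"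
    have "f \<cdot> g = u \<cdot> (p \<cdot> g)"
      using u comp_assoc[OF g(1) p(1) u(1)] by simp
    also have "\<dots> = arr_zero C W Z"
      using g comp_zero[OF u(1)] homs_objs by metis
    finally show "\<exists>!h. h \<in> homs C W (src C m) \<and> m \<cdot> h = g"
      using k(3) g(1) by blast
  qed
qed

lemma epi_cokernel_kernel:
  assumes "is_epi C e" "is_kernel C e k"
  shows "is_cokernel C k e"
proof -
  have e: "e \<in> homs C (src C e) (tgt C e)"
    using assms arr_hom by (auto simp: is_epi_def)
  note k = kernelD[OF assms(2) e]
  obtain f where fk: "is_cokernel C f e" using epi_normal assms by blast
  define Z where "Z = src C f"
  have f: "f \<in> homs C Z (src C e)"
    using fk unfolding is_cokernel_def Z_def by (auto simp: homs_def)
  note p = cokernelD[OF fk f]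
  obtain u where u: "u \<in> homs C Z (src C k)" "k \<cdot> u = f"
    using k(3)[OF f p(2)] by blast
  show ?thesis
  proof (rule cokernelI[OF k(1) e k(2)])
    fix W g assume g: "g \<in> homs C (src C e) W" "g \<cdot> k = arr_zero C (src C k) W"
    have "g \<cdot> f = (g \<cdot> k) \<cdot> u"
      using u comp_assoc[OF u(1) k(1) g(1)] by simp
    also have "\<dots> = arr_zero C Z W"
      using g zero_comp[OF u(1)] homs_objs by metis
    finally show "\<exists>!h. h \<in> homs C (tgt C e) W \<and> h \<cdot> e = g"
      using p(3) g(1) by blast
  qed
qed

text \<open>The point is that \<open>e\<close> is epi. If \<open>u\<close> kills \<open>e\<close>,
  then \<open>f\<close> factors through \<open>m \<cdot> k\<close> with \<open>k\<close> the kernel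
  of \<open>u\<close>. Since \<open>m\<close> is the smallest mono of this kind, it factors through
  \<open>m \<cdot> k\<close> as well; so \<open>k\<close> has a right inverse and \<open>u\<close>
  vanishes.\<close>

lemma im_factor:
  assumes f: "f \<in> homs C X Y"
  shows "im C f \<in> homs C (src C (im C f)) Y" "is_mono C (im C f)"
    "\<exists>e \<in> homs C X (src C (im C f)). is_epi C e \<and> im C f \<cdot> e = f"
    "is_kernel C (coker C f) (im C f)"
proof -
  define p where "p = coker C f"
  define P where "P = tgt C p"
  have pc: "is_cokernel C f p"
    using coker_is f by (auto simp: homs_def p_def)
  note p = cokernelD[OF pc f, folded P_def]
  define m where "m = im C f"
  define I where "I = src C m"
  have mk: "is_kernel C p m"
    unfolding m_def im_def p_def[symmetric] using ker_is p(1) by (auto simp: homs_def)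
  show "is_kernel C (coker C f) (im C f)" using mk by (simp add: m_def p_def)
  note m = kernelD[OF mk p(1), folded I_def]
  have mm: "is_mono C m" using kernel_mono mk by blast
  show "im C f \<in> homs C (src C (im C f)) Y" "is_mono C (im C f)"
    using m mm by (auto simp: m_def I_def)
  obtain e where e: "e \<in> homs C X I" "m \<cdot> e = f"
    using m(3)[OF f p(2)] by blast
  have "is_epi C e"
  proof (rule epiI[OF e(1)])
    fix Z u assume u: "u \<in> homs C I Z" and ue: "u \<cdot> e = arr_zero C X Z"
    define k where "k = ker C u"
    define K where "K = src C k"
    have kk: "is_kernel C u k" using ker_is u by (auto simp: homs_def k_def)
    note k = kernelD[OF kk u, folded K_def]
    obtain e' where e': "e' \<in> homs C X K" "k \<cdot> e' = e"
      using k(3)[OF e(1) ue] by blast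
    have mkh: "m \<cdot> k \<in> homs C K Y" using comp_hom k(1) m(1) by blast
    have mkm: "is_mono C (m \<cdot> k)"
      using mono_comp[OF k(1) m(1)] kernel_mono kk mk by blast
    define r where "r = coker C (m \<cdot> k)"
    define R where "R = tgt C r"
    have rc: "is_cokernel C (m \<cdot> k) r" using coker_is mkh by (auto simp: homs_def r_def)
    note r = cokernelD[OF rc mkh, folded R_def]
    have rk: "is_kernel C r (m \<cdot> k)" using mono_kernel_cokernel mkm rc by blast
    \<comment> \<open>\<open>r\<close> kills \<open>m \<cdot> k\<close>, hence \<open>f\<close>; so
      it factors through the cokernel \<open>p\<close> of \<open>f\<close> and kills
      \<open>m\<close>. As \<open>m \<cdot> k\<close> is the kernel of \<open>r\<close>, this puts
      \<open>m\<close> inside it.\<close>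
    have "r \<cdot> f = (r \<cdot> (m \<cdot> k)) \<cdot> e'"
      using e e' comp_assoc[OF e'(1) mkh r(1)] comp_assoc[OF e'(1) k(1) m(1)] by simp
    also have "\<dots> = arr_zero C X R"
      using r(1,2) zero_comp[OF e'(1)] homs_objs by metis
    finally obtain r' where r': "r' \<in> homs C P R" "r' \<cdot> p = r"
      using p(3) r(1) by blast
    have "r \<cdot> m = r' \<cdot> (p \<cdot> m)"
      using r' comp_assoc[OF m(1) p(1) r'(1)] by simp
    also have "\<dots> = arr_zero C I R"
      using m(1,2) comp_zero[OF r'(1)] homs_objs by metis
    finally obtain l where l: "l \<in> homs C I K" "(m \<cdot> k) \<cdot> l = m"
      using kernelD(3)[OF rk r(1) m(1)] hom_arr(2)[OF mkh] by metis
    have "m \<cdot> (k \<cdot> l) = m \<cdot> ident C I"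
      using l comp_assoc[OF l(1) k(1) m(1)] ident_right[OF m(1)] by simp
    then have kl: "k \<cdot> l = ident C I"
      using monoD[OF mm m(1) comp_hom[OF l(1) k(1)]] ident_hom homs_objs m(1) by blast
    have "u = u \<cdot> (k \<cdot> l)" using kl ident_right[OF u] by simp
    also have "\<dots> = (u \<cdot> k) \<cdot> l" using comp_assoc[OF l(1) k(1) u] by simp
    also have "\<dots> = arr_zero C I Z" using k(2) zero_comp[OF l(1)] u homs_objs by metis
    finally show "u = arr_zero C I Z" .
  qed
  then show "\<exists>e \<in> homs C X (src C (im C f)). is_epi C e \<and> im C f \<cdot> e = f"
    using e by (auto simp: m_def I_def)
qed

text \<open>The pullback is the kernel \<open>k\<close> of the difference \<open>d\<close> of the
  two maps from the biproduct to Z. \<open>d\<close> restricts to \<open>f\<close> on X, so it is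
  epi and the cokernel of \<open>k\<close>. If \<open>u\<close> kills \<open>q \<cdot> k\<close>,
  then \<open>u \<cdot> q = v \<cdot> d\<close>; restricting to X gives \<open>v\<close> = 0, and
  then restricting to Y gives \<open>u\<close> = 0.\<close>

lemma pullback_epi:
  assumes f: "f \<in> homs C X Z" and g: "g \<in> homs C Y Z" and ep: "is_epi C f"
  shows "\<exists>P c x. c \<in> homs C P Y \<and> is_epi C c \<and> x \<in> homs C P X \<and> f \<cdot> x = g \<cdot> c"
proof -
  have ob: "X \<in> objs C" "Y \<in> objs C" "Z \<in> objs C" using f g homs_objs by blast+
  obtain B i j p q where b: "is_biproduct C X Y B i j p q"
    using biproducts ob by blast
  then have i: "i \<in> homs C X B" and j: "j \<in> homs C Y B" and p: "p \<in> homs C B X" and q: "q \<in> homs C B Y"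
    and pi: "p \<cdot> i = ident C X" and qj: "q \<cdot> j = ident C Y"
    and s: "i \<cdot> p \<^bold>+ j \<cdot> q = ident C B" and B: "B \<in> objs C"
    by (auto simp: is_biproduct_def)
  have ip: "i \<cdot> p \<in> homs C B B" and jq: "j \<cdot> q \<in> homs C B B" using comp_hom i j p q by blast+
  \<comment> \<open>\<open>is_biproduct\<close> does not state that the two summands are orthogonal.
    It follows by composing \<open>q\<close> with the decomposition of the identity and cancelling
    \<open>q\<close>.\<close>
  have "q \<cdot> i = arr_zero C X Y"
  proof -
    have qi: "q \<cdot> i \<in> homs C X Y" using comp_hom i q by blast
    have "q = q \<cdot> (i \<cdot> p) \<^bold>+ q \<cdot> (j \<cdot> q)"
      using comp_add_right[OF ip jq q] s ident_right[OF q] by simp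
    also have "q \<cdot> (j \<cdot> q) = q"
      using comp_assoc[OF q j q] qj ident_left[OF q] by simp
    also have "q \<cdot> (i \<cdot> p) = (q \<cdot> i) \<cdot> p" using comp_assoc[OF p i q] by simp
    finally have "(q \<cdot> i) \<cdot> p \<^bold>+ q = q" by simp
    then have "(q \<cdot> i) \<cdot> p = arr_zero C B Y"
      using add_cancel[OF comp_hom[OF p qi] zero_hom[OF B ob(2)] q] zero_add[OF q] by simp
    then have "((q \<cdot> i) \<cdot> p) \<cdot> i = arr_zero C X Y"
      using zero_comp[OF i ob(2)] by simp
    then show ?thesis
      using comp_assoc[OF i p qi] pi ident_right[OF qi] by simp
  qed
  note qi = this
  define d where "d = f \<cdot> p \<^bold>- g \<cdot> q"
  have fp: "f \<cdot> p \<in> homs C B Z" and gq: "g \<cdot> q \<in> homs C B Z" using comp_hom f g p q by blast+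
  have d: "d \<in> homs C B Z" unfolding d_def using diff_hom fp gq by blast
  have di: "d \<cdot> i = f"
  proof -
    have "(f \<cdot> p) \<cdot> i = f" using comp_assoc[OF i p f] pi ident_right[OF f] by simp
    moreover have "(g \<cdot> q) \<cdot> i = arr_zero C X Z"
      using comp_assoc[OF i q g] qi comp_zero[OF g ob(1)] by simp
    ultimately show ?thesis
      unfolding d_def comp_diff_left[OF i fp gq]
      using diff_eq_iff[OF f zero_hom[OF ob(1,3)] f] add_zero[OF f] by simp
  qed
  have de: "is_epi C d" using epi_of_comp[OF i d] di ep by simp
  define k where "k = ker C d"
  define K where "K = src C k"
  have kk: "is_kernel C d k" using ker_is d by (auto simp: homs_def k_def)
  note k = kernelD[OF kk d, folded K_def]
  have dc: "is_cokernel C k d" using epi_cokernel_kernel de kk by blast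
  have qk: "q \<cdot> k \<in> homs C K Y" and pk: "p \<cdot> k \<in> homs C K X" using comp_hom k p q by blast+
  have "is_epi C (q \<cdot> k)"
  proof (rule epiI[OF qk])
    fix W u assume u: "u \<in> homs C Y W" and 0: "u \<cdot> (q \<cdot> k) = arr_zero C K W"
    have W: "W \<in> objs C" using u homs_objs by blast
    have uq: "u \<cdot> q \<in> homs C B W" using comp_hom u q by blast
    have "(u \<cdot> q) \<cdot> k = arr_zero C K W" using comp_assoc[OF k(1) q u] 0 by simp
    then obtain v where v: "v \<in> homs C Z W" "v \<cdot> d = u \<cdot> q"
      using cokernelD(3)[OF dc k(1) uq] d by (auto simp: homs_def)
    have "v \<cdot> f = (u \<cdot> q) \<cdot> i" using v di comp_assoc[OF i d v(1)] by simp
    also have "\<dots> = arr_zero C X W" using comp_assoc[OF i q u] qi comp_zero[OF u ob(1)] by simp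
    finally have "v = arr_zero C Z W" using epi_zero[OF ep f v(1)] by blast
    then have uq0: "u \<cdot> q = arr_zero C B W" using v(2) zero_comp[OF d W] by simp
    have "u = (u \<cdot> q) \<cdot> j" using comp_assoc[OF j q u] qj ident_right[OF u] by simp
    then show "u = arr_zero C Y W" using uq0 zero_comp[OF j W] by simp
  qed
  moreover have "f \<cdot> (p \<cdot> k) = g \<cdot> (q \<cdot> k)"
  proof -
    have "(f \<cdot> p) \<cdot> k \<^bold>- (g \<cdot> q) \<cdot> k = arr_zero C K Z"
      using k(2) comp_diff_left[OF k(1) fp gq] by (simp add: d_def)
    then have "(f \<cdot> p) \<cdot> k = (g \<cdot> q) \<cdot> k"
      using diff_zero_iff[OF comp_hom[OF k(1) fp] comp_hom[OF k(1) gq]] by simp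
    then show ?thesis using comp_assoc[OF k(1) p f] comp_assoc[OF k(1) q g] by simp
  qed
  ultimately show ?thesis using qk pk by blast
qed

end

section \<open>Smallness, products and limits\<close>

lemma small_lepoll:
  assumes "A \<lesssim> B" "small U B"
  shows "small U A"
  using assms lesspoll_trans1 unfolding small_def by blast

lemma small_subset: "A \<subseteq> B \<Longrightarrow> small U B \<Longrightarrow> small U A"
  using small_lepoll subset_imp_lepoll by blast

lemma small_image: "small U A \<Longrightarrow> small U (f ` A)"
  using small_lepoll image_lepoll by blast

text \<open>The assumptions on products and coproducts speak of index sets inside 'u. This moves any
  other small index set there: the naturals, sets of pairs of ordinals, sets of subsets.\<close>

lemma small_reindex:
  assumes "small TYPE('u) (I :: 'i set)"
  obtains g and J :: "'u set" where "bij_betw g J I" "small TYPE('u) J"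
proof -
  obtain f :: "'i \<Rightarrow> 'u" where f: "inj_on f I"
    using assms unfolding small_def lesspoll_def lepoll_def by blast
  show ?thesis
    using that[of "the_inv_into I f" "f ` I"] bij_betw_the_inv_into[of f I "f ` I"] f
      small_image[OF assms] by (auto simp: bij_betw_def)
qed

lemma universe_nat_small:
  assumes "universe TYPE('u::wellorder)"
  shows "small TYPE('u) (I :: nat set)"
proof -
  have u: "uncountable (UNIV :: 'u set)" using assms by (simp add: universe_def)
  then have "\<not> (UNIV :: nat set) \<approx> (UNIV :: 'u set)"
    using countable_lepoll[of "UNIV::nat set" "UNIV :: 'u set"] eqpoll_imp_lepoll eqpoll_sym
    by auto
  moreover have "(UNIV :: nat set) \<lesssim> (UNIV :: 'u set)"
    using uncountable_infinite[OF u] infinite_le_lepoll[THEN iffD1] by blast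
  ultimately have "small TYPE('u) (UNIV :: nat set)" by (simp add: small_def lesspoll_def)
  then show ?thesis by (rule small_subset[OF subset_UNIV])
qed

lemma universe_bounded:
  assumes "universe TYPE('u::wellorder)" "small TYPE('u) (I :: 'u set)"
  obtains \<alpha> where "I \<subseteq> {..<\<alpha>}"
  using assms unfolding universe_def by blast

text \<open>A small set is carried into an initial segment of 'u, where the strong limit clause of
  \<open>universe\<close> applies.\<close>

lemma universe_small_Pow:
  assumes U: "universe TYPE('u::wellorder)" and I: "small TYPE('u) (I :: 'i set)"
  shows "small TYPE('u) (Pow I)"
proof -
  obtain g and J :: "'u set" where g: "bij_betw g J I" and J: "small TYPE('u) J"
    using small_reindex[OF I] by blast
  obtain \<alpha> where "J \<subseteq> {..<\<alpha>}" using universe_bounded[OF U J] by blast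
  moreover have "small TYPE('u) (Pow {..<\<alpha>})" using U by (simp add: universe_def)
  ultimately have "small TYPE('u) (Pow J)" using small_subset by (meson Pow_mono)
  moreover have "Pow I = image g ` Pow J"
    using g by (metis bij_betw_def image_Pow_surj)
  ultimately show ?thesis using small_image by metis
qed

section \<open>Products and coproducts through their universal properties\<close>

context category
begin

lemma productD:
  assumes "is_product C I X P \<pi>"
  shows "P \<in> objs C" "\<And>i. i \<in> I \<Longrightarrow> \<pi> i \<in> homs C P (X i)"
    "\<And>Y f. Y \<in> objs C \<Longrightarrow> (\<And>i. i \<in> I \<Longrightarrow> f i \<in> homs C Y (X i)) \<Longrightarrow>
       \<exists>h\<in>homs C Y P. \<forall>i\<in>I. \<pi> i \<cdot> h = f i"
  using assms unfolding is_product_def Ex1_def by blast+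

lemma product_ex1:
  assumes "is_product C I X P \<pi>" "Y \<in> objs C" "\<And>i. i \<in> I \<Longrightarrow> f i \<in> homs C Y (X i)"
  shows "\<exists>!h. h \<in> homs C Y P \<and> (\<forall>i\<in>I. \<pi> i \<cdot> h = f i)"
  using assms by (simp add: is_product_def)

lemma product_ext:
  assumes P: "is_product C I X P \<pi>" and g: "g \<in> homs C Y P" and h: "h \<in> homs C Y P"
    and eq: "\<And>i. i \<in> I \<Longrightarrow> \<pi> i \<cdot> g = \<pi> i \<cdot> h"
  shows "g = h"
proof -
  have "\<exists>!k. k \<in> homs C Y P \<and> (\<forall>i\<in>I. \<pi> i \<cdot> k = \<pi> i \<cdot> g)"
    by (rule product_ex1[OF P homs_objs(1)[OF g] comp_hom[OF g productD(2)[OF P]]])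
  then obtain k where k: "\<And>y. y \<in> homs C Y P \<Longrightarrow> (\<forall>i\<in>I. \<pi> i \<cdot> y = \<pi> i \<cdot> g) \<Longrightarrow> y = k"
    by (elim ex1E) blast
  have "g = k" by (rule k[OF g]) simp
  moreover have "h = k" by (rule k[OF h]) (simp add: eq)
  ultimately show ?thesis by simp
qed

lemma coproductD:
  assumes "is_coproduct C I X P \<iota>"
  shows "P \<in> objs C" "\<And>i. i \<in> I \<Longrightarrow> \<iota> i \<in> homs C (X i) P"
    "\<And>Y f. Y \<in> objs C \<Longrightarrow> (\<And>i. i \<in> I \<Longrightarrow> f i \<in> homs C (X i) Y) \<Longrightarrow>
       \<exists>h\<in>homs C P Y. \<forall>i\<in>I. h \<cdot> \<iota> i = f i"
  using assms unfolding is_coproduct_def Ex1_def by blast+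

lemma coproduct_ex1:
  assumes "is_coproduct C I X P \<iota>" "Y \<in> objs C" "\<And>i. i \<in> I \<Longrightarrow> f i \<in> homs C (X i) Y"
  shows "\<exists>!h. h \<in> homs C P Y \<and> (\<forall>i\<in>I. h \<cdot> \<iota> i = f i)"
  using assms by (simp add: is_coproduct_def)

lemma coproduct_ext:
  assumes P: "is_coproduct C I X P \<iota>" and g: "g \<in> homs C P Y" and h: "h \<in> homs C P Y"
    and eq: "\<And>i. i \<in> I \<Longrightarrow> g \<cdot> \<iota> i = h \<cdot> \<iota> i"
  shows "g = h"
proof -
  have "\<exists>!k. k \<in> homs C P Y \<and> (\<forall>i\<in>I. k \<cdot> \<iota> i = g \<cdot> \<iota> i)"
    by (rule coproduct_ex1[OF P homs_objs(2)[OF g] comp_hom[OF coproductD(2)[OF P] g]])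
  then obtain k where k: "\<And>y. y \<in> homs C P Y \<Longrightarrow> (\<forall>i\<in>I. y \<cdot> \<iota> i = g \<cdot> \<iota> i) \<Longrightarrow> y = k"
    by (elim ex1E) blast
  have "g = k" by (rule k[OF g]) simp
  moreover have "h = k" by (rule k[OF h]) (simp add: eq)
  ultimately show ?thesis by simp
qed

lemma product_reindex:
  assumes P: "is_product C I X P \<pi>" and g: "bij_betw g J I"
  shows "is_product C J (X \<circ> g) P (\<pi> \<circ> g)"
  unfolding is_product_def
proof (intro conjI ballI allI impI)
  show "P \<in> objs C" by (rule productD(1)[OF P])
  show "(\<pi> \<circ> g) j \<in> homs C P ((X \<circ> g) j)" if "j \<in> J" for j
    using productD(2)[OF P] g that by (auto simp: bij_betw_def)
  fix Y f assume Y: "Y \<in> objs C" and f: "\<forall>j\<in>J. f j \<in> homs C Y ((X \<circ> g) j)"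
  define f' where "f' = f \<circ> the_inv_into J g"
  have f'g: "f' (g j) = f j" if "j \<in> J" for j
    using that g by (auto simp: f'_def bij_betw_def the_inv_into_f_f)
  have I: "I = g ` J" using g by (simp add: bij_betw_def)
  have f': "f' i \<in> homs C Y (X i)" if "i \<in> I" for i using that f f'g I by auto
  have "\<exists>!h. h \<in> homs C Y P \<and> (\<forall>i\<in>I. \<pi> i \<cdot> h = f' i)"
    by (rule product_ex1[OF P Y f'])
  moreover have "(\<forall>i\<in>I. \<pi> i \<cdot> h = f' i) \<longleftrightarrow> (\<forall>j\<in>J. (\<pi> \<circ> g) j \<cdot> h = f j)" for h
    using f'g I by auto
  ultimately show "\<exists>!h. h \<in> homs C Y P \<and> (\<forall>j\<in>J. (\<pi> \<circ> g) j \<cdot> h = f j)" by simp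
qed

lemma product_reindex_inv:
  assumes P: "is_product C J (X \<circ> g) P \<pi>" and g: "bij_betw g J I"
  shows "is_product C I X P (\<pi> \<circ> the_inv_into J g)"
proof -
  have "is_product C I ((X \<circ> g) \<circ> the_inv_into J g) P (\<pi> \<circ> the_inv_into J g)"
    by (rule product_reindex[OF P bij_betw_the_inv_into[OF g]])
  moreover have "((X \<circ> g) \<circ> the_inv_into J g) i = X i" if "i \<in> I" for i
    using that g f_the_inv_into_f_bij_betw by fastforce
  ultimately show ?thesis unfolding is_product_def by simp
qed

end

locale complete_abelian_category = abelian_category C for C :: "('o, 'm) precat" (structure) +
  fixes U :: "'u::wellorder itself"
  assumes univ: "universe TYPE('u)"
    and locally_small: "locally_small TYPE('u) C"
    and generator: "\<exists>G. is_generator C G"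
    and coproducts: "has_small_coproducts TYPE('u) C"
    and products: "has_small_products TYPE('u) C"
    and products_exact: "small_products_exact TYPE('u) C"
begin

lemma product_exists:
  assumes I: "small TYPE('u) (I :: 'i set)" and X: "\<And>i. i \<in> I \<Longrightarrow> X i \<in> objs C"
  shows "\<exists>P \<pi>. is_product C I X P \<pi>"
proof -
  obtain g and J :: "'u set" where g: "bij_betw g J I" and J: "small TYPE('u) J"
    using small_reindex[OF I] by blast
  have "\<forall>j\<in>J. (X \<circ> g) j \<in> objs C" using X g by (auto simp: bij_betw_def)
  then obtain P \<pi> where "is_product C J (X \<circ> g) P \<pi>"
    using products J unfolding has_small_products_def by blast
  then show ?thesis using product_reindex_inv g by blast
qed

text \<open>Exactness is assumed for short exact sequences, so each \<open>f i\<close> is completed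
  by its kernel; the product of the kernels then exhibits \<open>F\<close> as a cokernel.\<close>

lemma product_epi:
  assumes I: "small TYPE('u) (I :: 'i set)"
    and f: "\<And>i. i \<in> I \<Longrightarrow> f i \<in> homs C (X i) (Y i)" "\<And>i. i \<in> I \<Longrightarrow> is_epi C (f i)"
    and P: "is_product C I X P \<pi>" and Q: "is_product C I Y Q \<rho>"
    and F: "F \<in> homs C P Q" "\<And>i. i \<in> I \<Longrightarrow> \<rho> i \<cdot> F = f i \<cdot> \<pi> i"
  shows "is_epi C F"
proof -
  obtain g and J :: "'u set" where g: "bij_betw g J I" and J: "small TYPE('u) J"
    using small_reindex[OF I] by blast
  have gI: "g j \<in> I" if "j \<in> J" for j using that g by (auto simp: bij_betw_def)
  define k where "k j = ker C (f (g j))" for j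
  define K where "K j = src C (k j)" for j
  have kk: "is_kernel C (f (g j)) (k j)" if "j \<in> J" for j
    unfolding k_def using ker_is f(1) gI that hom_arr(1) by blast
  have k: "k j \<in> homs C (K j) (X (g j))" if "j \<in> J" for j
    unfolding K_def using kernelD(1)[OF kk] f(1) gI that by blast
  have ex: "short_exact C (k j) (f (g j))" if "j \<in> J" for j
    using kk epi_cokernel_kernel f(2) gI that unfolding short_exact_def by blast
  have "\<And>j. j \<in> J \<Longrightarrow> K j \<in> objs C" using k homs_objs by blast
  then obtain N \<nu> where N: "is_product C J K N \<nu>" using product_exists[OF J] by blast
  note P' = product_reindex[OF P g] and Q' = product_reindex[OF Q g]
  have "\<exists>h\<in>homs C N P. \<forall>j\<in>J. (\<pi> \<circ> g) j \<cdot> h = k j \<cdot> \<nu> j"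
    by (rule productD(3)[OF P' productD(1)[OF N]])
      (use comp_hom productD(2)[OF N] k in fastforce)
  then obtain h where h: "h \<in> homs C N P" "\<And>j. j \<in> J \<Longrightarrow> (\<pi> \<circ> g) j \<cdot> h = k j \<cdot> \<nu> j"
    by blast
  have "short_exact C h F"
    using products_exact[unfolded small_products_exact_def, rule_format,
        of J k K "X \<circ> g" "f \<circ> g" "Y \<circ> g" N \<nu> P "\<pi> \<circ> g" Q "\<rho> \<circ> g" h F]
      J k f(1) gI ex N P' Q' h F by auto
  then show ?thesis unfolding short_exact_def using cokernel_epi by blast
qed

text \<open>The limit is the equalizer of two maps from the product of the objects to the product
  over all pairs \<beta> \<le> \<gamma>: \<open>d\<close> applies the transition map to the later
  coordinate, \<open>d'\<close> reads off the earlier one.\<close>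

lemma limit_exists:
  assumes J: "small TYPE('u) (J :: 'u set)"
    and X: "\<And>\<beta>. \<beta> \<in> J \<Longrightarrow> X \<beta> \<in> objs C"
    and t: "\<And>\<beta> \<gamma>. \<beta> \<in> J \<Longrightarrow> \<gamma> \<in> J \<Longrightarrow> \<beta> \<le> \<gamma> \<Longrightarrow> t \<beta> \<gamma> \<in> homs C (X \<gamma>) (X \<beta>)"
  shows "\<exists>L \<pi>. is_limit C J X t L \<pi>"
proof -
  define E where "E = {(\<beta>, \<gamma>). \<beta> \<in> J \<and> \<gamma> \<in> J \<and> \<beta> \<le> \<gamma>}"
  \<comment> \<open>A pair with \<beta> \<le> \<gamma> is determined by its underlying set, so the
    pairs embed in \<open>Pow J\<close>, which is small.\<close>
  have "inj_on (\<lambda>(\<beta>, \<gamma>). {\<beta>, \<gamma>}) E"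
    unfolding E_def inj_on_def by (auto simp: doubleton_eq_iff)
  moreover have "(\<lambda>(\<beta>, \<gamma>). {\<beta>, \<gamma>}) ` E \<subseteq> Pow J" by (auto simp: E_def)
  ultimately have E: "small TYPE('u) E"
    using small_lepoll[OF _ universe_small_Pow[OF univ J]] unfolding lepoll_def by blast
  obtain P pr where P: "is_product C J X P pr" using product_exists[OF J] X by blast
  have "\<And>e. e \<in> E \<Longrightarrow> X (fst e) \<in> objs C" using X by (auto simp: E_def)
  then obtain R \<rho> where R: "is_product C E (\<lambda>e. X (fst e)) R \<rho>" using product_exists[OF E] by metis
  have E': "fst e \<in> J" "snd e \<in> J" "fst e \<le> snd e" if "e \<in> E" for e using that by (auto simp: E_def)
  have tp: "t (fst e) (snd e) \<cdot> pr (snd e) \<in> homs C P (X (fst e))" if "e \<in> E" for e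
    using comp_hom[OF productD(2)[OF P] t] E' that by blast
  obtain d where d: "d \<in> homs C P R" "\<And>e. e \<in> E \<Longrightarrow> \<rho> e \<cdot> d = t (fst e) (snd e) \<cdot> pr (snd e)"
    using productD(3)[OF R productD(1)[OF P], of "\<lambda>e. t (fst e) (snd e) \<cdot> pr (snd e)"] tp by blast
  obtain d' where d': "d' \<in> homs C P R" "\<And>e. e \<in> E \<Longrightarrow> \<rho> e \<cdot> d' = pr (fst e)"
    using productD(3)[OF R productD(1)[OF P], of "\<lambda>e. pr (fst e)"] productD(2)[OF P] E' by blast
  have dd: "d \<^bold>- d' \<in> homs C P R" using diff_hom d d' by blast
  define k where "k = ker C (d \<^bold>- d')"
  define L where "L = src C k"
  have kk: "is_kernel C (d \<^bold>- d') k" unfolding k_def using ker_is dd hom_arr by blast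
  note k = kernelD[OF kk dd, folded L_def]
  have L: "L \<in> objs C" using homs_objs k by blast
  have eq_iff: "(d \<^bold>- d') \<cdot> x = arr_zero C Y R \<longleftrightarrow>
      (\<forall>\<beta>\<in>J. \<forall>\<gamma>\<in>J. \<beta> \<le> \<gamma> \<longrightarrow> t \<beta> \<gamma> \<cdot> (pr \<gamma> \<cdot> x) = pr \<beta> \<cdot> x)" if x: "x \<in> homs C Y P" for x Y
  proof -
    have dx: "d \<cdot> x \<in> homs C Y R" "d' \<cdot> x \<in> homs C Y R" using comp_hom x d d' by blast+
    have "(d \<^bold>- d') \<cdot> x = arr_zero C Y R \<longleftrightarrow> d \<cdot> x = d' \<cdot> x"
      using comp_diff_left[OF x d(1) d'(1)] diff_zero_iff[OF dx] by simp
    also have "\<dots> \<longleftrightarrow> (\<forall>e\<in>E. \<rho> e \<cdot> (d \<cdot> x) = \<rho> e \<cdot> (d' \<cdot> x))"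
      using product_ext[OF R dx] by auto
    also have "\<dots> \<longleftrightarrow> (\<forall>e\<in>E. t (fst e) (snd e) \<cdot> (pr (snd e) \<cdot> x) = pr (fst e) \<cdot> x)"
    proof (rule ball_cong[OF refl])
      fix e assume e: "e \<in> E"
      have "\<rho> e \<cdot> (d \<cdot> x) = t (fst e) (snd e) \<cdot> (pr (snd e) \<cdot> x)"
        using comp_assoc[OF x d(1) productD(2)[OF R e]] d(2)[OF e]
          comp_assoc[OF x productD(2)[OF P] t] E'[OF e] by simp
      moreover have "\<rho> e \<cdot> (d' \<cdot> x) = pr (fst e) \<cdot> x"
        using comp_assoc[OF x d'(1) productD(2)[OF R e]] d'(2)[OF e] by simp
      ultimately show "\<rho> e \<cdot> (d \<cdot> x) = \<rho> e \<cdot> (d' \<cdot> x) \<longleftrightarrow>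
          t (fst e) (snd e) \<cdot> (pr (snd e) \<cdot> x) = pr (fst e) \<cdot> x" by simp
    qed
    finally show ?thesis by (auto simp: E_def)
  qed
  have "is_limit C J X t L (\<lambda>\<beta>. pr \<beta> \<cdot> k)"
    unfolding is_limit_def
  proof (intro conjI allI impI)
    show "is_cone C J X t L (\<lambda>\<beta>. pr \<beta> \<cdot> k)"
      using L comp_hom[OF k(1) productD(2)[OF P]] eq_iff[OF k(1)] k(2) unfolding is_cone_def by auto
    fix Y \<phi> assume cone: "is_cone C J X t Y \<phi>"
    then have Y: "Y \<in> objs C" and \<phi>: "\<And>\<beta>. \<beta> \<in> J \<Longrightarrow> \<phi> \<beta> \<in> homs C Y (X \<beta>)"
      and c: "\<And>\<beta> \<gamma>. \<beta> \<in> J \<Longrightarrow> \<gamma> \<in> J \<Longrightarrow> \<beta> \<le> \<gamma> \<Longrightarrow> t \<beta> \<gamma> \<cdot> \<phi> \<gamma> = \<phi> \<beta>"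
      unfolding is_cone_def by blast+
    obtain x where x: "x \<in> homs C Y P" "\<And>\<beta>. \<beta> \<in> J \<Longrightarrow> pr \<beta> \<cdot> x = \<phi> \<beta>"
      using productD(3)[OF P Y \<phi>] by blast
    have "(d \<^bold>- d') \<cdot> x = arr_zero C Y R" using eq_iff[OF x(1)] x(2) c by simp
    then obtain h where h: "h \<in> homs C Y L" "k \<cdot> h = x" using k(3)[OF x(1)] by blast
    show "\<exists>!h. h \<in> homs C Y L \<and> (\<forall>\<beta>\<in>J. (pr \<beta> \<cdot> k) \<cdot> h = \<phi> \<beta>)"
    proof (rule ex1I[of _ h])
      show "h \<in> homs C Y L \<and> (\<forall>\<beta>\<in>J. (pr \<beta> \<cdot> k) \<cdot> h = \<phi> \<beta>)"
        using h x(2) comp_assoc[OF h(1) k(1) productD(2)[OF P]] by simp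
      fix h' assume h': "h' \<in> homs C Y L \<and> (\<forall>\<beta>\<in>J. (pr \<beta> \<cdot> k) \<cdot> h' = \<phi> \<beta>)"
      then have h'': "h' \<in> homs C Y L" by blast
      have "pr \<beta> \<cdot> (k \<cdot> h') = pr \<beta> \<cdot> x" if "\<beta> \<in> J" for \<beta>
        using h' that x(2) comp_assoc[OF h'' k(1) productD(2)[OF P that]] by simp
      then have "k \<cdot> h' = x" using product_ext[OF P comp_hom[OF h'' k(1)] x(1)] by blast
      then show "h' = h"
        using monoD[OF kernel_mono[OF kk] k(1) h'' h(1)] h(2) by simp
    qed
  qed
  then show ?thesis by blast
qed

text \<open>Projectivity relative to the single target X. Being epi is not part of the notion, so
  that zero maps and differences of universal maps qualify too.\<close>

definition universal :: "'m \<Rightarrow> 'o \<Rightarrow> 'o \<Rightarrow> bool" where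
  "universal t T X \<longleftrightarrow> t \<in> homs C T X \<and>
     (\<forall>E. \<forall>e\<in>homs C E X. is_epi C e \<longrightarrow> (\<exists>s\<in>homs C T E. e \<cdot> s = t))"

lemma universal_cover:
  assumes X: "X \<in> objs C"
  shows "\<exists>W w. universal w W X \<and> is_epi C w"
proof -
  obtain G where gen: "is_generator C G" using generator by blast
  then have G: "G \<in> objs C" by (simp add: is_generator_def)
  have "small TYPE('u) (homs C G X)"
    using locally_small G X by (simp add: locally_small_def)
  then obtain \<phi> and J :: "'u set" where \<phi>: "bij_betw \<phi> J (homs C G X)" and J: "small TYPE('u) J"
    using small_reindex by blast
  have \<phi>X: "\<phi> j \<in> homs C G X" if "j \<in> J" for j using \<phi> that by (auto simp: bij_betw_def)
  have "\<exists>P \<iota> c. is_coproduct C K (\<lambda>_. G) P \<iota> \<and> c \<in> homs C P X \<and> (\<forall>j\<in>K. c \<cdot> \<iota> j = \<phi> j)"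
    if K: "K \<subseteq> J" for K
  proof -
    have "\<forall>i\<in>K. G \<in> objs C" using G by blast
    then obtain P \<iota> where P: "is_coproduct C K (\<lambda>_. G) P \<iota>"
      using coproducts small_subset[OF K J] unfolding has_small_coproducts_def by meson
    then show ?thesis using coproductD(3)[OF P X, of \<phi>] \<phi>X K by blast
  qed
  then obtain P \<iota> c where P: "\<And>K. K \<subseteq> J \<Longrightarrow> is_coproduct C K (\<lambda>_. G) (P K) (\<iota> K)"
    and c: "\<And>K. K \<subseteq> J \<Longrightarrow> c K \<in> homs C (P K) X"
    and c\<iota>: "\<And>K j. K \<subseteq> J \<Longrightarrow> j \<in> K \<Longrightarrow> c K \<cdot> \<iota> K j = \<phi> j"
    by metis
  define \<K> where "\<K> = {K. K \<subseteq> J \<and> is_epi C (c K)}"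
  have sm: "small TYPE('u) \<K>"
    by (rule small_subset[OF _ universe_small_Pow[OF univ J]]) (auto simp: \<K>_def)
  have cK: "c K \<in> homs C (P K) X" "is_epi C (c K)" if "K \<in> \<K>" for K
    using that c by (auto simp: \<K>_def)
  obtain Q \<pi> where Q: "is_product C \<K> P Q \<pi>"
    using product_exists[OF sm] homs_objs(1)[OF cK(1)] by metis
  obtain R \<rho> where R: "is_product C \<K> (\<lambda>_. X) R \<rho>"
    using product_exists[OF sm] X by metis
  obtain F where F: "F \<in> homs C Q R" "\<And>K. K \<in> \<K> \<Longrightarrow> \<rho> K \<cdot> F = c K \<cdot> \<pi> K"
    using productD(3)[OF R productD(1)[OF Q], of "\<lambda>K. c K \<cdot> \<pi> K"]
      comp_hom[OF productD(2)[OF Q] cK(1)] by metis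
  have Fe: "is_epi C F"
    by (rule product_epi[OF sm cK Q R F])
  \<comment> \<open>The fibre product of all \<open>c K\<close> over X is the pullback of their
    product along the diagonal, and it is epi over X because the product is.\<close>
  obtain \<Delta> where \<Delta>: "\<Delta> \<in> homs C X R" "\<And>K. K \<in> \<K> \<Longrightarrow> \<rho> K \<cdot> \<Delta> = ident C X"
    using productD(3)[OF R X, of "\<lambda>_. ident C X"] ident_hom[OF X] by metis
  obtain W w x where w: "w \<in> homs C W X" "is_epi C w" and x: "x \<in> homs C W Q" and Fx: "F \<cdot> x = \<Delta> \<cdot> w"
    using pullback_epi[OF F(1) \<Delta>(1) Fe] by blast
  have wK: "w = c K \<cdot> (\<pi> K \<cdot> x)" if K: "K \<in> \<K>" for K
  proof -
    have "w = \<rho> K \<cdot> (\<Delta> \<cdot> w)"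
      using comp_assoc[OF w(1) \<Delta>(1) productD(2)[OF R K]] \<Delta>(2)[OF K] ident_left[OF w(1)] by simp
    also have "\<dots> = \<rho> K \<cdot> (F \<cdot> x)" using Fx by simp
    also have "\<dots> = c K \<cdot> (\<pi> K \<cdot> x)"
      using comp_assoc[OF x F(1) productD(2)[OF R K]] F(2)[OF K]
        comp_assoc[OF x productD(2)[OF Q K] cK(1)[OF K]] by simp
    finally show ?thesis .
  qed
  have "\<exists>s\<in>homs C W E. e \<cdot> s = w" if e: "e \<in> homs C E X" and ee: "is_epi C e" for E e
  proof -
    have E: "E \<in> objs C" using homs_objs e by blast
    \<comment> \<open>The points G -> X that lift to \<open>E\<close>. They cover X: a map killing
      them kills the composites of \<open>e\<close> with all points of \<open>E\<close>, hence kills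
      \<open>e\<close>, hence is zero. Their chosen lifts assemble to a map from the coproduct to
      \<open>E\<close> over X.\<close>
    define K where "K = {j \<in> J. \<exists>g\<in>homs C G E. e \<cdot> g = \<phi> j}"
    have KJ: "K \<subseteq> J" by (auto simp: K_def)
    note PK = P[OF KJ] and cKK = c[OF KJ] and c\<iota>K = c\<iota>[OF KJ]
    have "is_epi C (c K)"
    proof (rule epiI[OF cKK])
      fix Z u assume u: "u \<in> homs C X Z" and uc: "u \<cdot> c K = arr_zero C (P K) Z"
      have Z: "Z \<in> objs C" using u homs_objs by blast
      have ue: "u \<cdot> e \<in> homs C E Z" using comp_hom e u by blast
      have "(u \<cdot> e) \<cdot> g = arr_zero C E Z \<cdot> g" if g: "g \<in> homs C G E" for g
      proof -
        have eg: "e \<cdot> g \<in> homs C G X" using comp_hom g e by blast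
        then obtain j where j: "j \<in> J" "\<phi> j = e \<cdot> g" using \<phi> by (metis bij_betw_def imageE)
        then have jK: "j \<in> K" using g by (auto simp: K_def)
        have "(u \<cdot> e) \<cdot> g = u \<cdot> (c K \<cdot> \<iota> K j)"
          using comp_assoc[OF g e u] j c\<iota>K[OF jK] by simp
        also have "\<dots> = arr_zero C G Z"
          using comp_assoc[OF coproductD(2)[OF PK jK] cKK u] uc
            zero_comp[OF coproductD(2)[OF PK jK] Z] by simp
        finally show ?thesis using zero_comp[OF g Z] by simp
      qed
      then have "u \<cdot> e = arr_zero C E Z"
        using gen ue zero_hom[OF E Z] unfolding is_generator_def by blast
      then show "u = arr_zero C X Z" using epi_zero[OF ee e u] by blast
    qed
    then have K: "K \<in> \<K>" using KJ by (simp add: \<K>_def)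
    have "\<forall>j\<in>K. \<exists>g. g \<in> homs C G E \<and> e \<cdot> g = \<phi> j" by (auto simp: K_def)
    then obtain g where g: "\<And>j. j \<in> K \<Longrightarrow> g j \<in> homs C G E" "\<And>j. j \<in> K \<Longrightarrow> e \<cdot> g j = \<phi> j" by metis
    obtain \<sigma> where \<sigma>: "\<sigma> \<in> homs C (P K) E" "\<And>j. j \<in> K \<Longrightarrow> \<sigma> \<cdot> \<iota> K j = g j"
      using coproductD(3)[OF PK E, of g] g(1) by blast
    have "e \<cdot> \<sigma> = c K"
    proof (rule coproduct_ext[OF PK comp_hom[OF \<sigma>(1) e] cKK])
      fix j assume j: "j \<in> K"
      show "(e \<cdot> \<sigma>) \<cdot> \<iota> K j = c K \<cdot> \<iota> K j"
        using comp_assoc[OF coproductD(2)[OF PK j] \<sigma>(1) e] \<sigma>(2)[OF j] g(2)[OF j] c\<iota>K[OF j] by simp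
    qed
    moreover have px: "\<pi> K \<cdot> x \<in> homs C W (P K)" using comp_hom x productD(2)[OF Q K] by blast
    ultimately have "e \<cdot> (\<sigma> \<cdot> (\<pi> K \<cdot> x)) = w"
      using wK[OF K] comp_assoc[OF px \<sigma>(1) e] by simp
    then show ?thesis using comp_hom[OF px \<sigma>(1)] by blast
  qed
  then show ?thesis using w unfolding universal_def by blast
qed

end

section \<open>Universal maps and the derived limit\<close>

context category
begin

lemma comp_eq:
  assumes "g \<cdot> f = k" "f \<in> homs C X Y" "g \<in> homs C Y Z" "v \<in> homs C W X"
  shows "g \<cdot> (f \<cdot> v) = k \<cdot> v"
  using assms comp_assoc by metis

lemma inverse_sequenceD:
  assumes "inverse_sequence C X"
  shows "ob X i \<in> objs C" "bond X i \<in> homs C (ob X (Suc i)) (ob X i)"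
  using assms by (auto simp: inverse_sequence_def)

lemmas ob_obj = inverse_sequenceD(1)
lemmas bond_hom = inverse_sequenceD(2)

end

context preadditive_category
begin

lemma diff_diff_add:
  assumes "s \<in> homs C X Y" "s' \<in> homs C X Y" "h \<in> homs C X Y"
  shows "s \<^bold>- ((s \<^bold>- s') \<^bold>+ h) = s' \<^bold>- h"
proof -
  have d: "s \<^bold>- s' \<in> homs C X Y" "s' \<^bold>- h \<in> homs C X Y" using assms diff_hom by blast+
  have "(s' \<^bold>- h) \<^bold>+ ((s \<^bold>- s') \<^bold>+ h) = (s' \<^bold>- h) \<^bold>+ (h \<^bold>+ (s \<^bold>- s'))"
    using add_comm[OF d(1) assms(3)] by simp
  also have "\<dots> = s' \<^bold>+ (s \<^bold>- s')"
    using add_assoc[OF d(2) assms(3) d(1)] diff_add[OF assms(2,3)] by simp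
  also have "\<dots> = s" using add_comm[OF assms(2) d(1)] diff_add[OF assms(1,2)] by simp
  finally show ?thesis
    using diff_eq_iff[OF assms(1) add_hom[OF d(1) assms(3)] d(2)] by simp
qed

end

section \<open>lim and lim^1 on generalized elements\<close>

context complete_abelian_category
begin

text \<open>The kernel of 1 - F vanishes, tested on maps from every T. No product object occurs, so
  that it can be chased componentwise.\<close>

definition lim0 :: "('o, 'm) inv_seq \<Rightarrow> bool" where
  "lim0 X \<longleftrightarrow> (\<forall>T x. (\<forall>i. x i \<in> homs C T (ob X i)) \<longrightarrow> (\<forall>i. bond X i \<cdot> x (Suc i) = x i) \<longrightarrow>
     (\<forall>i. x i = arr_zero C T (ob X i)))"

text \<open>The equation (1 - F) x = a, in components.\<close>

definition shift_solution :: "('o, 'm) inv_seq \<Rightarrow> (nat \<Rightarrow> 'm) \<Rightarrow> (nat \<Rightarrow> 'm) \<Rightarrow> bool" where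
  "shift_solution X a x \<longleftrightarrow> (\<forall>i. x i = a i \<^bold>+ bond X i \<cdot> x (Suc i))"

text \<open>1 - F is epi exactly when every map from T into the product lifts along it after an
  epimorphism onto T. The cover \<open>w\<close> stands in for the missing projectives.\<close>

definition lim1_zero :: "('o, 'm) inv_seq \<Rightarrow> bool" where
  "lim1_zero X \<longleftrightarrow> (\<forall>T a. T \<in> objs C \<longrightarrow> (\<forall>i. a i \<in> homs C T (ob X i)) \<longrightarrow>
     (\<exists>W w x. w \<in> homs C W T \<and> is_epi C w \<and> (\<forall>i. x i \<in> homs C W (ob X i)) \<and>
        shift_solution X (\<lambda>i. a i \<cdot> w) x))"

lemma lim0D:
  assumes "lim0 X" "\<And>i. x i \<in> homs C T (ob X i)" "\<And>i. bond X i \<cdot> x (Suc i) = x i"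
  shows "x i = arr_zero C T (ob X i)"
  using assms unfolding lim0_def by blast

lemma lim1_zeroD:
  assumes "lim1_zero X" "T \<in> objs C" "\<And>i. a i \<in> homs C T (ob X i)"
  shows "\<exists>W w x. w \<in> homs C W T \<and> is_epi C w \<and> (\<forall>i. x i \<in> homs C W (ob X i)) \<and>
    shift_solution X (\<lambda>i. a i \<cdot> w) x"
  using assms unfolding lim1_zero_def by blast

lemma universal_hom: "universal t T X \<Longrightarrow> t \<in> homs C T X"
  by (simp add: universal_def)

lemma universalD:
  assumes "universal t T X" "e \<in> homs C E X" "is_epi C e"
  obtains s where "s \<in> homs C T E" "e \<cdot> s = t"
  using assms unfolding universal_def by blast

lemma universal_precomp:
  assumes v: "universal v V X" and s: "s \<in> homs C T V"
  shows "universal (v \<cdot> s) T X"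
  unfolding universal_def
proof (intro conjI allI ballI impI)
  show "v \<cdot> s \<in> homs C T X" using comp_hom s universal_hom[OF v] by blast
  fix E e assume e: "e \<in> homs C E X" "is_epi C e"
  obtain u where u: "u \<in> homs C V E" "e \<cdot> u = v" using universalD[OF v e] by blast
  then have "e \<cdot> (u \<cdot> s) = v \<cdot> s" using comp_assoc[OF s u(1) e(1)] by simp
  then show "\<exists>s'\<in>homs C T E. e \<cdot> s' = v \<cdot> s" using comp_hom[OF s u(1)] by blast
qed

text \<open>An epimorphism onto Y is pulled back along \<open>g\<close> to one onto X, along which
  \<open>t\<close> lifts. Therefore a single cover of T can lift infinitely many maps out of
  T.\<close>

lemma universal_push:
  assumes t: "universal t T X" and g: "g \<in> homs C X Y"
  shows "universal (g \<cdot> t) T Y"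
  unfolding universal_def
proof (intro conjI allI ballI impI)
  show "g \<cdot> t \<in> homs C T Y" using comp_hom g universal_hom[OF t] by blast
  fix E e assume e: "e \<in> homs C E Y" "is_epi C e"
  obtain P c x where c: "c \<in> homs C P X" "is_epi C c" and x: "x \<in> homs C P E" "e \<cdot> x = g \<cdot> c"
    using pullback_epi[OF e(1) g e(2)] by blast
  obtain s where s: "s \<in> homs C T P" "c \<cdot> s = t" using universalD[OF t c] by blast
  then have "e \<cdot> (x \<cdot> s) = g \<cdot> t"
    using comp_eq[OF x(2,1) e(1) s(1)] comp_assoc[OF s(1) c(1) g] by simp
  then show "\<exists>s'\<in>homs C T E. e \<cdot> s' = g \<cdot> t" using comp_hom[OF s(1) x(1)] by blast
qed

text \<open>\<open>t\<close> is lifted along \<open>f \<cdot> v\<close> with \<open>v\<close> a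
  universal cover of X. The resulting lift along \<open>f\<close> factors through \<open>v\<close>
  and is universal again, which a lift chosen along \<open>f\<close> alone might not be.\<close>

lemma universal_lift:
  assumes t: "universal t T Y" and f: "f \<in> homs C X Y" "is_epi C f"
  shows "\<exists>s. universal s T X \<and> f \<cdot> s = t"
proof -
  obtain V v where v: "universal v V X" "is_epi C v" using universal_cover homs_objs(1)[OF f(1)] by blast
  note vh = universal_hom[OF v(1)]
  have "is_epi C (f \<cdot> v)" using epi_comp[OF vh f(1)] v f by blast
  then obtain s where s: "s \<in> homs C T V" "(f \<cdot> v) \<cdot> s = t"
    using universalD[OF t comp_hom[OF vh f(1)]] by blast
  then show ?thesis using universal_precomp[OF v(1) s(1)] comp_assoc[OF s(1) vh f(1)] by auto
qed

lemma universal_diff: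
  assumes s: "universal s T X" and t: "universal t T X"
  shows "universal (s \<^bold>- t) T X"
  unfolding universal_def
proof (intro conjI allI ballI impI)
  note st = universal_hom[OF s] universal_hom[OF t]
  show "s \<^bold>- t \<in> homs C T X" using diff_hom st by blast
  fix E e assume e: "e \<in> homs C E X" "is_epi C e"
  obtain u where u: "u \<in> homs C T E" "e \<cdot> u = s" using universalD[OF s e] by blast
  obtain v where v: "v \<in> homs C T E" "e \<cdot> v = t" using universalD[OF t e] by blast
  show "\<exists>s'\<in>homs C T E. e \<cdot> s' = s \<^bold>- t"
    using comp_diff_right[OF u(1) v(1) e(1)] u v diff_hom[OF u(1) v(1)] by auto
qed

lemma universal_zero:
  assumes "T \<in> objs C" "X \<in> objs C"
  shows "universal (arr_zero C T X) T X"
  unfolding universal_def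
  using assms zero_hom comp_zero homs_objs(1) by blast

lemma universal_coverE:
  assumes "T \<in> objs C"
  obtains W w where "w \<in> homs C W T" "is_epi C w" "universal w W T"
  using universal_cover[OF assms] universal_hom by blast

lemma universal_lift_along:
  assumes w: "universal w W T" and f: "f \<in> homs C X Y" "is_epi C f" and y: "y \<in> homs C T Y"
  shows "\<exists>x\<in>homs C W X. f \<cdot> x = y \<cdot> w"
  using universalD[OF universal_push[OF w y] f] by blast

text \<open>Exactness at Y on generalized elements: \<open>y\<close> factors through the image of
  \<open>f\<close>, and \<open>w\<close> lifts it further along the epimorphic part of
  \<open>f\<close>.\<close>

lemma universal_exact:
  assumes w: "universal w W T" and c: "is_cokernel C f p" and f: "f \<in> homs C X Y"
    and p: "p \<in> homs C Y Z" and y: "y \<in> homs C T Y" and 0: "p \<cdot> y = arr_zero C T Z"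
  shows "\<exists>x\<in>homs C W X. f \<cdot> x = y \<cdot> w"
proof -
  have T: "T \<in> objs C" using y homs_objs by blast
  \<comment> \<open>\<open>im\<close> refers to the cokernel picked by \<open>coker\<close>, so the
    given cokernel \<open>p\<close> has to be compared with that one.\<close>
  define c where "c = coker C f"
  have cc: "is_cokernel C f c" unfolding c_def using coker_is f hom_arr(1) by blast
  note c = cokernelD[OF cc f]
  obtain u where u: "u \<in> homs C Z (tgt C c)" "u \<cdot> p = c"
    using cokernelD(3)[OF assms(2) f c(1,2)] hom_arr(3)[OF p] by auto
  have "c \<cdot> y = arr_zero C T (tgt C c)"
    using comp_assoc[OF y p u(1)] u 0 comp_zero[OF u(1) T] by simp
  then obtain m where m: "m \<in> homs C T (src C (im C f))" "im C f \<cdot> m = y"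
    using kernelD(3)[OF im_factor(4)[OF f, folded c_def] c(1) y] by blast
  obtain e where e: "e \<in> homs C X (src C (im C f))" "is_epi C e" "im C f \<cdot> e = f"
    using im_factor(3)[OF f] by blast
  obtain x where x: "x \<in> homs C W X" "e \<cdot> x = m \<cdot> w"
    using universal_lift_along[OF w e(1,2) m(1)] by blast
  have "f \<cdot> x = y \<cdot> w"
    using comp_assoc[OF x(1) e(1) im_factor(1)[OF f]] e(3) x(2)
      comp_assoc[OF universal_hom[OF w] m(1) im_factor(1)[OF f]] m(2) by simp
  then show ?thesis using x by blast
qed

lemma seq_product_is:
  assumes "inverse_sequence C X"
  shows "is_product C UNIV (ob X) (fst (seq_product C X)) (snd (seq_product C X))"
proof -
  have "\<exists>P \<pi>. is_product C UNIV (ob X) P \<pi>"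
    using product_exists[OF universe_nat_small[OF univ]] ob_obj[OF assms] by metis
  then have "\<exists>p. is_product C UNIV (ob X) (fst p) (snd p)" by auto
  then show ?thesis unfolding seq_product_def by (rule someI_ex)
qed

text \<open>The definite description in \<open>shift_map\<close> is resolved here; afterwards 1 - F
  is known only by its equation in components.\<close>

lemma one_minus_shift:
  fixes X :: "('o, 'm) inv_seq"
  assumes X: "inverse_sequence C X"
  defines "P \<equiv> fst (seq_product C X)" and "pr \<equiv> snd (seq_product C X)" and "D \<equiv> one_minus_shift C X"
  shows "D \<in> homs C P P"
    and "\<And>T x y. x \<in> homs C T P \<Longrightarrow> y \<in> homs C T P \<Longrightarrow>
      D \<cdot> x = y \<longleftrightarrow> (\<forall>i. pr i \<cdot> x = pr i \<cdot> y \<^bold>+ bond X i \<cdot> (pr (Suc i) \<cdot> x))"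
proof -
  note P = seq_product_is[OF X, folded P_def pr_def]
  note X' = inverse_sequenceD[OF X]
  have Po: "P \<in> objs C" by (rule productD(1)[OF P])
  have pr: "pr i \<in> homs C P (ob X i)" for i using productD(2)[OF P] by blast
  have "\<exists>F\<in>homs C P P. \<forall>i\<in>UNIV. pr i \<cdot> F = bond X i \<cdot> pr (Suc i)"
    by (rule productD(3)[OF P Po]) (use comp_hom pr X' in blast)
  then obtain F where F: "F \<in> homs C P P" "\<And>i. pr i \<cdot> F = bond X i \<cdot> pr (Suc i)" by blast
  have "shift_map C X = (THE F. F \<in> homs C P P \<and> (\<forall>j. pr j \<cdot> F = bond X j \<cdot> pr (Suc j)))"
    by (simp add: shift_map_def P_def pr_def case_prod_beta Let_def)
  also have "\<dots> = F"
    by (rule the_equality) (use F product_ext[OF P] in auto)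
  finally have D_eq: "D = ident C P \<^bold>- F" by (simp add: D_def one_minus_shift_def P_def)
  note idP = ident_hom[OF Po]
  show D: "D \<in> homs C P P" unfolding D_eq using diff_hom[OF idP F(1)] .
  fix T x y assume x: "x \<in> homs C T P" and y: "y \<in> homs C T P"
  have Dx: "D \<cdot> x \<in> homs C T P" using comp_hom x D by blast
  have prx: "pr i \<cdot> x \<in> homs C T (ob X i)" "pr i \<cdot> y \<in> homs C T (ob X i)" for i
    using comp_hom x y pr by blast+
  have bx: "bond X i \<cdot> (pr (Suc i) \<cdot> x) \<in> homs C T (ob X i)" for i
    using comp_hom prx X' by blast
  have Fx: "F \<cdot> x \<in> homs C T P" using comp_hom x F by blast
  have "pr i \<cdot> (D \<cdot> x) = pr i \<cdot> x \<^bold>- bond X i \<cdot> (pr (Suc i) \<cdot> x)" for i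
  proof -
    have "D \<cdot> x = x \<^bold>- F \<cdot> x"
      unfolding D_eq using comp_diff_left[OF x idP F(1)] ident_left[OF x] by simp
    moreover have "pr i \<cdot> (F \<cdot> x) = bond X i \<cdot> (pr (Suc i) \<cdot> x)"
      using comp_eq[OF F(2) F(1) pr x] comp_assoc[OF x pr X'(2)] by simp
    ultimately show ?thesis using comp_diff_right[OF x Fx pr] by simp
  qed
  then have "D \<cdot> x = y \<longleftrightarrow> (\<forall>i. pr i \<cdot> x \<^bold>- bond X i \<cdot> (pr (Suc i) \<cdot> x) = pr i \<cdot> y)"
    using product_ext[OF P Dx y] by auto
  then show "D \<cdot> x = y \<longleftrightarrow> (\<forall>i. pr i \<cdot> x = pr i \<cdot> y \<^bold>+ bond X i \<cdot> (pr (Suc i) \<cdot> x))"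
    using diff_eq_iff[OF prx(1) bx prx(2)] by simp
qed

lemma seq_lim_zero_iff:
  assumes X: "inverse_sequence C X"
  shows "is_zero_object C (seq_lim C X) \<longleftrightarrow> lim0 X"
proof -
  define P where "P = fst (seq_product C X)"
  define pr where "pr = snd (seq_product C X)"
  define D where "D = one_minus_shift C X"
  note P = seq_product_is[OF X, folded P_def pr_def]
  note D = one_minus_shift[OF X, folded P_def pr_def D_def]
  note X' = inverse_sequenceD[OF X]
  have Po: "P \<in> objs C" by (rule productD(1)[OF P])
  have pr: "pr i \<in> homs C P (ob X i)" for i using productD(2)[OF P] by blast
  define k where "k = ker C D"
  define K where "K = src C k"
  have kk: "is_kernel C D k" unfolding k_def using ker_is D(1) hom_arr by blast
  note k = kernelD[OF kk D(1), folded K_def]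
  have K: "K \<in> objs C" using homs_objs k(1) by blast
  have lim: "seq_lim C X = K" by (simp add: seq_lim_def K_def k_def D_def)
  have D0: "D \<cdot> x = arr_zero C T P \<longleftrightarrow> (\<forall>i. bond X i \<cdot> (pr (Suc i) \<cdot> x) = pr i \<cdot> x)"
    if x: "x \<in> homs C T P" for x T
  proof -
    have T: "T \<in> objs C" using homs_objs x by blast
    have "pr i \<cdot> arr_zero C T P = arr_zero C T (ob X i)" for i using comp_zero pr T by blast
    moreover have "arr_zero C T (ob X i) \<^bold>+ bond X i \<cdot> (pr (Suc i) \<cdot> x) = bond X i \<cdot> (pr (Suc i) \<cdot> x)" for i
      by (rule zero_add[OF comp_hom[OF comp_hom[OF x pr] X'(2)]])
    ultimately show ?thesis
      using D(2)[OF x zero_hom[OF T Po]] by (metis (no_types))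
  qed
  show ?thesis
    unfolding lim
  proof
    assume z: "is_zero_object C K"
    show "lim0 X"
      unfolding lim0_def
    proof (intro allI impI)
      fix T x i
      assume x: "\<forall>i. x i \<in> homs C T (ob X i)" and c: "\<forall>i. bond X i \<cdot> x (Suc i) = x i"
      have T: "T \<in> objs C" using x homs_objs by blast
      obtain g where g: "g \<in> homs C T P" "\<And>i. pr i \<cdot> g = x i"
        using productD(3)[OF P T, of x] x by blast
      have "D \<cdot> g = arr_zero C T P" using D0[OF g(1)] g(2) c by simp
      then obtain h where h: "h \<in> homs C T K" "k \<cdot> h = g" using k(3)[OF g(1)] by blast
      then have "g = arr_zero C T P"
        using zero_object_homs(1)[OF z h(1)] comp_zero[OF k(1) T] by simp
      then show "x i = arr_zero C T (ob X i)" using g(2)[of i] comp_zero[OF pr T] by simp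
    qed
  next
    assume l: "lim0 X"
    \<comment> \<open>The inclusion of the kernel is itself a compatible family, with the kernel as
      test object.\<close>
    have "pr i \<cdot> k = arr_zero C K (ob X i)" for i
      by (rule lim0D[OF l comp_hom[OF k(1) pr]]) (use D0[OF k(1)] k(2) in blast)
    then have "k = arr_zero C K P"
      using product_ext[OF P k(1) zero_hom[OF K Po]] comp_zero[OF pr K] by simp
    then have "k \<cdot> ident C K = k \<cdot> arr_zero C K K"
      using ident_right[OF k(1)] comp_zero[OF k(1) K] by simp
    then have "ident C K = arr_zero C K K"
      using monoD[OF kernel_mono[OF kk] k(1) ident_hom[OF K] zero_hom[OF K K]] by blast
    then show "is_zero_object C K" using zero_object_iff[OF K] by blast
  qed
qed

lemma seq_lim1_zero_iff:
  assumes X: "inverse_sequence C X"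
  shows "is_zero_object C (seq_lim1 C X) \<longleftrightarrow> lim1_zero X"
proof -
  define P where "P = fst (seq_product C X)"
  define pr where "pr = snd (seq_product C X)"
  define D where "D = one_minus_shift C X"
  note P = seq_product_is[OF X, folded P_def pr_def]
  note D = one_minus_shift[OF X, folded P_def pr_def D_def]
  note X' = inverse_sequenceD[OF X]
  have Po: "P \<in> objs C" by (rule productD(1)[OF P])
  have pr: "pr i \<in> homs C P (ob X i)" for i using productD(2)[OF P] by blast
  define p where "p = coker C D"
  define L where "L = tgt C p"
  have pc: "is_cokernel C D p" unfolding p_def using coker_is D(1) hom_arr by blast
  note p = cokernelD[OF pc D(1), folded L_def]
  have L: "L \<in> objs C" using homs_objs p(1) by blast
  have lim: "seq_lim1 C X = L" by (simp add: seq_lim1_def L_def p_def D_def)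
  show ?thesis
    unfolding lim
  proof
    assume z: "is_zero_object C L"
    show "lim1_zero X"
      unfolding lim1_zero_def
    proof (intro allI impI)
      fix T a assume T: "T \<in> objs C" and a: "\<forall>i. a i \<in> homs C T (ob X i)"
      obtain g where g: "g \<in> homs C T P" "\<And>i. pr i \<cdot> g = a i"
        using productD(3)[OF P T, of a] a by blast
      obtain W w where w: "w \<in> homs C W T" "is_epi C w" "universal w W T"
        using universal_coverE[OF T] by blast
      have "p \<cdot> g = arr_zero C T L"
        using zero_object_homs(1)[OF z comp_hom[OF g(1) p(1)]] .
      then obtain x where x: "x \<in> homs C W P" "D \<cdot> x = g \<cdot> w"
        using universal_exact[OF w(3) pc D(1) p(1) g(1)] by blast
      have sol: "pr i \<cdot> x = a i \<cdot> w \<^bold>+ bond X i \<cdot> (pr (Suc i) \<cdot> x)" for i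
        using D(2)[OF x(1) comp_hom[OF w(1) g(1)], THEN iffD1, OF x(2), rule_format, of i]
        unfolding comp_eq[OF g(2) g(1) pr w(1)] .
      show "\<exists>W w x. w \<in> homs C W T \<and> is_epi C w \<and> (\<forall>i. x i \<in> homs C W (ob X i)) \<and>
        shift_solution X (\<lambda>i. a i \<cdot> w) x"
        by (intro exI[of _ W] exI[of _ w] exI[of _ "\<lambda>i. pr i \<cdot> x"] conjI allI)
          (rule w(1) w(2) comp_hom[OF x(1) pr] shift_solution_def[THEN iffD2] allI sol)+
    qed
  next
    assume l: "lim1_zero X"
    \<comment> \<open>The generic test family: the projections of the product itself. Its solution
      writes the epimorphism \<open>w\<close> as \<open>D \<cdot> g\<close>, so the cokernel of
      \<open>D\<close> kills \<open>w\<close> and is zero.\<close>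
    obtain W w x where w: "w \<in> homs C W P" "is_epi C w" and x: "\<And>i. x i \<in> homs C W (ob X i)"
      and e: "shift_solution X (\<lambda>i. pr i \<cdot> w) x"
      using lim1_zeroD[OF l Po, of pr, OF pr] by blast
    have W: "W \<in> objs C" using w homs_objs by blast
    obtain g where g: "g \<in> homs C W P" "\<And>i. pr i \<cdot> g = x i"
      using productD(3)[OF P W, of x] x by blast
    have "D \<cdot> g = w" unfolding D(2)[OF g(1) w(1)] g(2) using e[unfolded shift_solution_def] .
    then have "p \<cdot> w = arr_zero C W L"
      using comp_assoc[OF g(1) D(1) p(1)] p(2) zero_comp[OF g(1) L] by simp
    then have "p = arr_zero C P L" using epi_zero[OF w(2,1) p(1)] by blast
    then have "ident C L \<cdot> p = arr_zero C P L"
      using ident_left[OF p(1)] by simp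
    then have "ident C L = arr_zero C L L"
      using epi_zero[OF cokernel_epi[OF pc] p(1) ident_hom[OF L]] by blast
    then show "is_zero_object C L" using zero_object_iff[OF L] by blast
  qed
qed

text \<open>The equation is solved upwards from 0: the next term is a lift, along the bond, of the
  current term minus \<open>a n \<cdot> w\<close>. Universality of each term is part of the
  recursion and keeps all terms on the same W.\<close>

lemma lim1_zero_epi_bonds:
  assumes X: "inverse_sequence C X" and e: "\<And>i. is_epi C (bond X i)"
  shows "lim1_zero X"
  unfolding lim1_zero_def
proof (intro allI impI)
  note X' = inverse_sequenceD[OF X]
  fix T a assume T: "T \<in> objs C" and a: "\<forall>i. a i \<in> homs C T (ob X i)"
  obtain W w where w: "w \<in> homs C W T" "is_epi C w" "universal w W T"
    using universal_coverE[OF T] by blast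
  have W: "W \<in> objs C" using w homs_objs by blast
  have aw: "universal (a i \<cdot> w) W (ob X i)" for i using universal_push w(3) a by blast
  have "\<exists>z. \<forall>n. universal (z n) W (ob X n) \<and> bond X n \<cdot> z (Suc n) = z n \<^bold>- a n \<cdot> w"
  proof (rule dependent_nat_choice)
    show "\<exists>x. universal x W (ob X 0)" using universal_zero[OF W X'(1)] by blast
    show "\<exists>y. universal y W (ob X (Suc n)) \<and> bond X n \<cdot> y = x \<^bold>- a n \<cdot> w"
      if "universal x W (ob X n)" for x n
      using universal_lift[OF universal_diff[OF that aw] X'(2) e] .
  qed
  then obtain z where z: "\<And>n. universal (z n) W (ob X n)"
      "\<And>n. bond X n \<cdot> z (Suc n) = z n \<^bold>- a n \<cdot> w" by blast
  have sol: "z n = a n \<cdot> w \<^bold>+ bond X n \<cdot> z (Suc n)" for n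
  proof -
    have zn: "z n \<in> homs C W (ob X n)" "a n \<cdot> w \<in> homs C W (ob X n)" using z aw universal_hom by blast+
    then show ?thesis using z(2)[of n] diff_add[OF zn] add_comm[OF diff_hom[OF zn] zn(2)] by simp
  qed
  show "\<exists>W w x. w \<in> homs C W T \<and> is_epi C w \<and> (\<forall>i. x i \<in> homs C W (ob X i)) \<and>
        shift_solution X (\<lambda>i. a i \<cdot> w) x"
    by (intro exI[of _ W] exI[of _ w] exI[of _ z] conjI allI)
      (rule w(1) w(2) universal_hom[OF z(1)] shift_solution_def[THEN iffD2] allI sol)+
qed

text \<open>A universal cover \<open>t\<close> of the i-th object extends to a compatible family: it
  is lifted through the bonds above i and composed with those below. A zero limit forces
  \<open>t\<close> = 0.\<close>

lemma epi_bonds_lim0_zero: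
  assumes X: "inverse_sequence C X" and e: "\<And>i. is_epi C (bond X i)" and l: "lim0 X"
  shows "ident C (ob X i) = arr_zero C (ob X i) (ob X i)"
proof -
  note X' = inverse_sequenceD[OF X]
  obtain T t where t: "t \<in> homs C T (ob X i)" "is_epi C t" "universal t T (ob X i)"
    using universal_coverE[OF X'(1)] by blast
  have T: "T \<in> objs C" using t homs_objs by blast
  \<comment> \<open>Dependent choice promises only some starting value; the clause for n = 0 pins it
    to \<open>t\<close>.\<close>
  have "\<exists>y. \<forall>n. (universal (y n) T (ob X (i + n)) \<and> (n = 0 \<longrightarrow> y n = t)) \<and>
      bond X (i + n) \<cdot> y (Suc n) = y n"
  proof (rule dependent_nat_choice)
    show "\<exists>x. universal x T (ob X (i + 0)) \<and> (0 = (0::nat) \<longrightarrow> x = t)" using t(3) by auto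
    show "\<exists>y. (universal y T (ob X (i + Suc n)) \<and> (Suc n = 0 \<longrightarrow> y = t)) \<and> bond X (i + n) \<cdot> y = x"
      if "universal x T (ob X (i + n)) \<and> (n = 0 \<longrightarrow> x = t)" for x n
      using universal_lift[of x T "ob X (i + n)", OF _ X'(2) e] that by simp
  qed
  then obtain y where y: "\<And>n. universal (y n) T (ob X (i + n))" "y 0 = t"
    "\<And>n. bond X (i + n) \<cdot> y (Suc n) = y n" by blast
  \<comment> \<open>\<open>d k\<close> lives at level i - k. The truncated subtraction is harmless
    because only k \<le> i is used.\<close>
  define d where "d = rec_nat t (\<lambda>k u. bond X (i - Suc k) \<cdot> u)"
  have d0: "d 0 = t" and dS: "d (Suc k) = bond X (i - Suc k) \<cdot> d k" for k by (simp_all add: d_def)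
  have d: "k \<le> i \<Longrightarrow> d k \<in> homs C T (ob X (i - k))" for k
  proof (induction k)
    case 0 then show ?case using t d0 by simp
  next
    case (Suc k)
    then have "d k \<in> homs C T (ob X (Suc (i - Suc k)))" by (simp add: Suc_diff_Suc)
    then show ?case unfolding dS using comp_hom X'(2) by blast
  qed
  define x where "x j = (if i \<le> j then y (j - i) else d (i - j))" for j
  have "x i = arr_zero C T (ob X i)"
  proof (rule lim0D[OF l])
    show "x j \<in> homs C T (ob X j)" for j
      using universal_hom[OF y(1), of "j - i"] d[OF diff_le_self, of j] by (cases "i \<le> j") (auto simp: x_def)
    show "bond X j \<cdot> x (Suc j) = x j" for j
    proof -
      consider "i \<le> j" | "Suc j = i" | "Suc j < i" by linarith
      then show ?thesis
      proof cases
        case 1 then show ?thesis using y(3)[of "j - i"] by (simp add: x_def Suc_diff_le)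
      next
        case 2 then show ?thesis using dS[of 0] d0 y(2) by (auto simp: x_def)
      next
        case 3
        then have "i - j = Suc (i - Suc j)" "i - Suc (i - Suc j) = j" by linarith+
        then show ?thesis using 3 dS[of "i - Suc j"] by (simp add: x_def)
      qed
    qed
  qed
  then have "t = arr_zero C T (ob X i)" using y(2) by (simp add: x_def)
  then have "ident C (ob X i) \<cdot> t = arr_zero C T (ob X i)" using ident_left[OF t(1)] by simp
  then show ?thesis using epi_zero[OF t(2,1) ident_hom[OF X'(1)]] by blast
qed

end

section \<open>Chasing inverse sequences\<close>

lemma ex1_unique: "\<exists>!x. P x \<Longrightarrow> P a \<Longrightarrow> P b \<Longrightarrow> a = b"
  by blast

context complete_abelian_category
begin

text \<open>Morphisms of inverse sequences as bare families of components; a \<open>seq_map\<close>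
  also carries its two ends as data, which a chase does not want.\<close>

definition nat_map :: "('o, 'm) inv_seq \<Rightarrow> ('o, 'm) inv_seq \<Rightarrow> (nat \<Rightarrow> 'm) \<Rightarrow> bool" where
  "nat_map X Y h \<longleftrightarrow> inverse_sequence C X \<and> inverse_sequence C Y \<and>
     (\<forall>i. h i \<in> homs C (ob X i) (ob Y i) \<and> h i \<cdot> bond X i = bond Y i \<cdot> h (Suc i))"

lemma nat_mapD:
  assumes "nat_map X Y h"
  shows "inverse_sequence C X" "inverse_sequence C Y" "h i \<in> homs C (ob X i) (ob Y i)"
    "h i \<cdot> bond X i = bond Y i \<cdot> h (Suc i)"
  using assms by (auto simp: nat_map_def)

lemma bond_comp:
  "inverse_sequence C X \<Longrightarrow> s \<in> homs C T (ob X (Suc i)) \<Longrightarrow> bond X i \<cdot> s \<in> homs C T (ob X i)"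
  using comp_hom inverse_sequenceD(2) by blast

lemma nat_map_comp:
  "nat_map X Y h \<Longrightarrow> s \<in> homs C T (ob X i) \<Longrightarrow> h i \<cdot> s \<in> homs C T (ob Y i)"
  using comp_hom nat_mapD(3) by blast

lemma nat_map_bond:
  assumes h: "nat_map X Y h" and s: "s \<in> homs C T (ob X (Suc i))"
  shows "h i \<cdot> (bond X i \<cdot> s) = bond Y i \<cdot> (h (Suc i) \<cdot> s)"
proof -
  note b = bond_hom[OF nat_mapD(1)[OF h]] bond_hom[OF nat_mapD(2)[OF h]]
  show ?thesis
    using comp_eq[OF nat_mapD(4)[OF h] b(1) nat_mapD(3)[OF h] s]
      comp_assoc[OF s nat_mapD(3)[OF h] b(2)] by simp
qed

lemma bond_pre:
  assumes "inverse_sequence C X" "s \<in> homs C T (ob X (Suc i))" "v \<in> homs C W T"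
  shows "bond X i \<cdot> (s \<cdot> v) = (bond X i \<cdot> s) \<cdot> v"
  using comp_assoc[OF assms(3,2) bond_hom[OF assms(1)]] by simp

lemma nat_map_pre:
  assumes "nat_map X Y h" "s \<in> homs C T (ob X i)" "v \<in> homs C W T"
  shows "h i \<cdot> (s \<cdot> v) = (h i \<cdot> s) \<cdot> v"
  using comp_assoc[OF assms(3,2) nat_mapD(3)[OF assms(1)]] by simp

lemma nat_map_diff:
  assumes "nat_map X Y h" "s \<in> homs C T (ob X i)" "t \<in> homs C T (ob X i)"
  shows "h i \<cdot> (s \<^bold>- t) = h i \<cdot> s \<^bold>- h i \<cdot> t"
  using comp_diff_right[OF assms(2,3) nat_mapD(3)[OF assms(1)]] .

lemma nat_map_add:
  assumes "nat_map X Y h" "s \<in> homs C T (ob X i)" "t \<in> homs C T (ob X i)"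
  shows "h i \<cdot> (s \<^bold>+ t) = h i \<cdot> s \<^bold>+ h i \<cdot> t"
  using comp_add_right[OF assms(2,3) nat_mapD(3)[OF assms(1)]] .

lemma nat_map_diff_zero_iff:
  assumes "nat_map X Y h" "s \<in> homs C T (ob X i)" "t \<in> homs C T (ob X i)"
  shows "h i \<cdot> (s \<^bold>- t) = arr_zero C T (ob Y i) \<longleftrightarrow> h i \<cdot> s = h i \<cdot> t"
  unfolding nat_map_diff[OF assms]
  using diff_zero_iff nat_map_comp assms by blast

lemma bond_diff:
  assumes "inverse_sequence C X" "s \<in> homs C T (ob X (Suc i))" "t \<in> homs C T (ob X (Suc i))"
  shows "bond X i \<cdot> (s \<^bold>- t) = bond X i \<cdot> s \<^bold>- bond X i \<cdot> t"
  using comp_diff_right[OF assms(2,3) bond_hom[OF assms(1)]] .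

text \<open>Every composite \<open>a i \<cdot> w\<close> is again universal, so one W serves all
  components.\<close>

lemma nat_map_lift:
  assumes q: "nat_map X Y q" and e: "\<And>i. is_epi C (q i)" and w: "universal w W T"
    and a: "\<And>i. a i \<in> homs C T (ob Y i)"
  shows "\<exists>s. \<forall>i. s i \<in> homs C W (ob X i) \<and> q i \<cdot> s i = a i \<cdot> w"
  using universal_lift_along[OF w nat_mapD(3)[OF q] e a] by metis

lemma nat_map_exact:
  assumes h: "nat_map X Y h" and p: "nat_map Y Z p" and c: "\<And>i. is_cokernel C (h i) (p i)"
    and w: "universal w W T" and y: "\<And>i. y i \<in> homs C T (ob Y i)"
    and 0: "\<And>i. p i \<cdot> y i = arr_zero C T (ob Z i)"
  shows "\<exists>s. \<forall>i. s i \<in> homs C W (ob X i) \<and> h i \<cdot> s i = y i \<cdot> w"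
proof -
  have "\<exists>x\<in>homs C W (ob X i). h i \<cdot> x = y i \<cdot> w" for i
    by (rule universal_exact[OF w c[of i] nat_mapD(3)[OF h] nat_mapD(3)[OF p] y[of i] 0[of i]])
  then show ?thesis unfolding Bex_def by (rule choice[OF allI])
qed

lemma shift_solutionI: "(\<And>i. x i = a i \<^bold>+ bond X i \<cdot> x (Suc i)) \<Longrightarrow> shift_solution X a x"
  unfolding shift_solution_def by (rule allI)

lemma shift_solutionD: "shift_solution X a x \<Longrightarrow> x i = a i \<^bold>+ bond X i \<cdot> x (Suc i)"
  unfolding shift_solution_def by (erule spec)

lemma shift_solution_map:
  assumes h: "nat_map X Y h" and a: "\<And>i. a i \<in> homs C T (ob X i)"
    and x: "\<And>i. x i \<in> homs C T (ob X i)" and sol: "shift_solution X a x"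
  shows "shift_solution Y (\<lambda>i. h i \<cdot> a i) (\<lambda>i. h i \<cdot> x i)"
  unfolding shift_solution_def
proof
  fix i
  have "h i \<cdot> x i = h i \<cdot> (a i \<^bold>+ bond X i \<cdot> x (Suc i))"
    by (rule arg_cong[OF shift_solutionD[OF sol]])
  then show "h i \<cdot> x i = h i \<cdot> a i \<^bold>+ bond Y i \<cdot> (h (Suc i) \<cdot> x (Suc i))"
    unfolding nat_map_add[OF h a bond_comp[OF nat_mapD(1)[OF h] x]] nat_map_bond[OF h x] .
qed

lemma shift_solution_precomp:
  assumes X: "inverse_sequence C X" and a: "\<And>i. a i \<in> homs C T (ob X i)"
    and x: "\<And>i. x i \<in> homs C T (ob X i)" and sol: "shift_solution X a x" and v: "v \<in> homs C V T"
  shows "shift_solution X (\<lambda>i. a i \<cdot> v) (\<lambda>i. x i \<cdot> v)"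
  unfolding shift_solution_def
proof
  fix i
  have "x i \<cdot> v = (a i \<^bold>+ bond X i \<cdot> x (Suc i)) \<cdot> v"
    by (rule arg_cong[OF shift_solutionD[OF sol]])
  then show "x i \<cdot> v = a i \<cdot> v \<^bold>+ bond X i \<cdot> (x (Suc i) \<cdot> v)"
    unfolding comp_add_left[OF v a bond_comp[OF X x]] bond_pre[OF X x v] .
qed

lemma lim1_zeroI:
  assumes "\<And>T a. T \<in> objs C \<Longrightarrow> (\<And>i. a i \<in> homs C T (ob X i)) \<Longrightarrow>
    \<exists>W w x. w \<in> homs C W T \<and> is_epi C w \<and> (\<forall>i. x i \<in> homs C W (ob X i)) \<and>
    shift_solution X (\<lambda>i. a i \<cdot> w) x"
  shows "lim1_zero X"
  using assms unfolding lim1_zero_def by blast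

lemma lim1_zero_witness:
  assumes "w \<in> homs C W T" "is_epi C w" "\<And>i. x i \<in> homs C W (ob X i)"
    "shift_solution X (\<lambda>i. a i \<cdot> w) x"
  shows "\<exists>W w x. w \<in> homs C W T \<and> is_epi C w \<and> (\<forall>i. x i \<in> homs C W (ob X i)) \<and>
    shift_solution X (\<lambda>i. a i \<cdot> w) x"
  by (rule exI[of _ W], rule exI[of _ w], rule exI[of _ x]) (simp add: assms)

section \<open>Pieces of the long exact sequence of lim and lim^1\<close>

lemma cokernel_comp_zero:
  assumes "is_cokernel C f p" "f \<in> homs C X Y" "p \<in> homs C Y Z" "x \<in> homs C T X"
  shows "p \<cdot> (f \<cdot> x) = arr_zero C T Z"
proof -
  have "p \<cdot> f = arr_zero C X Z" using cokernelD(2)[OF assms(1,2)] hom_arr(3)[OF assms(3)] by simp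
  then show ?thesis
    using comp_assoc[OF assms(4,2,3)] zero_comp[OF assms(4) homs_objs(2)[OF assms(3)]] by simp
qed

text \<open>The connecting map out of lim Z. A lift \<open>s\<close> of a compatible family fails to
  be compatible by \<open>d\<close>, which dies in Z and hence comes from X. Solving the shift
  equation in X corrects \<open>s\<close> to a compatible family of Y, which is zero; so
  \<open>s\<close> comes from X and dies in Z. \<open>h\<close> may have a kernel, as the map from S
  to its completion does.\<close>

lemma lim0_cokernel:
  assumes h: "nat_map X Y h" and p: "nat_map Y Z p" and c: "\<And>i. is_cokernel C (h i) (p i)"
    and lX: "lim1_zero X" and lY: "lim0 Y"
  shows "lim0 Z"
  unfolding lim0_def
proof (intro allI impI)
  fix T z i
  assume "\<forall>i. z i \<in> homs C T (ob Z i)" and zc': "\<forall>i. bond Z i \<cdot> z (Suc i) = z i"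
  then have z: "\<And>i. z i \<in> homs C T (ob Z i)" and zc: "\<And>i. bond Z i \<cdot> z (Suc i) = z i" by auto
  note X = nat_mapD(1)[OF h] and Y = nat_mapD(2)[OF h] and Z = nat_mapD(2)[OF p]
  have T: "T \<in> objs C" using z homs_objs by blast
  obtain W w where w: "w \<in> homs C W T" "is_epi C w" "universal w W T"
    using universal_coverE[OF T] by blast
  have W: "W \<in> objs C" using w homs_objs by blast
  obtain s where s: "\<And>i. s i \<in> homs C W (ob Y i)" "\<And>i. p i \<cdot> s i = z i \<cdot> w"
    using nat_map_lift[OF p cokernel_epi[OF c] w(3), of z, OF z] by blast
  note fs = bond_comp[OF Y s(1)]
  define d where "d i = s i \<^bold>- bond Y i \<cdot> s (Suc i)" for i
  have d: "d i \<in> homs C W (ob Y i)" for i unfolding d_def by (rule diff_hom[OF s(1) fs])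
  have pd: "p i \<cdot> d i = arr_zero C W (ob Z i)" for i
    unfolding d_def nat_map_diff_zero_iff[OF p s(1) fs] nat_map_bond[OF p s(1)] s(2)
      bond_pre[OF Z z w(1)] zc ..
  obtain W' w' where w': "w' \<in> homs C W' W" "is_epi C w'" "universal w' W' W"
    using universal_coverE[OF W] by blast
  have W': "W' \<in> objs C" using w' homs_objs by blast
  obtain a where a: "\<And>i. a i \<in> homs C W' (ob X i)" "\<And>i. h i \<cdot> a i = d i \<cdot> w'"
    using nat_map_exact[OF h p c w'(3), of d, OF d pd] by blast
  obtain V v x where v: "v \<in> homs C V W'" "is_epi C v" and "\<forall>i. x i \<in> homs C V (ob X i)"
    and sol: "shift_solution X (\<lambda>i. a i \<cdot> v) x"
    using lim1_zeroD[OF lX W', of a, OF a(1)] by blast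
  then have x: "\<And>i. x i \<in> homs C V (ob X i)" by blast
  define u where "u = w' \<cdot> v"
  have u: "u \<in> homs C V W" "is_epi C u" unfolding u_def using comp_hom v w' epi_comp by blast+
  have V: "V \<in> objs C" using v homs_objs by blast
  note su = comp_hom[OF u(1) s(1)] and hx = nat_map_comp[OF h x]
  note fhx = bond_comp[OF Y hx] and fsu = bond_comp[OF Y su]
  have hx_eq: "h i \<cdot> x i = (s i \<cdot> u \<^bold>- bond Y i \<cdot> (s (Suc i) \<cdot> u)) \<^bold>+ bond Y i \<cdot> (h (Suc i) \<cdot> x (Suc i))" for i
  proof -
    have "h i \<cdot> x i = h i \<cdot> (a i \<cdot> v) \<^bold>+ bond Y i \<cdot> (h (Suc i) \<cdot> x (Suc i))"
      by (rule shift_solutionD[OF shift_solution_map[OF h comp_hom[OF v(1) a(1)] x sol]])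
    moreover have "h i \<cdot> (a i \<cdot> v) = d i \<cdot> u"
      using nat_map_pre[OF h a(1) v(1)] a(2) comp_assoc[OF v(1) w'(1) d] by (simp add: u_def)
    moreover have "d i \<cdot> u = s i \<cdot> u \<^bold>- bond Y i \<cdot> (s (Suc i) \<cdot> u)"
      unfolding d_def using comp_diff_left[OF u(1) s(1) fs] bond_pre[OF Y s(1) u(1)] by simp
    ultimately show ?thesis by (simp only:)
  qed
  \<comment> \<open>\<open>s\<close> and \<open>h x\<close> miss compatibility by the same defect,
    so their difference is compatible.\<close>
  have eq: "s i \<cdot> u \<^bold>- h i \<cdot> x i = bond Y i \<cdot> (s (Suc i) \<cdot> u \<^bold>- h (Suc i) \<cdot> x (Suc i))" for i
    unfolding bond_diff[OF Y su hx] by (subst hx_eq[of i]) (rule diff_diff_add[OF su fsu fhx])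
  have "s i \<cdot> u \<^bold>- h i \<cdot> x i = arr_zero C V (ob Y i)" for i
    by (rule lim0D[OF lY diff_hom[OF su hx] eq[symmetric]])
  then have "s i \<cdot> u = h i \<cdot> x i" for i using diff_zero_iff[OF su hx] by blast
  then have "p i \<cdot> (s i \<cdot> u) = arr_zero C V (ob Z i)"
    using cokernel_comp_zero[OF c nat_mapD(3)[OF h] nat_mapD(3)[OF p] x] by simp
  then have "z i \<cdot> (w \<cdot> u) = arr_zero C V (ob Z i)"
    using nat_map_pre[OF p s(1) u(1)] s(2) comp_assoc[OF u(1) w(1) z] by simp
  then show "z i = arr_zero C T (ob Z i)"
    using epi_zero[OF epi_comp[OF u(1) w(1) u(2) w(2)] comp_hom[OF u(1) w(1)] z] by blast
qed

text \<open>Meant for Y the completion, Z its cokernel and Q = S^\<mu>, the image of S in Y. A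
  solution in Y for data from X gives a compatible family in Z, which is zero, so the solution lifts
  to X after a cover. There the equation holds up to the kernel of \<open>h\<close>, which
  \<open>q\<close> kills.\<close>

lemma lim1_zero_image:
  assumes h: "nat_map X Y h" and p: "nat_map Y Z p" and c: "\<And>i. is_cokernel C (h i) (p i)"
    and lY: "lim1_zero Y" and lZ: "lim0 Z"
    and q: "nat_map X Q q" and qe: "\<And>i. is_epi C (q i)"
    and hq: "\<And>i T s. s \<in> homs C T (ob X i) \<Longrightarrow> h i \<cdot> s = arr_zero C T (ob Y i) \<Longrightarrow>
      q i \<cdot> s = arr_zero C T (ob Q i)"
  shows "lim1_zero Q"
proof (rule lim1_zeroI)
  fix T a assume T: "T \<in> objs C" and a: "\<And>i. a i \<in> homs C T (ob Q i)"
  note X = nat_mapD(1)[OF h] and Y = nat_mapD(2)[OF h] and Z = nat_mapD(2)[OF p]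
    and Q = nat_mapD(2)[OF q]
  obtain W w where w: "w \<in> homs C W T" "is_epi C w" "universal w W T"
    using universal_coverE[OF T] by blast
  have W: "W \<in> objs C" using w homs_objs by blast
  obtain s where s: "\<And>i. s i \<in> homs C W (ob X i)" "\<And>i. q i \<cdot> s i = a i \<cdot> w"
    using nat_map_lift[OF q qe w(3), of a, OF a] by blast
  note hs = nat_map_comp[OF h s(1)]
  obtain W' w' y where w': "w' \<in> homs C W' W" "is_epi C w'" and "\<forall>i. y i \<in> homs C W' (ob Y i)"
    and sol: "shift_solution Y (\<lambda>i. (h i \<cdot> s i) \<cdot> w') y"
    using lim1_zeroD[OF lY W, of "\<lambda>i. h i \<cdot> s i", OF hs] by blast
  then have y: "\<And>i. y i \<in> homs C W' (ob Y i)" by blast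
  note hsw = comp_hom[OF w'(1) hs] and fy = bond_comp[OF Y y]
  have W': "W' \<in> objs C" using w' homs_objs by blast
  have "bond Z i \<cdot> (p (Suc i) \<cdot> y (Suc i)) = p i \<cdot> y i" for i
  proof -
    have "p i \<cdot> ((h i \<cdot> s i) \<cdot> w') = arr_zero C W' (ob Z i)"
      using cokernel_comp_zero[OF c nat_mapD(3)[OF h] nat_mapD(3)[OF p] comp_hom[OF w'(1) s(1)]]
        nat_map_pre[OF h s(1) w'(1)] by simp
    then have "p i \<cdot> y i = arr_zero C W' (ob Z i) \<^bold>+ bond Z i \<cdot> (p (Suc i) \<cdot> y (Suc i))"
      using shift_solutionD[OF shift_solution_map[OF p hsw y sol], of i] by (simp only:)
    then show ?thesis
      unfolding zero_add[OF bond_comp[OF Z nat_map_comp[OF p y]]] by (rule sym)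
  qed
  then have py: "p i \<cdot> y i = arr_zero C W' (ob Z i)" for i
    by (rule lim0D[OF lZ nat_map_comp[OF p y], rotated])
  obtain V v where v: "v \<in> homs C V W'" "is_epi C v" "universal v V W'"
    using universal_coverE[OF W'] by blast
  obtain z where z: "\<And>i. z i \<in> homs C V (ob X i)" "\<And>i. h i \<cdot> z i = y i \<cdot> v"
    using nat_map_exact[OF h p c v(3), of y, OF y py] by blast
  define u where "u = w' \<cdot> v"
  have u: "u \<in> homs C V W" "is_epi C u" unfolding u_def using comp_hom v w' epi_comp by blast+
  note su = comp_hom[OF u(1) s(1)] and fz = bond_comp[OF X z(1)]
  have "q i \<cdot> z i = a i \<cdot> (w \<cdot> u) \<^bold>+ bond Q i \<cdot> (q (Suc i) \<cdot> z (Suc i))" for i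
  proof -
    have r: "s i \<cdot> u \<^bold>+ bond X i \<cdot> z (Suc i) \<in> homs C V (ob X i)" by (rule add_hom[OF su fz])
    have "h i \<cdot> z i = h i \<cdot> (s i \<cdot> u \<^bold>+ bond X i \<cdot> z (Suc i))"
    proof -
      have "y i \<cdot> v = ((h i \<cdot> s i) \<cdot> w') \<cdot> v \<^bold>+ bond Y i \<cdot> (y (Suc i) \<cdot> v)"
        by (rule shift_solutionD[OF shift_solution_precomp[OF Y hsw y sol v(1)]])
      moreover have "((h i \<cdot> s i) \<cdot> w') \<cdot> v = h i \<cdot> (s i \<cdot> u)"
        using comp_assoc[OF v(1) w'(1) hs] nat_map_pre[OF h s(1) u(1)] by (simp add: u_def)
      moreover have "bond Y i \<cdot> (y (Suc i) \<cdot> v) = h i \<cdot> (bond X i \<cdot> z (Suc i))"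
        using nat_map_bond[OF h z(1)] z(2) by simp
      ultimately show ?thesis unfolding z(2) nat_map_add[OF h su fz] by (simp only:)
    qed
    then have "h i \<cdot> (z i \<^bold>- (s i \<cdot> u \<^bold>+ bond X i \<cdot> z (Suc i))) = arr_zero C V (ob Y i)"
      using nat_map_diff_zero_iff[OF h z(1) r] by blast
    then have "q i \<cdot> z i = q i \<cdot> (s i \<cdot> u \<^bold>+ bond X i \<cdot> z (Suc i))"
      using hq[OF diff_hom[OF z(1) r]] nat_map_diff_zero_iff[OF q z(1) r] by blast
    also have "\<dots> = q i \<cdot> (s i \<cdot> u) \<^bold>+ q i \<cdot> (bond X i \<cdot> z (Suc i))" by (rule nat_map_add[OF q su fz])
    also have "q i \<cdot> (s i \<cdot> u) = a i \<cdot> (w \<cdot> u)"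
      using nat_map_pre[OF q s(1) u(1)] s(2) comp_assoc[OF u(1) w(1) a] by simp
    also have "q i \<cdot> (bond X i \<cdot> z (Suc i)) = bond Q i \<cdot> (q (Suc i) \<cdot> z (Suc i))"
      by (rule nat_map_bond[OF q z(1)])
    finally show ?thesis .
  qed
  then have "shift_solution Q (\<lambda>i. a i \<cdot> (w \<cdot> u)) (\<lambda>i. q i \<cdot> z i)"
    by (rule shift_solutionI)
  then show "\<exists>W w x. w \<in> homs C W T \<and> is_epi C w \<and> (\<forall>i. x i \<in> homs C W (ob Q i)) \<and>
    shift_solution Q (\<lambda>i. a i \<cdot> w) x"
    by (rule lim1_zero_witness[OF comp_hom[OF u(1) w(1)] epi_comp[OF u(1) w(1) u(2) w(2)]
        nat_map_comp[OF q z(1)]])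
qed

text \<open>Meant for Q = S^(\<beta>+1) and Q' = S^\<beta>: \<open>qq'\<close> provides a map from Q
  to Q', and \<open>q'q\<close> says that its kernel has zero bonds. A compatible family of Q dies
  in Q', and each of its members is the bond image of the next, hence zero.\<close>

lemma lim0_succ:
  assumes q: "nat_map X Q q" and qe: "\<And>i. is_epi C (q i)" and q': "nat_map X Q' q'"
    and qq': "\<And>i T s. s \<in> homs C T (ob X i) \<Longrightarrow> q i \<cdot> s = arr_zero C T (ob Q i) \<Longrightarrow>
      q' i \<cdot> s = arr_zero C T (ob Q' i)"
    and q'q: "\<And>i T s. s \<in> homs C T (ob X (Suc i)) \<Longrightarrow> q' (Suc i) \<cdot> s = arr_zero C T (ob Q' (Suc i)) \<Longrightarrow>
      q i \<cdot> (bond X i \<cdot> s) = arr_zero C T (ob Q i)"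
    and l: "lim0 Q'"
  shows "lim0 Q"
  unfolding lim0_def
proof (intro allI impI)
  fix T x i
  assume "\<forall>i. x i \<in> homs C T (ob Q i)" "\<forall>i. bond Q i \<cdot> x (Suc i) = x i"
  then have x: "\<And>i. x i \<in> homs C T (ob Q i)" and xc: "\<And>i. bond Q i \<cdot> x (Suc i) = x i" by auto
  note X = nat_mapD(1)[OF q] and Q = nat_mapD(2)[OF q] and Q' = nat_mapD(2)[OF q']
  have T: "T \<in> objs C" using x homs_objs by blast
  obtain W w where w: "w \<in> homs C W T" "is_epi C w" "universal w W T"
    using universal_coverE[OF T] by blast
  obtain s where s: "\<And>i. s i \<in> homs C W (ob X i)" "\<And>i. q i \<cdot> s i = x i \<cdot> w"
    using nat_map_lift[OF q qe w(3), of x, OF x] by blast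
  note fs = bond_comp[OF X s(1)]
  have qf: "q i \<cdot> (bond X i \<cdot> s (Suc i)) = q i \<cdot> s i" for i
    using nat_map_bond[OF q s(1)] s(2) bond_pre[OF Q x w(1)] xc by simp
  have "q' i \<cdot> s i = q' i \<cdot> (bond X i \<cdot> s (Suc i))" for i
    using qq'[OF diff_hom[OF s(1) fs]] nat_map_diff_zero_iff[OF q s(1) fs]
      nat_map_diff_zero_iff[OF q' s(1) fs] qf by simp
  then have "bond Q' i \<cdot> (q' (Suc i) \<cdot> s (Suc i)) = q' i \<cdot> s i" for i
    unfolding nat_map_bond[OF q' s(1)] by (rule sym)
  then have "q' i \<cdot> s i = arr_zero C W (ob Q' i)" for i
    by (rule lim0D[OF l nat_map_comp[OF q' s(1)], rotated])
  then have "x i \<cdot> w = arr_zero C W (ob Q i)"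
    using q'q[OF s(1), of i] qf[of i] s(2)[of i] by simp
  then show "x i = arr_zero C T (ob Q i)" using epi_zero[OF w(2,1) x] by blast
qed

text \<open>A lift \<open>y\<close> to X of a solution in Q' satisfies the equation up to the kernel
  of \<open>q'\<close>. Replacing \<open>y\<close> by its own right-hand side \<open>z\<close>
  changes it by such an error only, and the bond moves that error into the kernel of
  \<open>q\<close>; so \<open>z\<close> is an exact solution in Q.\<close>

lemma lim1_zero_succ:
  assumes q: "nat_map X Q q" and qe: "\<And>i. is_epi C (q i)"
    and q': "nat_map X Q' q'" and qe': "\<And>i. is_epi C (q' i)"
    and q'q: "\<And>i T s. s \<in> homs C T (ob X (Suc i)) \<Longrightarrow> q' (Suc i) \<cdot> s = arr_zero C T (ob Q' (Suc i)) \<Longrightarrow>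
      q i \<cdot> (bond X i \<cdot> s) = arr_zero C T (ob Q i)"
    and l: "lim1_zero Q'"
  shows "lim1_zero Q"
proof (rule lim1_zeroI)
  fix T a assume T: "T \<in> objs C" and a: "\<And>i. a i \<in> homs C T (ob Q i)"
  note X = nat_mapD(1)[OF q] and Q = nat_mapD(2)[OF q] and Q' = nat_mapD(2)[OF q']
  obtain W w where w: "w \<in> homs C W T" "is_epi C w" "universal w W T"
    using universal_coverE[OF T] by blast
  have W: "W \<in> objs C" using w homs_objs by blast
  obtain s where s: "\<And>i. s i \<in> homs C W (ob X i)" "\<And>i. q i \<cdot> s i = a i \<cdot> w"
    using nat_map_lift[OF q qe w(3), of a, OF a] by blast
  note qs = nat_map_comp[OF q' s(1)]
  obtain W' w' x where w': "w' \<in> homs C W' W" "is_epi C w'" and "\<forall>i. x i \<in> homs C W' (ob Q' i)"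
    and sol: "shift_solution Q' (\<lambda>i. (q' i \<cdot> s i) \<cdot> w') x"
    using lim1_zeroD[OF l W, of "\<lambda>i. q' i \<cdot> s i", OF qs] by blast
  then have x: "\<And>i. x i \<in> homs C W' (ob Q' i)" by blast
  have W': "W' \<in> objs C" using w' homs_objs by blast
  obtain V v where v: "v \<in> homs C V W'" "is_epi C v" "universal v V W'"
    using universal_coverE[OF W'] by blast
  obtain y where y: "\<And>i. y i \<in> homs C V (ob X i)" "\<And>i. q' i \<cdot> y i = x i \<cdot> v"
    using nat_map_lift[OF q' qe' v(3), of x, OF x] by blast
  define u where "u = w' \<cdot> v"
  have u: "u \<in> homs C V W" "is_epi C u" unfolding u_def using comp_hom v w' epi_comp by blast+
  note su = comp_hom[OF u(1) s(1)] and fy = bond_comp[OF X y(1)]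
  define z where "z i = s i \<cdot> u \<^bold>+ bond X i \<cdot> y (Suc i)" for i
  have z: "z i \<in> homs C V (ob X i)" for i unfolding z_def by (rule add_hom[OF su fy])
  have "q' i \<cdot> y i = q' i \<cdot> z i" for i
  proof -
    have "x i \<cdot> v = ((q' i \<cdot> s i) \<cdot> w') \<cdot> v \<^bold>+ bond Q' i \<cdot> (x (Suc i) \<cdot> v)"
      by (rule shift_solutionD[OF shift_solution_precomp[OF Q' comp_hom[OF w'(1) qs] x sol v(1)]])
    moreover have "((q' i \<cdot> s i) \<cdot> w') \<cdot> v = q' i \<cdot> (s i \<cdot> u)"
      using comp_assoc[OF v(1) w'(1) qs] nat_map_pre[OF q' s(1) u(1)] by (simp add: u_def)
    moreover have "bond Q' i \<cdot> (x (Suc i) \<cdot> v) = q' i \<cdot> (bond X i \<cdot> y (Suc i))"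
      using nat_map_bond[OF q' y(1)] y(2) by simp
    ultimately show ?thesis unfolding y(2) z_def nat_map_add[OF q' su fy] by (simp only:)
  qed
  then have "q' i \<cdot> (y i \<^bold>- z i) = arr_zero C V (ob Q' i)" for i
    using nat_map_diff_zero_iff[OF q' y(1) z] by blast
  then have "q i \<cdot> (bond X i \<cdot> (y (Suc i) \<^bold>- z (Suc i))) = arr_zero C V (ob Q i)" for i
    using q'q[OF diff_hom[OF y(1) z]] by blast
  then have qfz: "q i \<cdot> (bond X i \<cdot> y (Suc i)) = q i \<cdot> (bond X i \<cdot> z (Suc i))" for i
    using bond_diff[OF X y(1) z] nat_map_diff_zero_iff[OF q fy bond_comp[OF X z]] by simp
  have "q i \<cdot> z i = a i \<cdot> (w \<cdot> u) \<^bold>+ bond Q i \<cdot> (q (Suc i) \<cdot> z (Suc i))" for i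
  proof -
    have "q i \<cdot> z i = q i \<cdot> (s i \<cdot> u) \<^bold>+ q i \<cdot> (bond X i \<cdot> z (Suc i))"
      using nat_map_add[OF q su fy] qfz by (simp add: z_def)
    moreover have "q i \<cdot> (s i \<cdot> u) = a i \<cdot> (w \<cdot> u)"
      using nat_map_pre[OF q s(1) u(1)] s(2) comp_assoc[OF u(1) w(1) a] by simp
    ultimately show ?thesis using nat_map_bond[OF q z] by simp
  qed
  then have "shift_solution Q (\<lambda>i. a i \<cdot> (w \<cdot> u)) (\<lambda>i. q i \<cdot> z i)"
    by (rule shift_solutionI)
  then show "\<exists>W w x. w \<in> homs C W T \<and> is_epi C w \<and> (\<forall>i. x i \<in> homs C W (ob Q i)) \<and>
    shift_solution Q (\<lambda>i. a i \<cdot> w) x"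
    by (rule lim1_zero_witness[OF comp_hom[OF u(1) w(1)] epi_comp[OF u(1) w(1) u(2) w(2)]
        nat_map_comp[OF q z]])
qed

text \<open>The maps from Q to the \<open>R \<beta>\<close> are present only as the kernel condition
  \<open>qr\<close>, so the argument runs on lifts to X: they become compatible, hence zero, in
  every \<open>R \<beta>\<close>.\<close>

lemma lim0_limit:
  assumes q: "nat_map X Q q" and qe: "\<And>i. is_epi C (q i)"
    and r: "\<And>\<beta>. \<beta> \<in> B \<Longrightarrow> nat_map X (R \<beta>) (r \<beta>)"
    and qr: "\<And>i T s. s \<in> homs C T (ob X i) \<Longrightarrow> q i \<cdot> s = arr_zero C T (ob Q i) \<longleftrightarrow>
      (\<forall>\<beta>\<in>B. r \<beta> i \<cdot> s = arr_zero C T (ob (R \<beta>) i))"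
    and l: "\<And>\<beta>. \<beta> \<in> B \<Longrightarrow> lim0 (R \<beta>)"
  shows "lim0 Q"
  unfolding lim0_def
proof (intro allI impI)
  fix T x i
  assume "\<forall>i. x i \<in> homs C T (ob Q i)" "\<forall>i. bond Q i \<cdot> x (Suc i) = x i"
  then have x: "\<And>i. x i \<in> homs C T (ob Q i)" and xc: "\<And>i. bond Q i \<cdot> x (Suc i) = x i" by auto
  note X = nat_mapD(1)[OF q] and Q = nat_mapD(2)[OF q]
  have T: "T \<in> objs C" using x homs_objs by blast
  obtain W w where w: "w \<in> homs C W T" "is_epi C w" "universal w W T"
    using universal_coverE[OF T] by blast
  obtain s where s: "\<And>i. s i \<in> homs C W (ob X i)" "\<And>i. q i \<cdot> s i = x i \<cdot> w"
    using nat_map_lift[OF q qe w(3), of x, OF x] by blast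
  note fs = bond_comp[OF X s(1)]
  have "q i \<cdot> (bond X i \<cdot> s (Suc i)) = q i \<cdot> s i" for i
    using nat_map_bond[OF q s(1)] s(2) bond_pre[OF Q x w(1)] xc by simp
  then have eq: "q i \<cdot> (s i \<^bold>- bond X i \<cdot> s (Suc i)) = arr_zero C W (ob Q i)" for i
    using nat_map_diff_zero_iff[OF q s(1) fs] by simp
  have "r \<beta> i \<cdot> s i = arr_zero C W (ob (R \<beta>) i)" if \<beta>: "\<beta> \<in> B" for i \<beta>
  proof -
    have "r \<beta> i \<cdot> s i = r \<beta> i \<cdot> (bond X i \<cdot> s (Suc i))" for i
      using eq[of i, unfolded qr[OF diff_hom[OF s(1) fs]]] \<beta>
        nat_map_diff_zero_iff[OF r[OF \<beta>] s(1) fs] by blast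
    then have "bond (R \<beta>) i \<cdot> (r \<beta> (Suc i) \<cdot> s (Suc i)) = r \<beta> i \<cdot> s i" for i
      unfolding nat_map_bond[OF r[OF \<beta>] s(1)] by (rule sym)
    then show ?thesis
      by (rule lim0D[OF l[OF \<beta>] nat_map_comp[OF r[OF \<beta>] s(1)], rotated])
  qed
  then have "x i \<cdot> w = arr_zero C W (ob Q i)" using qr[OF s(1)] s(2)[of i] by simp
  then show "x i = arr_zero C T (ob Q i)" using epi_zero[OF w(2,1) x] by blast
qed

lemma lim0_joint_mono:
  assumes r: "\<And>\<beta>. \<beta> \<in> B \<Longrightarrow> nat_map Y (R \<beta>) (r \<beta>)"
    and ext: "\<And>i T s t. s \<in> homs C T (ob Y i) \<Longrightarrow> t \<in> homs C T (ob Y i) \<Longrightarrow>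
      (\<forall>\<beta>\<in>B. r \<beta> i \<cdot> s = r \<beta> i \<cdot> t) \<Longrightarrow> s = t"
    and Y: "inverse_sequence C Y" and l: "\<And>\<beta>. \<beta> \<in> B \<Longrightarrow> lim0 (R \<beta>)"
  shows "lim0 Y"
  unfolding lim0_def
proof (intro allI impI)
  fix T x i
  assume "\<forall>i. x i \<in> homs C T (ob Y i)" "\<forall>i. bond Y i \<cdot> x (Suc i) = x i"
  then have x: "\<And>i. x i \<in> homs C T (ob Y i)" and xc: "\<And>i. bond Y i \<cdot> x (Suc i) = x i" by auto
  have T: "T \<in> objs C" using x homs_objs by blast
  show "x i = arr_zero C T (ob Y i)"
  proof (rule ext[OF x zero_hom[OF T ob_obj[OF Y]]], rule ballI)
    fix \<beta> assume \<beta>: "\<beta> \<in> B"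
    have "bond (R \<beta>) i \<cdot> (r \<beta> (Suc i) \<cdot> x (Suc i)) = r \<beta> i \<cdot> x i" for i
      using nat_map_bond[OF r[OF \<beta>] x, of i] xc by simp
    then have "r \<beta> i \<cdot> x i = arr_zero C T (ob (R \<beta>) i)"
      by (rule lim0D[OF l[OF \<beta>] nat_map_comp[OF r[OF \<beta>] x], rotated])
    then show "r \<beta> i \<cdot> x i = r \<beta> i \<cdot> arr_zero C T (ob Y i)"
      using comp_zero[OF nat_mapD(3)[OF r[OF \<beta>]] T] by simp
  qed
qed

text \<open>Two solutions differ by a compatible family.\<close>

lemma shift_solution_unique:
  assumes X: "inverse_sequence C X" and l: "lim0 X"
    and a: "\<And>i. a i \<in> homs C T (ob X i)"
    and x: "\<And>i. x i \<in> homs C T (ob X i)" "shift_solution X a x"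
    and y: "\<And>i. y i \<in> homs C T (ob X i)" "shift_solution X a y"
  shows "x i = y i"
proof -
  note fx = bond_comp[OF X x(1)] and fy = bond_comp[OF X y(1)]
  have "bond X i \<cdot> (x (Suc i) \<^bold>- y (Suc i)) = x i \<^bold>- y i" for i
  proof -
    have d: "bond X i \<cdot> x (Suc i) \<^bold>- bond X i \<cdot> y (Suc i) \<in> homs C T (ob X i)"
      by (rule diff_hom[OF fx fy])
    have "x i = a i \<^bold>+ ((bond X i \<cdot> x (Suc i) \<^bold>- bond X i \<cdot> y (Suc i)) \<^bold>+ bond X i \<cdot> y (Suc i))"
      using shift_solutionD[OF x(2), of i] diff_add[OF fx fy] by simp
    also have "\<dots> = (bond X i \<cdot> x (Suc i) \<^bold>- bond X i \<cdot> y (Suc i)) \<^bold>+ y i"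
      using shift_solutionD[OF y(2), of i] add_assoc[OF a d fy] add_comm[OF a d] add_assoc[OF d a fy]
      by simp
    finally have "x i \<^bold>- y i = bond X i \<cdot> x (Suc i) \<^bold>- bond X i \<cdot> y (Suc i)"
      using diff_eq_iff[OF x(1) y(1) d] by blast
    then show ?thesis using bond_diff[OF X x(1) y(1)] by simp
  qed
  then have "x i \<^bold>- y i = arr_zero C T (ob X i)"
    by (rule lim0D[OF l diff_hom[OF x(1) y(1)], rotated])
  then show ?thesis using diff_zero_iff[OF x(1) y(1)] by blast
qed

text \<open>The cover that carries a solution depends on X and \<open>a\<close>. Factoring a
  universal \<open>w\<close> through it transports the solution to W, so that solutions for many
  sequences can be compared on one source.\<close>

lemma lim1_zero_universal:
  assumes X: "inverse_sequence C X" and l: "lim1_zero X" and w: "universal w W T"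
    and a: "\<And>i. a i \<in> homs C T (ob X i)"
  shows "\<exists>x. (\<forall>i. x i \<in> homs C W (ob X i)) \<and> shift_solution X (\<lambda>i. a i \<cdot> w) x"
proof -
  have T: "T \<in> objs C" using a homs_objs by blast
  obtain V v x where v: "v \<in> homs C V T" "is_epi C v" and "\<forall>i. x i \<in> homs C V (ob X i)"
    and sol: "shift_solution X (\<lambda>i. a i \<cdot> v) x"
    using lim1_zeroD[OF l T, of a, OF a] by blast
  then have x: "\<And>i. x i \<in> homs C V (ob X i)" by blast
  obtain s where s: "s \<in> homs C W V" "v \<cdot> s = w" using universalD[OF w v] by blast
  have "shift_solution X (\<lambda>i. a i \<cdot> w) (\<lambda>i. x i \<cdot> s)"
    using shift_solution_precomp[OF X comp_hom[OF v(1) a] x sol s(1)]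
    unfolding comp_assoc[OF s(1) v(1) a] s(2) .
  then show ?thesis by (intro exI[of _ "\<lambda>i. x i \<cdot> s"] conjI allI comp_hom[OF s(1) x])
qed

text \<open>All solutions live on one W. The transition maps carry solutions to solutions of the
  same equations, so by uniqueness they form a cone. Since no lift is chosen along the ordinals, the
  cofinality does not matter.\<close>

lemma lim1_zero_limit:
  fixes R :: "'u \<Rightarrow> ('o, 'm) inv_seq"
  assumes r: "\<And>\<beta>. \<beta> \<in> B \<Longrightarrow> nat_map Y (R \<beta>) (r \<beta>)"
    and t: "\<And>\<beta> \<gamma>. \<beta> \<in> B \<Longrightarrow> \<gamma> \<in> B \<Longrightarrow> \<beta> \<le> \<gamma> \<Longrightarrow> nat_map (R \<gamma>) (R \<beta>) (t \<beta> \<gamma>)"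
    and lim: "\<And>i. is_limit C B (\<lambda>\<beta>. ob (R \<beta>) i) (\<lambda>\<beta> \<gamma>. t \<beta> \<gamma> i) (ob Y i) (\<lambda>\<beta>. r \<beta> i)"
    and Y: "inverse_sequence C Y"
    and l0: "\<And>\<beta>. \<beta> \<in> B \<Longrightarrow> lim0 (R \<beta>)" and l1: "\<And>\<beta>. \<beta> \<in> B \<Longrightarrow> lim1_zero (R \<beta>)"
  shows "lim1_zero Y"
proof (rule lim1_zeroI)
  fix T a assume T: "T \<in> objs C" and a: "\<And>i. a i \<in> homs C T (ob Y i)"
  obtain W w where w: "w \<in> homs C W T" "is_epi C w" "universal w W T"
    using universal_coverE[OF T] by blast
  have W: "W \<in> objs C" using w homs_objs by blast
  have "\<exists>x. (\<forall>i. x i \<in> homs C W (ob (R \<beta>) i)) \<and> shift_solution (R \<beta>) (\<lambda>i. (r \<beta> i \<cdot> a i) \<cdot> w) x"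
    if \<beta>: "\<beta> \<in> B" for \<beta>
    by (rule lim1_zero_universal[OF nat_mapD(2)[OF r[OF \<beta>]] l1[OF \<beta>] w(3)])
      (rule nat_map_comp[OF r[OF \<beta>] a])
  then obtain x where x: "\<And>\<beta> i. \<beta> \<in> B \<Longrightarrow> x \<beta> i \<in> homs C W (ob (R \<beta>) i)"
    and sol: "\<And>\<beta>. \<beta> \<in> B \<Longrightarrow> shift_solution (R \<beta>) (\<lambda>i. (r \<beta> i \<cdot> a i) \<cdot> w) (x \<beta>)" by metis
  have tr: "t \<beta> \<gamma> i \<cdot> (r \<gamma> i \<cdot> s) = r \<beta> i \<cdot> s"
    if "\<beta> \<in> B" "\<gamma> \<in> B" "\<beta> \<le> \<gamma>" "s \<in> homs C V (ob Y i)" for \<beta> \<gamma> i s V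
  proof -
    have "t \<beta> \<gamma> i \<cdot> r \<gamma> i = r \<beta> i" using lim[of i] that by (auto simp: is_limit_def is_cone_def)
    then show ?thesis
      using comp_eq[OF _ nat_mapD(3)[OF r[OF that(2)]] nat_mapD(3)[OF t[OF that(1-3)]] that(4)] by blast
  qed
  have aw: "a i \<cdot> w \<in> homs C W (ob Y i)" for i by (rule comp_hom[OF w(1) a])
  have raw: "(r \<beta> i \<cdot> a i) \<cdot> w \<in> homs C W (ob (R \<beta>) i)" if "\<beta> \<in> B" for \<beta> i
    by (rule comp_hom[OF w(1) nat_map_comp[OF r[OF that] a]])
  have "t \<beta> \<gamma> i \<cdot> x \<gamma> i = x \<beta> i" if b: "\<beta> \<in> B" "\<gamma> \<in> B" "\<beta> \<le> \<gamma>" for \<beta> \<gamma> i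
  proof (rule shift_solution_unique[OF nat_mapD(2)[OF r[OF b(1)]] l0[OF b(1)]])
    show "(r \<beta> i \<cdot> a i) \<cdot> w \<in> homs C W (ob (R \<beta>) i)" for i by (rule raw[OF b(1)])
    show "x \<beta> i \<in> homs C W (ob (R \<beta>) i)" for i by (rule x[OF b(1)])
    show "shift_solution (R \<beta>) (\<lambda>i. (r \<beta> i \<cdot> a i) \<cdot> w) (x \<beta>)" by (rule sol[OF b(1)])
    show "t \<beta> \<gamma> i \<cdot> x \<gamma> i \<in> homs C W (ob (R \<beta>) i)" for i by (rule nat_map_comp[OF t[OF b] x[OF b(2)]])
    have "t \<beta> \<gamma> i \<cdot> ((r \<gamma> i \<cdot> a i) \<cdot> w) = (r \<beta> i \<cdot> a i) \<cdot> w" for i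
      using tr[OF b aw] nat_map_pre[OF r[OF b(2)] a w(1)] nat_map_pre[OF r[OF b(1)] a w(1)] by simp
    then show "shift_solution (R \<beta>) (\<lambda>i. (r \<beta> i \<cdot> a i) \<cdot> w) (\<lambda>i. t \<beta> \<gamma> i \<cdot> x \<gamma> i)"
      using shift_solution_map[OF t[OF b], of "\<lambda>i. (r \<gamma> i \<cdot> a i) \<cdot> w" W "x \<gamma>",
        OF raw[OF b(2)] x[OF b(2)] sol[OF b(2)]] by simp
  qed
  then have "is_cone C B (\<lambda>\<beta>. ob (R \<beta>) i) (\<lambda>\<beta> \<gamma>. t \<beta> \<gamma> i) W (\<lambda>\<beta>. x \<beta> i)" for i
    unfolding is_cone_def using W x by blast
  then have "\<exists>y. y \<in> homs C W (ob Y i) \<and> (\<forall>\<beta>\<in>B. r \<beta> i \<cdot> y = x \<beta> i)" for i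
    using lim[of i] unfolding is_limit_def Ex1_def by blast
  then obtain y where y: "\<And>i. y i \<in> homs C W (ob Y i)" "\<And>i \<beta>. \<beta> \<in> B \<Longrightarrow> r \<beta> i \<cdot> y i = x \<beta> i" by metis
  have "y i = a i \<cdot> w \<^bold>+ bond Y i \<cdot> y (Suc i)" for i
  proof -
    note fy = bond_comp[OF Y y(1)]
    have eq: "r \<beta> i \<cdot> (a i \<cdot> w \<^bold>+ bond Y i \<cdot> y (Suc i)) = x \<beta> i" if \<beta>: "\<beta> \<in> B" for \<beta>
      using nat_map_add[OF r[OF \<beta>] aw fy] nat_map_bond[OF r[OF \<beta>] y(1)] y(2)[OF \<beta>]
        nat_map_pre[OF r[OF \<beta>] a w(1)] shift_solutionD[OF sol[OF \<beta>], of i] by simp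
    have "is_cone C B (\<lambda>\<beta>. ob (R \<beta>) i) (\<lambda>\<beta> \<gamma>. t \<beta> \<gamma> i) W (\<lambda>\<beta>. x \<beta> i)" by fact
    then have "\<exists>!h. h \<in> homs C W (ob Y i) \<and> (\<forall>\<beta>\<in>B. r \<beta> i \<cdot> h = x \<beta> i)"
      using lim[of i] unfolding is_limit_def by blast
    moreover have "y i \<in> homs C W (ob Y i) \<and> (\<forall>\<beta>\<in>B. r \<beta> i \<cdot> y i = x \<beta> i)" using y by blast
    moreover have "a i \<cdot> w \<^bold>+ bond Y i \<cdot> y (Suc i) \<in> homs C W (ob Y i) \<and>
        (\<forall>\<beta>\<in>B. r \<beta> i \<cdot> (a i \<cdot> w \<^bold>+ bond Y i \<cdot> y (Suc i)) = x \<beta> i)"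
      using eq add_hom[OF aw fy] by blast
    ultimately show ?thesis by (rule ex1_unique)
  qed
  then have "shift_solution Y (\<lambda>i. a i \<cdot> w) y"
    by (rule shift_solutionI)
  then show "\<exists>W w x. w \<in> homs C W T \<and> is_epi C w \<and> (\<forall>i. x i \<in> homs C W (ob Y i)) \<and>
    shift_solution Y (\<lambda>i. a i \<cdot> w) x"
    by (rule lim1_zero_witness[OF w(1,2) y(1)])
qed

text \<open>A lift \<open>y\<close> to X of a solution in Q fails the equation by an error
  \<open>b\<close> from M. Solving the equation for \<open>b\<close> in M and subtracting the result
  repairs the lift.\<close>

lemma lim1_zero_extension:
  assumes m: "nat_map M X m" and q: "nat_map X Q q" and qe: "\<And>i. is_epi C (q i)"
    and mq: "\<And>i T s. s \<in> homs C T (ob X i) \<Longrightarrow> q i \<cdot> s = arr_zero C T (ob Q i) \<Longrightarrow>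
      \<exists>s'\<in>homs C T (ob M i). m i \<cdot> s' = s"
    and lM: "lim1_zero M" and lQ: "lim1_zero Q"
  shows "lim1_zero X"
proof (rule lim1_zeroI)
  fix T a assume T: "T \<in> objs C" and a: "\<And>i. a i \<in> homs C T (ob X i)"
  note M = nat_mapD(1)[OF m] and X = nat_mapD(1)[OF q] and Q = nat_mapD(2)[OF q]
  obtain W w x where w: "w \<in> homs C W T" "is_epi C w" and "\<forall>i. x i \<in> homs C W (ob Q i)"
    and sol: "shift_solution Q (\<lambda>i. (q i \<cdot> a i) \<cdot> w) x"
    using lim1_zeroD[OF lQ T, of "\<lambda>i. q i \<cdot> a i", OF nat_map_comp[OF q a]] by blast
  then have x: "\<And>i. x i \<in> homs C W (ob Q i)" by blast
  have W: "W \<in> objs C" using w homs_objs by blast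
  obtain V v where v: "v \<in> homs C V W" "is_epi C v" "universal v V W"
    using universal_coverE[OF W] by blast
  have V: "V \<in> objs C" using v homs_objs by blast
  obtain y where y: "\<And>i. y i \<in> homs C V (ob X i)" "\<And>i. q i \<cdot> y i = x i \<cdot> v"
    using nat_map_lift[OF q qe v(3), of x, OF x] by blast
  define u where "u = w \<cdot> v"
  have u: "u \<in> homs C V T" "is_epi C u" unfolding u_def using comp_hom v w epi_comp by blast+
  note au = comp_hom[OF u(1) a] and fy = bond_comp[OF X y(1)]
  note r = add_hom[OF au fy]
  have "q i \<cdot> y i = q i \<cdot> (a i \<cdot> u \<^bold>+ bond X i \<cdot> y (Suc i))" for i
  proof -
    have "x i \<cdot> v = ((q i \<cdot> a i) \<cdot> w) \<cdot> v \<^bold>+ bond Q i \<cdot> (x (Suc i) \<cdot> v)"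
      by (rule shift_solutionD[OF
            shift_solution_precomp[OF Q comp_hom[OF w(1) nat_map_comp[OF q a]] x sol v(1)]])
    moreover have "((q i \<cdot> a i) \<cdot> w) \<cdot> v = q i \<cdot> (a i \<cdot> u)"
      using comp_assoc[OF v(1) w(1) nat_map_comp[OF q a]] nat_map_pre[OF q a u(1)] by (simp add: u_def)
    moreover have "bond Q i \<cdot> (x (Suc i) \<cdot> v) = q i \<cdot> (bond X i \<cdot> y (Suc i))"
      using nat_map_bond[OF q y(1)] y(2) by simp
    ultimately show ?thesis unfolding y(2) nat_map_add[OF q au fy] by (simp only:)
  qed
  then have "q i \<cdot> (y i \<^bold>- (a i \<cdot> u \<^bold>+ bond X i \<cdot> y (Suc i))) = arr_zero C V (ob Q i)" for i
    using nat_map_diff_zero_iff[OF q y(1) r] by blast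
  then have "\<exists>b. b \<in> homs C V (ob M i) \<and> m i \<cdot> b = y i \<^bold>- (a i \<cdot> u \<^bold>+ bond X i \<cdot> y (Suc i))" for i
    using mq[OF diff_hom[OF y(1) r]] by blast
  then obtain b where b: "\<And>i. b i \<in> homs C V (ob M i)"
    "\<And>i. m i \<cdot> b i = y i \<^bold>- (a i \<cdot> u \<^bold>+ bond X i \<cdot> y (Suc i))" by metis
  obtain V' v' z where v': "v' \<in> homs C V' V" "is_epi C v'" and "\<forall>i. z i \<in> homs C V' (ob M i)"
    and sol': "shift_solution M (\<lambda>i. b i \<cdot> v') z"
    using lim1_zeroD[OF lM V, of b, OF b(1)] by blast
  then have z: "\<And>i. z i \<in> homs C V' (ob M i)" by blast
  define t where "t = u \<cdot> v'"
  have t: "t \<in> homs C V' T" "is_epi C t" unfolding t_def using comp_hom v' u epi_comp by blast+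
  note yv = comp_hom[OF v'(1) y(1)] and at = comp_hom[OF t(1) a] and mz = nat_map_comp[OF m z]
  note fyv = bond_comp[OF X yv] and fmz = bond_comp[OF X mz]
  have "y i \<cdot> v' \<^bold>- m i \<cdot> z i = a i \<cdot> t \<^bold>+ bond X i \<cdot> (y (Suc i) \<cdot> v' \<^bold>- m (Suc i) \<cdot> z (Suc i))" for i
  proof -
    let ?f = "bond X i \<cdot> (y (Suc i) \<cdot> v')" and ?g = "bond X i \<cdot> (m (Suc i) \<cdot> z (Suc i))"
    have rt: "a i \<cdot> t \<^bold>+ ?f \<in> homs C V' (ob X i)" by (rule add_hom[OF at fyv])
    have "m i \<cdot> z i = m i \<cdot> (b i \<cdot> v') \<^bold>+ ?g"
      by (rule shift_solutionD[OF shift_solution_map[OF m comp_hom[OF v'(1) b(1)] z sol']])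
    also have "m i \<cdot> (b i \<cdot> v') = y i \<cdot> v' \<^bold>- (a i \<cdot> t \<^bold>+ ?f)"
      using nat_map_pre[OF m b(1) v'(1)] b(2) comp_diff_left[OF v'(1) y(1) r]
        comp_add_left[OF v'(1) au fy] comp_assoc[OF v'(1) u(1) a] bond_pre[OF X y(1) v'(1)]
      by (simp add: t_def)
    finally have "y i \<cdot> v' \<^bold>- m i \<cdot> z i = (a i \<cdot> t \<^bold>+ ?f) \<^bold>- ?g"
      using diff_diff_add[OF yv rt fmz] by simp
    also have "\<dots> = a i \<cdot> t \<^bold>+ (?f \<^bold>- ?g)"
    proof -
      note fg = diff_hom[OF fyv fmz]
      have "a i \<cdot> t \<^bold>+ (?f \<^bold>- ?g) \<^bold>+ ?g = a i \<cdot> t \<^bold>+ ?f"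
        using add_assoc[OF at fg fmz] diff_add[OF fyv fmz] by simp
      then show ?thesis using diff_eq_iff[OF rt fmz add_hom[OF at fg]] by simp
    qed
    also have "?f \<^bold>- ?g = bond X i \<cdot> (y (Suc i) \<cdot> v' \<^bold>- m (Suc i) \<cdot> z (Suc i))"
      using bond_diff[OF X yv mz] by simp
    finally show ?thesis .
  qed
  then have "shift_solution X (\<lambda>i. a i \<cdot> t) (\<lambda>i. y i \<cdot> v' \<^bold>- m i \<cdot> z i)"
    by (rule shift_solutionI)
  then show "\<exists>W w x. w \<in> homs C W T \<and> is_epi C w \<and> (\<forall>i. x i \<in> homs C W (ob X i)) \<and>
    shift_solution X (\<lambda>i. a i \<cdot> w) x"
    by (rule lim1_zero_witness[OF t diff_hom[OF yv mz]])
qed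

end

section \<open>Cokernels of completions along a countable tower\<close>

context complete_abelian_category
begin

text \<open>In a completion along a countable tower infinite sums can be formed. A generalized
  element of Y_i is approximated by lifts \<open>s n\<close>; their differences have bond preimages
  \<open>e n\<close> so deep in the filtration that the sum of the \<open>e n\<close> converges at
  level i + 1. Up to a cover, Y_i is therefore the image of its bond plus the image of X_i. The
  index shift in \<open>image\<close> says that one bond preimage costs one term of the
  tower.\<close>

lemma completion_cokernel_bond_epi:
  fixes Q :: "nat \<Rightarrow> ('o, 'm) inv_seq"
  assumes h: "nat_map X Y h" and p: "nat_map Y Z p" and c: "\<And>i. is_cokernel C (h i) (p i)"
    and q: "\<And>n. nat_map X (Q n) (q n)" and qe: "\<And>n i. is_epi C (q n i)"
    and r: "\<And>n. nat_map Y (Q n) (r n)" and rh: "\<And>n i. r n i \<cdot> h i = q n i"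
    and t: "\<And>n. nat_map (Q (Suc n)) (Q n) (t n)" and tq: "\<And>n i. t n i \<cdot> q (Suc n) i = q n i"
    and tr: "\<And>n i. t n i \<cdot> r (Suc n) i = r n i"
    and lim: "\<And>i T x. T \<in> objs C \<Longrightarrow> (\<And>n. x n \<in> homs C T (ob (Q n) i)) \<Longrightarrow>
      (\<And>n. t n i \<cdot> x (Suc n) = x n) \<Longrightarrow> \<exists>y\<in>homs C T (ob Y i). \<forall>n. r n i \<cdot> y = x n"
    and ext: "\<And>i T s s'. s \<in> homs C T (ob Y i) \<Longrightarrow> s' \<in> homs C T (ob Y i) \<Longrightarrow>
      (\<And>n. r n i \<cdot> s = r n i \<cdot> s') \<Longrightarrow> s = s'"
    and image: "\<And>n i T s. s \<in> homs C T (ob X i) \<Longrightarrow>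
      q (Suc n) i \<cdot> s = arr_zero C T (ob (Q (Suc n)) i) \<Longrightarrow>
      \<exists>V v s'. v \<in> homs C V T \<and> is_epi C v \<and> s' \<in> homs C V (ob X (Suc i)) \<and>
        q n (Suc i) \<cdot> s' = arr_zero C V (ob (Q n) (Suc i)) \<and> bond X i \<cdot> s' = s \<cdot> v"
  shows "is_epi C (bond Z i)"
proof (rule epiI[OF bond_hom[OF nat_mapD(2)[OF p]]])
  note X = nat_mapD(1)[OF h] and Y = nat_mapD(2)[OF h] and Z = nat_mapD(2)[OF p]
  fix U u assume u: "u \<in> homs C (ob Z i) U" and u0: "u \<cdot> bond Z i = arr_zero C (ob Z (Suc i)) U"
  have U: "U \<in> objs C" using u homs_objs by blast
  obtain W w where w: "w \<in> homs C W (ob Y i)" "is_epi C w" "universal w W (ob Y i)"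
    using universal_coverE[OF ob_obj[OF Y]] by blast
  have W: "W \<in> objs C" using w homs_objs by blast
  have "\<exists>s. s \<in> homs C W (ob X i) \<and> q n i \<cdot> s = r n i \<cdot> w" for n
    using universal_lift_along[OF w(3) nat_mapD(3)[OF q] qe nat_mapD(3)[OF r]] by blast
  then obtain s where s: "\<And>n. s n \<in> homs C W (ob X i)" "\<And>n. q n i \<cdot> s n = r n i \<cdot> w" by metis
  define d where "d n = s (Suc n) \<^bold>- s n" for n
  have d: "d n \<in> homs C W (ob X i)" for n unfolding d_def by (rule diff_hom[OF s(1) s(1)])
  have qs: "q n i \<cdot> s (Suc n) = r n i \<cdot> w" for n
    using comp_eq[OF tq nat_mapD(3)[OF q] nat_mapD(3)[OF t] s(1), of n "Suc n"]
      comp_eq[OF tr nat_mapD(3)[OF r] nat_mapD(3)[OF t] w(1), of n] s(2)[of "Suc n"] by simp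
  have qd: "q n i \<cdot> d n = arr_zero C W (ob (Q n) i)" for n
    unfolding d_def nat_map_diff_zero_iff[OF q s(1) s(1)] qs s(2) ..
  obtain W' w' where w': "w' \<in> homs C W' W" "is_epi C w'" "universal w' W' W"
    using universal_coverE[OF W] by blast
  have W': "W' \<in> objs C" using w' homs_objs by blast
  \<comment> \<open>\<open>d (Suc n)\<close> dies in \<open>Q (Suc n)\<close>, its bond preimage
    only in \<open>Q n\<close>; hence the telescoping sum starts at \<open>s (Suc 0)\<close>.
    Universality of \<open>w'\<close> brings the preimages for all n onto one W'.\<close>
  have "\<exists>e. e \<in> homs C W' (ob X (Suc i)) \<and> q n (Suc i) \<cdot> e = arr_zero C W' (ob (Q n) (Suc i)) \<and>
      bond X i \<cdot> e = d (Suc n) \<cdot> w'" for n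
  proof -
    obtain V v s' where v: "v \<in> homs C V W" "is_epi C v" and s': "s' \<in> homs C V (ob X (Suc i))"
        "q n (Suc i) \<cdot> s' = arr_zero C V (ob (Q n) (Suc i))" "bond X i \<cdot> s' = d (Suc n) \<cdot> v"
      using image[OF d qd, of n] by blast
    obtain g where g: "g \<in> homs C W' V" "v \<cdot> g = w'" using universalD[OF w'(3) v] by blast
    have "q n (Suc i) \<cdot> (s' \<cdot> g) = arr_zero C W' (ob (Q n) (Suc i))"
      using nat_map_pre[OF q s'(1) g(1)] s'(2)
        zero_comp[OF g(1) ob_obj[OF nat_mapD(2)[OF q]]] by simp
    moreover have "bond X i \<cdot> (s' \<cdot> g) = d (Suc n) \<cdot> w'"
      using bond_pre[OF X s'(1) g(1)] s'(3) comp_assoc[OF g(1) v(1) d] g(2) by simp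
    ultimately show ?thesis using comp_hom[OF g(1) s'(1)] by blast
  qed
  then obtain e where e: "\<And>n. e n \<in> homs C W' (ob X (Suc i))"
    "\<And>n. q n (Suc i) \<cdot> e n = arr_zero C W' (ob (Q n) (Suc i))"
    "\<And>n. bond X i \<cdot> e n = d (Suc n) \<cdot> w'" by metis
  \<comment> \<open>Partial sums of the \<open>e n\<close>. Their images in \<open>Q n\<close> are
    compatible because the summand that is added, \<open>e n\<close>, dies in
    \<open>Q n\<close>.\<close>
  define E where "E = rec_nat (arr_zero C W' (ob X (Suc i))) (\<lambda>n a. a \<^bold>+ e n)"
  have E0: "E 0 = arr_zero C W' (ob X (Suc i))" and ES: "E (Suc n) = E n \<^bold>+ e n" for n
    by (simp_all add: E_def)
  have E: "E n \<in> homs C W' (ob X (Suc i))" for n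
  proof (induction n)
    case 0 show ?case unfolding E0 by (rule zero_hom[OF W' ob_obj[OF X]])
  next
    case (Suc n) then show ?case unfolding ES by (rule add_hom[OF _ e(1)])
  qed
  note sw = comp_hom[OF w'(1) s(1)]
  note fE = bond_comp[OF X E] and fe = bond_comp[OF X e(1)]
  have sum: "bond X i \<cdot> E n \<^bold>+ s (Suc 0) \<cdot> w' = s (Suc n) \<cdot> w'" for n
  proof (induction n)
    case 0
    show ?case
      unfolding E0 comp_zero[OF bond_hom[OF X] W'] by (rule zero_add[OF sw])
  next
    case (Suc n)
    have "bond X i \<cdot> E (Suc n) = bond X i \<cdot> E n \<^bold>+ bond X i \<cdot> e n"
      unfolding ES by (rule comp_add_right[OF E e(1) bond_hom[OF X]])
    then have "bond X i \<cdot> E (Suc n) \<^bold>+ s (Suc 0) \<cdot> w' = bond X i \<cdot> e n \<^bold>+ s (Suc n) \<cdot> w'"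
      using add_comm[OF fE fe] add_assoc[OF fe fE sw] Suc.IH by simp
    also have "bond X i \<cdot> e n = s (Suc (Suc n)) \<cdot> w' \<^bold>- s (Suc n) \<cdot> w'"
      unfolding e(3) d_def by (rule comp_diff_left[OF w'(1) s(1) s(1)])
    also have "\<dots> \<^bold>+ s (Suc n) \<cdot> w' = s (Suc (Suc n)) \<cdot> w'" by (rule diff_add[OF sw sw])
    finally show ?case .
  qed
  have "\<exists>y\<in>homs C W' (ob Y (Suc i)). \<forall>n. r n (Suc i) \<cdot> y = q n (Suc i) \<cdot> E n"
  proof (rule lim[OF W'])
    show "q n (Suc i) \<cdot> E n \<in> homs C W' (ob (Q n) (Suc i))" for n by (rule nat_map_comp[OF q E])
    have "t n (Suc i) \<cdot> (q (Suc n) (Suc i) \<cdot> E (Suc n)) = q n (Suc i) \<cdot> E (Suc n)" for n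
      by (rule comp_eq[OF tq nat_mapD(3)[OF q] nat_mapD(3)[OF t] E])
    also have "q n (Suc i) \<cdot> E (Suc n) = q n (Suc i) \<cdot> E n" for n
      unfolding ES nat_map_add[OF q E e(1)] e(2) by (rule add_zero[OF nat_map_comp[OF q E]])
    finally show "t n (Suc i) \<cdot> (q (Suc n) (Suc i) \<cdot> E (Suc n)) = q n (Suc i) \<cdot> E n" for n .
  qed
  then obtain y where y: "y \<in> homs C W' (ob Y (Suc i))" "\<And>n. r n (Suc i) \<cdot> y = q n (Suc i) \<cdot> E n"
    by blast
  define v where "v = w \<cdot> w'"
  have v: "v \<in> homs C W' (ob Y i)" "is_epi C v" unfolding v_def using comp_hom w' w epi_comp by blast+
  note fy = bond_comp[OF Y y(1)] and hs = nat_map_comp[OF h sw]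
  \<comment> \<open>\<open>y\<close> is the infinite sum of the \<open>e n\<close>, whose images under the bond telescope to \<open>v - h (s 1)\<close>\<close>
  have "bond Y i \<cdot> y \<^bold>+ h i \<cdot> (s (Suc 0) \<cdot> w') = v"
  proof (rule ext[OF add_hom[OF fy hs] v(1)])
    fix n
    have "r n i \<cdot> (bond Y i \<cdot> y \<^bold>+ h i \<cdot> (s (Suc 0) \<cdot> w')) =
        r n i \<cdot> (bond Y i \<cdot> y) \<^bold>+ r n i \<cdot> (h i \<cdot> (s (Suc 0) \<cdot> w'))"
      by (rule nat_map_add[OF r fy hs])
    also have "r n i \<cdot> (bond Y i \<cdot> y) = q n i \<cdot> (bond X i \<cdot> E n)"
      using nat_map_bond[OF r y(1)] y(2) nat_map_bond[OF q E] by simp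
    also have "r n i \<cdot> (h i \<cdot> (s (Suc 0) \<cdot> w')) = q n i \<cdot> (s (Suc 0) \<cdot> w')"
      by (rule comp_eq[OF rh nat_mapD(3)[OF h] nat_mapD(3)[OF r] sw])
    also have "q n i \<cdot> (bond X i \<cdot> E n) \<^bold>+ q n i \<cdot> (s (Suc 0) \<cdot> w') = q n i \<cdot> (s (Suc n) \<cdot> w')"
      unfolding nat_map_add[OF q fE sw, symmetric] sum ..
    also have "\<dots> = r n i \<cdot> v"
      using nat_map_pre[OF q s(1) w'(1)] qs comp_assoc[OF w'(1) w(1) nat_mapD(3)[OF r]]
      by (simp add: v_def)
    finally show "r n i \<cdot> (bond Y i \<cdot> y \<^bold>+ h i \<cdot> (s (Suc 0) \<cdot> w')) = r n i \<cdot> v" .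
  qed
  note v_eq = this
  note pi = nat_mapD(3)[OF p, of i]
  have up: "u \<cdot> p i \<in> homs C (ob Y i) U" by (rule comp_hom[OF pi u])
  \<comment> \<open>\<open>p\<close> kills the image of \<open>h\<close>, and \<open>u\<close> kills
    what the bond of Z hits, so both summands of \<open>v\<close> vanish.\<close>
  have "(u \<cdot> p i) \<cdot> v = (u \<cdot> p i) \<cdot> (bond Y i \<cdot> y) \<^bold>+ (u \<cdot> p i) \<cdot> (h i \<cdot> (s (Suc 0) \<cdot> w'))"
    unfolding v_eq[symmetric] by (rule comp_add_right[OF fy hs up])
  also have "(u \<cdot> p i) \<cdot> (h i \<cdot> (s (Suc 0) \<cdot> w')) = arr_zero C W' U"
    using comp_assoc[OF hs pi u] cokernel_comp_zero[OF c nat_mapD(3)[OF h] pi sw]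
      comp_zero[OF u W'] by simp
  also have "(u \<cdot> p i) \<cdot> (bond Y i \<cdot> y) = arr_zero C W' U"
    using comp_assoc[OF fy pi u] nat_map_bond[OF p y(1)]
      comp_eq[OF u0 bond_hom[OF Z] u nat_map_comp[OF p y(1)]]
      zero_comp[OF nat_map_comp[OF p y(1)] U] by simp
  also have "arr_zero C W' U \<^bold>+ arr_zero C W' U = arr_zero C W' U" by (rule add_zero[OF zero_hom[OF W' U]])
  finally have "u \<cdot> p i = arr_zero C (ob Y i) U" by (rule epi_zero[OF v(2,1) up])
  then show "u = arr_zero C (ob Z i) U" by (rule epi_zero[OF cokernel_epi[OF c] pi u])
qed

section \<open>The category of inverse sequences\<close>

abbreviation seq_homs :: "('o, 'm) inv_seq \<Rightarrow> ('o, 'm) inv_seq \<Rightarrow> ('o, 'm) seq_map set" where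
  "seq_homs \<equiv> homs (seq_cat C)"

abbreviation seq_comp :: "('o, 'm) seq_map \<Rightarrow> ('o, 'm) seq_map \<Rightarrow> ('o, 'm) seq_map" (infixr "\<odot>" 70) where
  "\<psi> \<odot> \<phi> \<equiv> \<psi> \<cdot>\<^bsub>seq_cat C\<^esub> \<phi>"

lemma seq_hom_iff:
  "\<phi> \<in> seq_homs X Y \<longleftrightarrow> map_src \<phi> = X \<and> map_tgt \<phi> = Y \<and> nat_map X Y (component \<phi>)"
  by (auto simp: homs_def seq_cat_def nat_map_def)

lemma seq_cat_simps [simp]:
  "objs (seq_cat C) = {X. inverse_sequence C X}" "src (seq_cat C) = map_src" "tgt (seq_cat C) = map_tgt"
  "component (\<psi> \<odot> \<phi>) i = component \<psi> i \<cdot> component \<phi> i"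
  "map_src (\<psi> \<odot> \<phi>) = map_src \<phi>" "map_tgt (\<psi> \<odot> \<phi>) = map_tgt \<psi>"
  "component (arr_zero (seq_cat C) X Y) i = arr_zero C (ob X i) (ob Y i)"
  "component (ident (seq_cat C) X) i = ident C (ob X i)"
  by (simp_all add: seq_cat_def)

lemma seq_hom_ext:
  assumes "\<phi> \<in> seq_homs X Y" "\<psi> \<in> seq_homs X Y"
    "\<And>i. component \<phi> i = component \<psi> i"
  shows "\<phi> = \<psi>"
proof -
  have "component \<phi> = component \<psi>" using assms(3) by blast
  then show ?thesis using assms(1,2) by (auto simp: seq_hom_iff intro: seq_map.expand)
qed

lemma seq_homI: "nat_map X Y h \<Longrightarrow> Seq_Map X Y h \<in> seq_homs X Y"
  by (simp add: seq_hom_iff)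

lemma seq_homD:
  assumes "\<phi> \<in> seq_homs X Y"
  shows "nat_map X Y (component \<phi>)" "map_src \<phi> = X" "map_tgt \<phi> = Y"
  using assms by (auto simp: seq_hom_iff)

lemmas seq_component = nat_mapD(3)[OF seq_homD(1)]

lemma nat_map_compose:
  assumes f: "nat_map X Y f" and g: "nat_map Y Z g"
  shows "nat_map X Z (\<lambda>i. g i \<cdot> f i)"
  unfolding nat_map_def
proof (intro conjI allI)
  show "inverse_sequence C X" "inverse_sequence C Z" using nat_mapD f g by blast+
  note X = bond_hom[OF nat_mapD(1)[OF f]] and Y = bond_hom[OF nat_mapD(1)[OF g]]
    and Z = bond_hom[OF nat_mapD(2)[OF g]]
  show "g i \<cdot> f i \<in> homs C (ob X i) (ob Z i)" for i using comp_hom nat_mapD(3) f g by blast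
  show "(g i \<cdot> f i) \<cdot> bond X i = bond Z i \<cdot> (g (Suc i) \<cdot> f (Suc i))" for i
    using comp_assoc[OF X nat_mapD(3)[OF f] nat_mapD(3)[OF g]] nat_mapD(4)[OF f]
      nat_map_bond[OF g nat_mapD(3)[OF f]] by simp
qed

lemma seq_ident:
  assumes X: "inverse_sequence C X"
  shows "ident (seq_cat C) X \<in> seq_homs X X"
proof -
  have "nat_map X X (\<lambda>i. ident C (ob X i))"
    unfolding nat_map_def
    using X ident_hom[OF ob_obj[OF X]] ident_left[OF bond_hom[OF X]]
      ident_right[OF bond_hom[OF X]] by simp
  then show ?thesis using seq_homI by (simp add: seq_cat_def)
qed

lemma seq_category: "category (seq_cat C)"
proof
  show "src (seq_cat C) f \<in> objs (seq_cat C) \<and> tgt (seq_cat C) f \<in> objs (seq_cat C)"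
    if "f \<in> arrs (seq_cat C)" for f
    using that by (auto simp: seq_cat_def)
  show "ident (seq_cat C) X \<in> seq_homs X X" if "X \<in> objs (seq_cat C)" for X
    using that by (simp add: seq_ident)
  show c: "g \<odot> f \<in> seq_homs X Z"
    if "f \<in> seq_homs X Y" "g \<in> seq_homs Y Z" for f g X Y Z
    using that nat_map_compose[of X Y "component f" Z "component g"]
    unfolding seq_hom_iff by (simp add: nat_map_def)
  note i = seq_ident
  show "ident (seq_cat C) Y \<odot> f = f" "f \<odot> ident (seq_cat C) X = f"
    if f: "f \<in> seq_homs X Y" for f X Y
  proof -
    note f' = seq_homD(1)[OF f]
    show "ident (seq_cat C) Y \<odot> f = f"
      by (rule seq_hom_ext[OF c[OF f i[OF nat_mapD(2)[OF f']]] f])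
        (simp add: ident_left[OF nat_mapD(3)[OF f']])
    show "f \<odot> ident (seq_cat C) X = f"
      by (rule seq_hom_ext[OF c[OF i[OF nat_mapD(1)[OF f']] f] f])
        (simp add: ident_right[OF nat_mapD(3)[OF f']])
  qed
  show "(h \<odot> g) \<odot> f = h \<odot> (g \<odot> f)"
    if "f \<in> seq_homs W X" "g \<in> seq_homs X Y" "h \<in> seq_homs Y Z" for f g h W X Y Z
    by (rule seq_hom_ext[OF c[OF that(1) c[OF that(2,3)]] c[OF c[OF that(1,2)] that(3)]])
      (simp add: comp_assoc[OF seq_component[OF that(1)]
        seq_component[OF that(2)] seq_component[OF that(3)]])
qed

sublocale seq: category "seq_cat C"
  by (rule seq_category)

lemma seq_mono:
  assumes m: "m \<in> seq_homs X Y" and "\<And>i. is_mono C (component m i)"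
  shows "is_mono (seq_cat C) m"
  unfolding seq.mono_iff[OF m]
proof (intro allI ballI impI)
  fix W g h assume g: "g \<in> seq_homs W X" and h: "h \<in> seq_homs W X"
    and eq: "m \<odot> g = m \<odot> h"
  show "g = h"
  proof (rule seq_hom_ext[OF g h])
    fix i
    have "component m i \<cdot> component g i = component m i \<cdot> component h i"
      using arg_cong[OF eq, of "\<lambda>\<phi>. component \<phi> i"] by simp
    then show "component g i = component h i"
      using monoD[OF assms(2)] nat_mapD(3) seq_homD(1) m g h by metis
  qed
qed

lemma seq_epi:
  assumes p: "p \<in> seq_homs X Y" and "\<And>i. is_epi C (component p i)"
  shows "is_epi (seq_cat C) p"
  unfolding seq.epi_iff[OF p]
proof (intro allI ballI impI)
  fix W g h assume g: "g \<in> seq_homs Y W" and h: "h \<in> seq_homs Y W"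
    and eq: "g \<odot> p = h \<odot> p"
  show "g = h"
  proof (rule seq_hom_ext[OF g h])
    fix i
    have "component g i \<cdot> component p i = component h i \<cdot> component p i"
      using arg_cong[OF eq, of "\<lambda>\<phi>. component \<phi> i"] by simp
    then show "component g i = component h i"
      using epiD[OF assms(2)] nat_mapD(3) seq_homD(1) p g h by metis
  qed
qed

text \<open>Naturality of the induced family is checked after composing with the epimorphism
  \<open>p (Suc i)\<close>.\<close>

lemma nat_map_factor_epi:
  assumes p: "nat_map X Y p" and e: "\<And>i. is_epi C (p i)" and g: "nat_map X Z g"
    and h: "\<And>i. h i \<in> homs C (ob Y i) (ob Z i)" "\<And>i. h i \<cdot> p i = g i"
  shows "nat_map Y Z h"
  unfolding nat_map_def
proof (intro conjI allI h(1))
  show Y: "inverse_sequence C Y" and Z: "inverse_sequence C Z" using nat_mapD p g by blast+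
  note bX = bond_hom[OF nat_mapD(1)[OF p]] and bY = bond_hom[OF Y]
    and bZ = bond_hom[OF Z]
  fix i
  have "(h i \<cdot> bond Y i) \<cdot> p (Suc i) = (bond Z i \<cdot> h (Suc i)) \<cdot> p (Suc i)"
    using comp_assoc[OF nat_mapD(3)[OF p] bY h(1)] nat_mapD(4)[OF p]
      comp_eq[OF h(2) nat_mapD(3)[OF p] h(1) bX] nat_mapD(4)[OF g]
      comp_assoc[OF nat_mapD(3)[OF p] h(1) bZ] h(2) by simp
  then show "h i \<cdot> bond Y i = bond Z i \<cdot> h (Suc i)"
    by (rule epiD[OF e nat_mapD(3)[OF p] comp_hom[OF bY h(1)] comp_hom[OF h(1) bZ]])
qed

lemma seq_zero:
  assumes X: "inverse_sequence C X" and Y: "inverse_sequence C Y"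
  shows "arr_zero (seq_cat C) X Y \<in> seq_homs X Y"
proof -
  note X' = inverse_sequenceD[OF X] and Y' = inverse_sequenceD[OF Y]
  have "nat_map X Y (\<lambda>i. arr_zero C (ob X i) (ob Y i))"
    unfolding nat_map_def
    using X Y zero_hom[OF X'(1) Y'(1)] zero_comp[OF X'(2) Y'(1)] comp_zero[OF Y'(2) X'(1)] by simp
  then show ?thesis using seq_homI by (simp add: seq_cat_def)
qed

lemma seq_cokernel_exists:
  assumes \<phi>: "\<phi> \<in> seq_homs X Y"
  shows "\<exists>Z p. p \<in> seq_homs Y Z \<and> is_cokernel (seq_cat C) \<phi> p \<and>
    (\<forall>i. is_cokernel C (component \<phi> i) (component p i))"
proof -
  note f = seq_homD(1)[OF \<phi>]
  define f where "f = component \<phi>"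
  note f = f[folded f_def]
  note X = nat_mapD(1)[OF f] and Y = nat_mapD(2)[OF f]
  note bX = bond_hom[OF X] and bY = bond_hom[OF Y]
  define c where "c i = coker C (f i)" for i
  define Zo where "Zo i = tgt C (c i)" for i
  have cc: "is_cokernel C (f i) (c i)" for i
    unfolding c_def by (rule coker_is[OF hom_arr(1)[OF nat_mapD(3)[OF f]]])
  note c = cokernelD[OF cc nat_mapD(3)[OF f], folded Zo_def]
  have ce: "is_epi C (c i)" for i by (rule cokernel_epi[OF cc])
  have "\<exists>b. b \<in> homs C (Zo (Suc i)) (Zo i) \<and> b \<cdot> c (Suc i) = c i \<cdot> bond Y i" for i
  proof -
    have "(c i \<cdot> bond Y i) \<cdot> f (Suc i) = arr_zero C (ob X (Suc i)) (Zo i)"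
      using comp_assoc[OF nat_mapD(3)[OF f] bY c(1)] nat_mapD(4)[OF f, symmetric]
        comp_eq[OF c(2) nat_mapD(3)[OF f] c(1) bX] zero_comp[OF bX homs_objs(2)[OF c(1)]] by simp
    then show ?thesis using c(3)[OF comp_hom[OF bY c(1)]] by blast
  qed
  then obtain b where b: "\<And>i. b i \<in> homs C (Zo (Suc i)) (Zo i)"
    "\<And>i. b i \<cdot> c (Suc i) = c i \<cdot> bond Y i" by metis
  define Z where "Z = Inv_Seq Zo b"
  have Z: "inverse_sequence C Z" using b homs_objs(2)[OF c(1)] by (auto simp: inverse_sequence_def Z_def)
  have cn: "nat_map Y Z c" using Y Z c(1) b by (simp add: nat_map_def Z_def)
  define p where "p = Seq_Map Y Z c"
  have p: "p \<in> seq_homs Y Z" unfolding p_def by (rule seq_homI[OF cn])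
  have "is_cokernel (seq_cat C) \<phi> p"
  proof (rule seq.cokernelI[OF \<phi> p])
    show "p \<odot> \<phi> = arr_zero (seq_cat C) X Z"
      by (rule seq_hom_ext[OF seq.comp_hom[OF \<phi> p] seq_zero[OF X Z]])
        (simp add: p_def f_def[symmetric] c(2) Z_def)
    fix W g assume g: "g \<in> seq_homs Y W" and 0: "g \<odot> \<phi> = arr_zero (seq_cat C) X W"
    note g' = seq_homD(1)[OF g]
    have "component g i \<cdot> f i = arr_zero C (ob X i) (ob W i)" for i
      using arg_cong[OF 0, of "\<lambda>\<phi>. component \<phi> i"] by (simp add: f_def)
    then have "\<exists>h. h \<in> homs C (Zo i) (ob W i) \<and> h \<cdot> c i = component g i" for i
      using c(3)[OF nat_mapD(3)[OF g']] by blast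
    then obtain h where h: "\<And>i. h i \<in> homs C (Zo i) (ob W i)" "\<And>i. h i \<cdot> c i = component g i" by metis
    have "nat_map Z W h"
      by (rule nat_map_factor_epi[OF cn ce g']) (simp_all add: Z_def h)
    then have H: "Seq_Map Z W h \<in> seq_homs Z W" by (rule seq_homI)
    show "\<exists>!h. h \<in> seq_homs Z W \<and> h \<odot> p = g"
    proof (rule ex1I[of _ "Seq_Map Z W h"])
      have Hp: "Seq_Map Z W h \<odot> p = g"
        by (rule seq_hom_ext[OF seq.comp_hom[OF p H] g]) (simp add: p_def h(2))
      then show "Seq_Map Z W h \<in> seq_homs Z W \<and> Seq_Map Z W h \<odot> p = g"
        using H by blast
      fix k assume k: "k \<in> seq_homs Z W \<and> k \<odot> p = g"
      have "is_epi (seq_cat C) p" by (rule seq_epi[OF p]) (simp add: p_def ce)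
      then show "k = Seq_Map Z W h"
        using seq.epiD[OF _ p _ H] k Hp by simp
    qed
  qed
  then show ?thesis using p cc by (intro exI[of _ Z] exI[of _ p]) (simp add: p_def f_def)
qed

text \<open>\<open>coker\<close> picks an arbitrary cokernel of sequences, not the one built
  componentwise. The comparison maps \<open>a\<close> and \<open>b\<close> between the two transport
  the universal property to each component.\<close>

lemma seq_coker:
  assumes \<phi>: "\<phi> \<in> seq_homs X Y"
  defines "p \<equiv> coker (seq_cat C) \<phi>"
  shows "p \<in> seq_homs Y (map_tgt p)"
    "is_cokernel C (component \<phi> i) (component p i)"
proof -
  obtain Z c where c: "c \<in> seq_homs Y Z" "is_cokernel (seq_cat C) \<phi> c"
    "\<And>i. is_cokernel C (component \<phi> i) (component c i)"
    using seq_cokernel_exists[OF \<phi>] by blast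
  have pc: "is_cokernel (seq_cat C) \<phi> p"
    unfolding p_def coker_def by (rule someI[of _ c]) (rule c(2))
  note p = seq.cokernelD[OF pc \<phi>, simplified]
  note c' = seq.cokernelD[OF c(2) \<phi>, simplified, unfolded seq_homD(3)[OF c(1)]]
  define P where "P = map_tgt p"
  note p = p[folded P_def]
  show "p \<in> seq_homs Y (map_tgt p)" using p(1) by (simp add: P_def)
  obtain a where a: "a \<in> seq_homs Z P" "a \<odot> c = p"
    using c'(3)[OF p(1,2)] by blast
  obtain b where b: "b \<in> seq_homs P Z" "b \<odot> p = c"
    using p(3)[OF c'(1,2)] by blast
  have Po: "P \<in> objs (seq_cat C)" using seq.homs_objs[OF p(1)] by blast
  have "a \<odot> b = ident (seq_cat C) P"
  proof (rule ex1_unique[OF p(3)[OF p(1,2)]])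
    show "a \<odot> b \<in> seq_homs P P \<and> (a \<odot> b) \<odot> p = p"
      using seq.comp_hom[OF b(1) a(1)] seq.comp_assoc[OF p(1) b(1) a(1)] a(2) b(2) by simp
    show "ident (seq_cat C) P \<in> seq_homs P P \<and> ident (seq_cat C) P \<odot> p = p"
      using seq.ident_hom[OF Po] seq.ident_left[OF p(1)] by blast
  qed
  from arg_cong[OF this, of "\<lambda>\<phi>. component \<phi> i"]
  have ab: "component a i \<cdot> component b i = ident C (ob P i)" by simp
  have ac: "component a i \<cdot> component c i = component p i"
    and bp: "component b i \<cdot> component p i = component c i"
    using arg_cong[OF a(2), of "\<lambda>\<phi>. component \<phi> i"] arg_cong[OF b(2), of "\<lambda>\<phi>. component \<phi> i"] by simp_all
  have fi: "component \<phi> i \<in> homs C (ob X i) (ob Y i)" and ci: "component c i \<in> homs C (ob Y i) (ob Z i)"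
    and pi: "component p i \<in> homs C (ob Y i) (ob P i)" and ai: "component a i \<in> homs C (ob Z i) (ob P i)"
    and bi: "component b i \<in> homs C (ob P i) (ob Z i)"
    using nat_mapD(3)[OF seq_homD(1)] \<phi> c(1) p(1) a(1) b(1) by blast+
  note cD = cokernelD[OF c(3)[of i] fi, unfolded hom_arr(3)[OF ci]]
  show "is_cokernel C (component \<phi> i) (component p i)"
  proof (rule cokernelI[OF fi pi])
    show "component p i \<cdot> component \<phi> i = arr_zero C (ob X i) (ob P i)"
      using arg_cong[OF p(2), of "\<lambda>\<phi>. component \<phi> i"] by simp
    fix W g assume g: "g \<in> homs C (ob Y i) W" "g \<cdot> component \<phi> i = arr_zero C (ob X i) W"
    obtain k where k: "k \<in> homs C (ob Z i) W" "k \<cdot> component c i = g" using cD(3)[OF g] by blast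
    show "\<exists>!h. h \<in> homs C (ob P i) W \<and> h \<cdot> component p i = g"
    proof (rule ex1I[of _ "k \<cdot> component b i"])
      show kb: "k \<cdot> component b i \<in> homs C (ob P i) W \<and> (k \<cdot> component b i) \<cdot> component p i = g"
        using comp_hom[OF bi k(1)] comp_assoc[OF pi bi k(1)] bp k(2) by simp
      fix h assume h: "h \<in> homs C (ob P i) W \<and> h \<cdot> component p i = g"
      then have h1: "h \<in> homs C (ob P i) W" by blast
      have "(h \<cdot> component a i) \<cdot> component c i = k \<cdot> component c i"
        using comp_assoc[OF ci ai h1] ac h k(2) by simp
      then have "h \<cdot> component a i = k"
        by (rule epiD[OF cokernel_epi[OF c(3)] ci comp_hom[OF ai h1] k(1)])
      then show "h = k \<cdot> component b i"
        using comp_assoc[OF bi ai h1] ab ident_right[OF h1] by simp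
    qed
  qed
qed

lemma limitD:
  assumes "is_limit C J X t L \<pi>"
  shows "L \<in> objs C" "\<And>\<beta>. \<beta> \<in> J \<Longrightarrow> \<pi> \<beta> \<in> homs C L (X \<beta>)"
    "\<And>\<beta> \<gamma>. \<beta> \<in> J \<Longrightarrow> \<gamma> \<in> J \<Longrightarrow> \<beta> \<le> \<gamma> \<Longrightarrow> t \<beta> \<gamma> \<cdot> \<pi> \<gamma> = \<pi> \<beta>"
  using assms by (auto simp: is_limit_def is_cone_def)

lemma limit_lift:
  assumes "is_limit C J X t L \<pi>" "Y \<in> objs C" "\<And>\<beta>. \<beta> \<in> J \<Longrightarrow> \<phi> \<beta> \<in> homs C Y (X \<beta>)"
    "\<And>\<beta> \<gamma>. \<beta> \<in> J \<Longrightarrow> \<gamma> \<in> J \<Longrightarrow> \<beta> \<le> \<gamma> \<Longrightarrow> t \<beta> \<gamma> \<cdot> \<phi> \<gamma> = \<phi> \<beta>"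
  shows "\<exists>h. h \<in> homs C Y L \<and> (\<forall>\<beta>\<in>J. \<pi> \<beta> \<cdot> h = \<phi> \<beta>)"
proof -
  have "is_cone C J X t Y \<phi>" using assms(2-4) unfolding is_cone_def by blast
  then have "\<exists>!h. h \<in> homs C Y L \<and> (\<forall>\<beta>\<in>J. \<pi> \<beta> \<cdot> h = \<phi> \<beta>)"
    using assms(1) unfolding is_limit_def by blast
  then show ?thesis by (rule ex1_implies_ex)
qed

lemma limit_ext:
  assumes lim: "is_limit C J X t L \<pi>"
    and t: "\<And>\<beta> \<gamma>. \<beta> \<in> J \<Longrightarrow> \<gamma> \<in> J \<Longrightarrow> \<beta> \<le> \<gamma> \<Longrightarrow> t \<beta> \<gamma> \<in> homs C (X \<gamma>) (X \<beta>)"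
    and g: "g \<in> homs C Y L" and h: "h \<in> homs C Y L"
    and eq: "\<And>\<beta>. \<beta> \<in> J \<Longrightarrow> \<pi> \<beta> \<cdot> g = \<pi> \<beta> \<cdot> h"
  shows "g = h"
proof -
  note L = limitD[OF lim]
  have "is_cone C J X t Y (\<lambda>\<beta>. \<pi> \<beta> \<cdot> h)"
    unfolding is_cone_def
    using homs_objs(1)[OF h] comp_hom[OF h L(2)] comp_eq[OF L(3) L(2) t h] by auto
  then have "\<exists>!k. k \<in> homs C Y L \<and> (\<forall>\<beta>\<in>J. \<pi> \<beta> \<cdot> k = \<pi> \<beta> \<cdot> h)"
    using lim unfolding is_limit_def by blast
  then show ?thesis by (rule ex1_unique) (use g h eq in auto)
qed

end

section \<open>Limits of inverse sequences are componentwise\<close>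

context complete_abelian_category
begin

lemma seq_is_coneI:
  assumes "inverse_sequence C Y" "\<And>\<beta>. \<beta> \<in> J \<Longrightarrow> \<phi> \<beta> \<in> seq_homs Y (X \<beta>)"
    "\<And>\<beta> \<gamma>. \<beta> \<in> J \<Longrightarrow> \<gamma> \<in> J \<Longrightarrow> \<beta> \<le> \<gamma> \<Longrightarrow> t \<beta> \<gamma> \<odot> \<phi> \<gamma> = \<phi> \<beta>"
  shows "is_cone (seq_cat C) J X t Y \<phi>"
  using assms by (simp add: is_cone_def)

lemma seq_is_coneD:
  assumes "is_cone (seq_cat C) J X t Y \<phi>"
  shows "inverse_sequence C Y" "\<And>\<beta>. \<beta> \<in> J \<Longrightarrow> \<phi> \<beta> \<in> seq_homs Y (X \<beta>)"
    "\<And>\<beta> \<gamma>. \<beta> \<in> J \<Longrightarrow> \<gamma> \<in> J \<Longrightarrow> \<beta> \<le> \<gamma> \<Longrightarrow> t \<beta> \<gamma> \<odot> \<phi> \<gamma> = \<phi> \<beta>"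
  using assms by (simp_all add: is_cone_def)

lemma seq_limit_exists:
  fixes J :: "'u set" and X :: "'u \<Rightarrow> ('o, 'm) inv_seq"
  assumes J: "small TYPE('u) J" and X: "\<And>\<beta>. \<beta> \<in> J \<Longrightarrow> inverse_sequence C (X \<beta>)"
    and t: "\<And>\<beta> \<gamma>. \<beta> \<in> J \<Longrightarrow> \<gamma> \<in> J \<Longrightarrow> \<beta> \<le> \<gamma> \<Longrightarrow> t \<beta> \<gamma> \<in> seq_homs (X \<gamma>) (X \<beta>)"
  shows "\<exists>L \<pi>. is_limit (seq_cat C) J X t L \<pi> \<and> (\<forall>i. is_limit C J (\<lambda>\<beta>. ob (X \<beta>) i)
    (\<lambda>\<beta> \<gamma>. component (t \<beta> \<gamma>) i) (ob L i) (\<lambda>\<beta>. component (\<pi> \<beta>) i))"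
proof -
  note tn = seq_homD(1)[OF t]
  note tc = nat_mapD(3)[OF tn]
  have "\<exists>L \<pi>. is_limit C J (\<lambda>\<beta>. ob (X \<beta>) i) (\<lambda>\<beta> \<gamma>. component (t \<beta> \<gamma>) i) L \<pi>" for i
    by (rule limit_exists[OF J ob_obj[OF X] tc])
  then obtain Lo \<rho> where lim: "\<And>i. is_limit C J (\<lambda>\<beta>. ob (X \<beta>) i) (\<lambda>\<beta> \<gamma>. component (t \<beta> \<gamma>) i) (Lo i) (\<rho> i)"
    by metis
  note L = limitD[OF lim]
  note bX = bond_hom[OF X]
  have "\<exists>b. b \<in> homs C (Lo (Suc i)) (Lo i) \<and> (\<forall>\<beta>\<in>J. \<rho> i \<beta> \<cdot> b = bond (X \<beta>) i \<cdot> \<rho> (Suc i) \<beta>)" for i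
  proof (rule limit_lift[OF lim L(1)])
    show "bond (X \<beta>) i \<cdot> \<rho> (Suc i) \<beta> \<in> homs C (Lo (Suc i)) (ob (X \<beta>) i)" if "\<beta> \<in> J" for \<beta>
      by (rule comp_hom[OF L(2)[OF that] bX[OF that]])
    show "component (t \<beta> \<gamma>) i \<cdot> (bond (X \<gamma>) i \<cdot> \<rho> (Suc i) \<gamma>) = bond (X \<beta>) i \<cdot> \<rho> (Suc i) \<beta>"
      if "\<beta> \<in> J" "\<gamma> \<in> J" "\<beta> \<le> \<gamma>" for \<beta> \<gamma>
      using nat_map_bond[OF tn[OF that] L(2)[OF that(2)]] L(3)[OF that] by simp
  qed
  then obtain b where b: "\<And>i. b i \<in> homs C (Lo (Suc i)) (Lo i)"
    "\<And>i \<beta>. \<beta> \<in> J \<Longrightarrow> \<rho> i \<beta> \<cdot> b i = bond (X \<beta>) i \<cdot> \<rho> (Suc i) \<beta>" by metis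
  define Ls where "Ls = Inv_Seq Lo b"
  have Ls: "inverse_sequence C Ls" using b L(1) by (simp add: inverse_sequence_def Ls_def)
  define \<pi> where "\<pi> \<beta> = Seq_Map Ls (X \<beta>) (\<lambda>i. \<rho> i \<beta>)" for \<beta>
  have \<pi>: "\<pi> \<beta> \<in> seq_homs Ls (X \<beta>)" if "\<beta> \<in> J" for \<beta>
    unfolding \<pi>_def
    by (rule seq_homI) (use Ls X[OF that] L(2)[OF that] b(2)[OF that] in \<open>simp add: nat_map_def Ls_def\<close>)
  have "is_limit (seq_cat C) J X t Ls \<pi>"
    unfolding is_limit_def
  proof (intro conjI allI impI)
    show "is_cone (seq_cat C) J X t Ls \<pi>"
    proof (rule seq_is_coneI[OF Ls \<pi>])
      show "t \<beta> \<gamma> \<odot> \<pi> \<gamma> = \<pi> \<beta>" if "\<beta> \<in> J" "\<gamma> \<in> J" "\<beta> \<le> \<gamma>" for \<beta> \<gamma>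
        by (rule seq_hom_ext[OF seq.comp_hom[OF \<pi>[OF that(2)] t[OF that]] \<pi>[OF that(1)]])
          (simp add: \<pi>_def L(3)[OF that])
    qed
    fix Y \<phi> assume cone: "is_cone (seq_cat C) J X t Y \<phi>"
    note Y = seq_is_coneD[OF cone]
    note \<phi> = seq_homD(1)[OF Y(2)]
    have \<phi>c: "component (t \<beta> \<gamma>) i \<cdot> component (\<phi> \<gamma>) i = component (\<phi> \<beta>) i"
      if "\<beta> \<in> J" "\<gamma> \<in> J" "\<beta> \<le> \<gamma>" for \<beta> \<gamma> i
      using arg_cong[OF Y(3)[OF that], of "\<lambda>\<phi>. component \<phi> i"] by simp
    have "\<exists>h. h \<in> homs C (ob Y i) (Lo i) \<and> (\<forall>\<beta>\<in>J. \<rho> i \<beta> \<cdot> h = component (\<phi> \<beta>) i)" for i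
      by (rule limit_lift[OF lim ob_obj[OF Y(1)] nat_mapD(3)[OF \<phi>] \<phi>c])
    then obtain h where h: "\<And>i. h i \<in> homs C (ob Y i) (Lo i)"
      "\<And>i \<beta>. \<beta> \<in> J \<Longrightarrow> \<rho> i \<beta> \<cdot> h i = component (\<phi> \<beta>) i" by metis
    note bY = bond_hom[OF Y(1)]
    have "h i \<cdot> bond Y i = b i \<cdot> h (Suc i)" for i
    proof (rule limit_ext[OF lim tc comp_hom[OF bY h(1)] comp_hom[OF h(1) b(1)]])
      fix \<beta> assume \<beta>: "\<beta> \<in> J"
      show "\<rho> i \<beta> \<cdot> (h i \<cdot> bond Y i) = \<rho> i \<beta> \<cdot> (b i \<cdot> h (Suc i))"
        using comp_eq[OF h(2)[OF \<beta>] h(1) L(2)[OF \<beta>] bY] nat_mapD(4)[OF \<phi>[OF \<beta>]]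
          comp_eq[OF b(2)[OF \<beta>] b(1) L(2)[OF \<beta>] h(1)]
          comp_assoc[OF h(1) L(2)[OF \<beta>] bX[OF \<beta>]] h(2)[OF \<beta>] by simp
    qed
    then have hn: "nat_map Y Ls h" using Y(1) Ls h(1) by (simp add: nat_map_def Ls_def)
    then have H: "Seq_Map Y Ls h \<in> seq_homs Y Ls" by (rule seq_homI)
    show "\<exists>!h. h \<in> seq_homs Y Ls \<and> (\<forall>\<beta>\<in>J. \<pi> \<beta> \<odot> h = \<phi> \<beta>)"
    proof (rule ex1I[of _ "Seq_Map Y Ls h"], intro conjI ballI H)
      show "\<pi> \<beta> \<odot> Seq_Map Y Ls h = \<phi> \<beta>" if "\<beta> \<in> J" for \<beta>
        by (rule seq_hom_ext[OF seq.comp_hom[OF H \<pi>[OF that]] Y(2)[OF that]])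
          (simp add: \<pi>_def h(2)[OF that])
      fix k assume k: "k \<in> seq_homs Y Ls \<and> (\<forall>\<beta>\<in>J. \<pi> \<beta> \<odot> k = \<phi> \<beta>)"
      then have k1: "k \<in> seq_homs Y Ls" by blast
      have ki: "component k i \<in> homs C (ob Y i) (Lo i)" for i
        using nat_mapD(3)[OF seq_homD(1)[OF k1], of i] by (simp add: Ls_def)
      show "k = Seq_Map Y Ls h"
      proof (rule seq_hom_ext[OF k1 H])
        show "component k i = component (Seq_Map Y Ls h) i" for i
          unfolding seq_map.sel
        proof (rule limit_ext[OF lim tc ki h(1)])
          fix \<beta> assume \<beta>: "\<beta> \<in> J"
          have "\<pi> \<beta> \<odot> k = \<phi> \<beta>" using k \<beta> by blast
          from arg_cong[OF this, of "\<lambda>\<phi>. component \<phi> i"]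
          show "\<rho> i \<beta> \<cdot> component k i = \<rho> i \<beta> \<cdot> h i" by (simp add: \<pi>_def h(2)[OF \<beta>])
        qed
      qed
    qed
  qed
  moreover have "is_limit C J (\<lambda>\<beta>. ob (X \<beta>) i) (\<lambda>\<beta> \<gamma>. component (t \<beta> \<gamma>) i) (ob Ls i)
      (\<lambda>\<beta>. component (\<pi> \<beta>) i)" for i
    using lim[of i] by (simp add: Ls_def \<pi>_def)
  ultimately show ?thesis by blast
qed

text \<open>As for cokernels, the limit picked by \<open>limit_cone\<close> is compared with the
  componentwise one, and the comparison maps carry the universal property over to each
  component.\<close>

lemma seq_limit_cone:
  fixes J :: "'u set" and X :: "'u \<Rightarrow> ('o, 'm) inv_seq"
  assumes J: "small TYPE('u) J" and X: "\<And>\<beta>. \<beta> \<in> J \<Longrightarrow> inverse_sequence C (X \<beta>)"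
    and t: "\<And>\<beta> \<gamma>. \<beta> \<in> J \<Longrightarrow> \<gamma> \<in> J \<Longrightarrow> \<beta> \<le> \<gamma> \<Longrightarrow> t \<beta> \<gamma> \<in> seq_homs (X \<gamma>) (X \<beta>)"
  defines "c \<equiv> limit_cone (seq_cat C) J X t"
  shows "is_limit (seq_cat C) J X t (fst c) (snd c)"
    and "is_limit C J (\<lambda>\<beta>. ob (X \<beta>) i) (\<lambda>\<beta> \<gamma>. component (t \<beta> \<gamma>) i) (ob (fst c) i)
      (\<lambda>\<beta>. component (snd c \<beta>) i)"
proof -
  define L where "L = fst c"
  define \<pi> where "\<pi> = snd c"
  obtain M \<rho> where M: "is_limit (seq_cat C) J X t M \<rho>"
    and Mi: "\<And>i. is_limit C J (\<lambda>\<beta>. ob (X \<beta>) i) (\<lambda>\<beta> \<gamma>. component (t \<beta> \<gamma>) i) (ob M i)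
      (\<lambda>\<beta>. component (\<rho> \<beta>) i)"
    using seq_limit_exists[OF J, of X t, OF X t] by blast
  have lim: "is_limit (seq_cat C) J X t L \<pi>"
    unfolding L_def \<pi>_def c_def limit_cone_def by (rule someI[of _ "(M, \<rho>)"]) (simp add: M)
  then show "is_limit (seq_cat C) J X t (fst c) (snd c)" by (simp add: L_def \<pi>_def)
  have Lc: "is_cone (seq_cat C) J X t L \<pi>" and Mc: "is_cone (seq_cat C) J X t M \<rho>"
    using lim M by (auto simp: is_limit_def)
  note L = seq_is_coneD[OF Lc] and M' = seq_is_coneD[OF Mc]
  obtain a where a: "a \<in> seq_homs L M" "\<And>\<beta>. \<beta> \<in> J \<Longrightarrow> \<rho> \<beta> \<odot> a = \<pi> \<beta>"
    using M[unfolded is_limit_def, THEN conjunct2, rule_format, OF Lc] by blast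
  obtain b where b: "b \<in> seq_homs M L" "\<And>\<beta>. \<beta> \<in> J \<Longrightarrow> \<pi> \<beta> \<odot> b = \<rho> \<beta>"
    using lim[unfolded is_limit_def, THEN conjunct2, rule_format, OF Mc] by blast
  have "b \<odot> a = ident (seq_cat C) L"
  proof (rule ex1_unique[OF lim[unfolded is_limit_def, THEN conjunct2, rule_format, OF Lc]])
    show "b \<odot> a \<in> seq_homs L L \<and> (\<forall>\<beta>\<in>J. \<pi> \<beta> \<odot> (b \<odot> a) = \<pi> \<beta>)"
      using seq.comp_hom[OF a(1) b(1)] seq.comp_eq[OF b(2) b(1) L(2) a(1)] a(2) by simp
    show "ident (seq_cat C) L \<in> seq_homs L L \<and> (\<forall>\<beta>\<in>J. \<pi> \<beta> \<odot> ident (seq_cat C) L = \<pi> \<beta>)"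
      using seq_ident[OF L(1)] seq.ident_right[OF L(2)] by blast
  qed
  from arg_cong[OF this, of "\<lambda>\<phi>. component \<phi> i"]
  have ba: "component b i \<cdot> component a i = ident C (ob L i)" by simp
  have ra: "component (\<rho> \<beta>) i \<cdot> component a i = component (\<pi> \<beta>) i" if "\<beta> \<in> J" for \<beta>
    using arg_cong[OF a(2)[OF that], of "\<lambda>\<phi>. component \<phi> i"] by simp
  have pb: "component (\<pi> \<beta>) i \<cdot> component b i = component (\<rho> \<beta>) i" if "\<beta> \<in> J" for \<beta>
    using arg_cong[OF b(2)[OF that], of "\<lambda>\<phi>. component \<phi> i"] by simp
  note ai = nat_mapD(3)[OF seq_homD(1)[OF a(1)], of i] and bi = nat_mapD(3)[OF seq_homD(1)[OF b(1)], of i]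
  have pi: "component (\<pi> \<beta>) i \<in> homs C (ob L i) (ob (X \<beta>) i)" if "\<beta> \<in> J" for \<beta>
    by (rule seq_component[OF L(2)[OF that]])
  have ri: "component (\<rho> \<beta>) i \<in> homs C (ob M i) (ob (X \<beta>) i)" if "\<beta> \<in> J" for \<beta>
    by (rule seq_component[OF M'(2)[OF that]])
  note tc = seq_component[OF t]
  show "is_limit C J (\<lambda>\<beta>. ob (X \<beta>) i) (\<lambda>\<beta> \<gamma>. component (t \<beta> \<gamma>) i) (ob (fst c) i)
      (\<lambda>\<beta>. component (snd c \<beta>) i)"
    unfolding is_limit_def L_def[symmetric] \<pi>_def[symmetric]
  proof (intro conjI allI impI)
    have "component (t \<beta> \<gamma>) i \<cdot> component (\<pi> \<gamma>) i = component (\<pi> \<beta>) i"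
      if "\<beta> \<in> J" "\<gamma> \<in> J" "\<beta> \<le> \<gamma>" for \<beta> \<gamma>
      using arg_cong[OF L(3)[OF that], of "\<lambda>\<phi>. component \<phi> i"] by simp
    then show "is_cone C J (\<lambda>\<beta>. ob (X \<beta>) i) (\<lambda>\<beta> \<gamma>. component (t \<beta> \<gamma>) i) (ob L i)
        (\<lambda>\<beta>. component (\<pi> \<beta>) i)"
      unfolding is_cone_def using ob_obj[OF L(1)] pi by simp
    fix Y \<psi> assume cone: "is_cone C J (\<lambda>\<beta>. ob (X \<beta>) i) (\<lambda>\<beta> \<gamma>. component (t \<beta> \<gamma>) i) Y \<psi>"
    then obtain g where g: "g \<in> homs C Y (ob M i)" "\<And>\<beta>. \<beta> \<in> J \<Longrightarrow> component (\<rho> \<beta>) i \<cdot> g = \<psi> \<beta>"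
      using Mi[of i, unfolded is_limit_def, THEN conjunct2, rule_format, OF cone] by blast
    show "\<exists>!h. h \<in> homs C Y (ob L i) \<and> (\<forall>\<beta>\<in>J. component (\<pi> \<beta>) i \<cdot> h = \<psi> \<beta>)"
    proof (rule ex1I[of _ "component b i \<cdot> g"], intro conjI ballI)
      show "component b i \<cdot> g \<in> homs C Y (ob L i)" by (rule comp_hom[OF g(1) bi])
      show "component (\<pi> \<beta>) i \<cdot> (component b i \<cdot> g) = \<psi> \<beta>" if "\<beta> \<in> J" for \<beta>
        using comp_eq[OF pb[OF that] bi pi[OF that] g(1)] g(2)[OF that] by simp
      fix h assume h: "h \<in> homs C Y (ob L i) \<and> (\<forall>\<beta>\<in>J. component (\<pi> \<beta>) i \<cdot> h = \<psi> \<beta>)"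
      then have h1: "h \<in> homs C Y (ob L i)" by blast
      have "component a i \<cdot> h = g"
      proof (rule limit_ext[OF Mi tc comp_hom[OF h1 ai] g(1)])
        show "component (\<rho> \<beta>) i \<cdot> (component a i \<cdot> h) = component (\<rho> \<beta>) i \<cdot> g" if "\<beta> \<in> J" for \<beta>
          using comp_eq[OF ra[OF that] ai ri[OF that] h1] h that g(2) by simp
      qed
      then show "h = component b i \<cdot> g"
        using comp_eq[OF ba ai bi h1] ident_left[OF h1] by simp
    qed
  qed
qed

end

section \<open>The image filtration and the completions\<close>

lemma ord_zero_le: "(ord_zero :: 'u::wellorder) \<le> \<alpha>"
  unfolding ord_zero_def by (rule Least_le) simp

lemma ordinal_cases:
  obtains "(\<alpha> :: 'u::wellorder) = ord_zero" | \<beta> where "ord_pred \<beta> \<alpha>" | "limit_ordinal \<alpha>"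
  unfolding limit_ordinal_def by blast

lemma ord_pred_less: "ord_pred \<beta> \<alpha> \<Longrightarrow> \<beta> < \<alpha>"
  by (simp add: ord_pred_def)

lemma ord_pred_le: "ord_pred \<beta> \<alpha> \<Longrightarrow> \<gamma> < \<alpha> \<Longrightarrow> \<gamma> \<le> \<beta>"
  by (simp add: ord_pred_def)

lemma limit_ordinal_pos: "limit_ordinal \<mu> \<Longrightarrow> ord_zero < \<mu>"
  using ord_zero_le[of \<mu>] by (auto simp: limit_ordinal_def)

lemma ord_pred_Least:
  assumes "(\<beta> :: 'u::wellorder) < \<gamma>"
  shows "ord_pred \<beta> (LEAST \<delta>. \<beta> < \<delta>)"
  unfolding ord_pred_def using LeastI[of "\<lambda>\<delta>. \<beta> < \<delta>", OF assms] not_less_Least by (meson not_less)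

text \<open>The least ordinal above \<beta> is at most \<mu>, and equality would give \<mu> a
  predecessor.\<close>

lemma limit_ordinal_succ:
  assumes "limit_ordinal \<mu>" "\<beta> < \<mu>"
  shows "\<exists>\<gamma><\<mu>. ord_pred \<beta> \<gamma>"
proof -
  define \<gamma> where "\<gamma> = (LEAST \<delta>. \<beta> < \<delta>)"
  have p: "ord_pred \<beta> \<gamma>" unfolding \<gamma>_def by (rule ord_pred_Least[OF assms(2)])
  have "\<gamma> \<le> \<mu>" unfolding \<gamma>_def by (rule Least_le[of "\<lambda>\<delta>. \<beta> < \<delta>", OF assms(2)])
  then show ?thesis using p assms(1) unfolding limit_ordinal_def by (metis le_less)
qed

text \<open>Each step takes the maximum of the successor of \<open>b n\<close> and the next element
  of a countable cofinal set. The latter makes the sequence cofinal; the former leaves room for one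
  image step between consecutive terms.\<close>

lemma countable_cofinality_sequence:
  fixes \<mu> :: "'u::wellorder"
  assumes \<mu>: "limit_ordinal \<mu>" and c: "countable {..<cofinality \<mu>}"
  obtains b :: "nat \<Rightarrow> 'u" where "\<And>n. b n < \<mu>" "\<And>n. \<exists>\<gamma>. ord_pred (b n) \<gamma> \<and> \<gamma> \<le> b (Suc n)"
    "\<And>\<beta>. \<beta> < \<mu> \<Longrightarrow> \<exists>n. \<beta> \<le> b n"
proof -
  \<comment> \<open>\<open>LEAST\<close> needs a witness: all of {..<\<mu>} is cofinal in
    \<mu>.\<close>
  have "\<exists>C. C \<subseteq> {..<\<mu>} \<and> (\<forall>\<beta><\<mu>. \<exists>\<gamma>\<in>C. \<beta> \<le> \<gamma>) \<and> C \<approx> {..<\<mu>}"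
    by (rule exI[of _ "{..<\<mu>}"]) (auto simp: eqpoll_refl)
  then have "\<exists>C. C \<subseteq> {..<\<mu>} \<and> (\<forall>\<beta><\<mu>. \<exists>\<gamma>\<in>C. \<beta> \<le> \<gamma>) \<and> C \<approx> {..<cofinality \<mu>}"
    unfolding cofinality_def by (rule LeastI)
  then obtain C where C: "C \<subseteq> {..<\<mu>}" "\<And>\<beta>. \<beta> < \<mu> \<Longrightarrow> \<exists>\<gamma>\<in>C. \<beta> \<le> \<gamma>" "C \<approx> {..<cofinality \<mu>}"
    by blast
  have cC: "countable C" using countable_eqpoll[OF c C(3)] .
  have ne: "C \<noteq> {}" using C(2)[OF limit_ordinal_pos[OF \<mu>]] by blast
  define e where "e = from_nat_into C"
  have e: "range e = C" unfolding e_def by (rule range_from_nat_into[OF ne cC])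
  have "\<exists>s. \<forall>\<beta><\<mu>. s \<beta> < \<mu> \<and> ord_pred \<beta> (s \<beta>)"
    using limit_ordinal_succ[OF \<mu>] by metis
  then obtain s where s: "\<And>\<beta>. \<beta> < \<mu> \<Longrightarrow> s \<beta> < \<mu>" "\<And>\<beta>. \<beta> < \<mu> \<Longrightarrow> ord_pred \<beta> (s \<beta>)" by blast
  define b where "b = rec_nat (e 0) (\<lambda>n \<beta>. max (s \<beta>) (e (Suc n)))"
  have b0: "b 0 = e 0" and bS: "b (Suc n) = max (s (b n)) (e (Suc n))" for n by (simp_all add: b_def)
  have e\<mu>: "e n < \<mu>" for n using e C(1) by auto
  have b\<mu>: "b n < \<mu>" for n by (induction n) (simp_all add: b0 bS e\<mu> s(1))
  show ?thesis
  proof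
    show "b n < \<mu>" for n by (rule b\<mu>)
    show "\<exists>\<gamma>. ord_pred (b n) \<gamma> \<and> \<gamma> \<le> b (Suc n)" for n
      using s(2)[OF b\<mu>[of n]] by (auto simp: bS)
    have "e n \<le> b n" for n by (cases n) (simp_all add: b0 bS)
    then show "\<exists>n. \<beta> \<le> b n" if "\<beta> < \<mu>" for \<beta>
      using C(2)[OF that] e by (metis order_trans rangeE)
  qed
qed

context complete_abelian_category
begin

lemma small_lessThan: "small TYPE('u) {..<\<alpha> :: 'u}"
  using univ by (simp add: universe_def)

text \<open>Singletons are small and small sets are bounded, so 'u has no last element.\<close>

lemma ord_succ_exists: "\<exists>\<gamma>. ord_pred (\<beta> :: 'u) \<gamma>"
proof -
  have "infinite (UNIV :: 'u set)" using univ uncountable_infinite by (auto simp: universe_def)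
  then have "small TYPE('u) {\<beta>}"
    unfolding small_def using finite_lesspoll_infinite by blast
  then obtain \<gamma> where "{\<beta>} \<subseteq> {..<\<gamma>}" using universe_bounded[OF univ] by blast
  then show ?thesis using ord_pred_Least[of \<beta> \<gamma>] by blast
qed

lemma image_incl:
  assumes X: "inverse_sequence C X"
  shows "image_incl C X \<in> seq_homs (image_seq C X) X"
    "is_mono C (component (image_incl C X) i)"
    "\<exists>e\<in>homs C (ob X (Suc i)) (ob (image_seq C X) i). is_epi C e \<and>
      component (image_incl C X) i \<cdot> e = bond X i"
proof -
  note bX = bond_hom[OF X]
  define m where "m i = im C (bond X i)" for i
  define I where "I i = src C (m i)" for i
  have m: "m i \<in> homs C (I i) (ob X i)" "is_mono C (m i)"
    "\<exists>e \<in> homs C (ob X (Suc i)) (I i). is_epi C e \<and> m i \<cdot> e = bond X i" for i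
    using im_factor(1-3)[OF bX] by (simp_all add: m_def I_def)
  define b where "b i = factor_mono C (m i) (bond X i \<cdot> m (Suc i))" for i
  have b: "b i \<in> homs C (I (Suc i)) (I i) \<and> m i \<cdot> b i = bond X i \<cdot> m (Suc i)" for i
  proof -
    obtain e where e: "e \<in> homs C (ob X (Suc i)) (I i)" "m i \<cdot> e = bond X i" using m(3) by blast
    \<comment> \<open>The restricted bond: include the next image into the next object, then apply
      the epimorphic part of the bond.\<close>
    have h: "e \<cdot> m (Suc i) \<in> homs C (I (Suc i)) (I i)" by (rule comp_hom[OF m(1) e(1)])
    have eq: "m i \<cdot> (e \<cdot> m (Suc i)) = bond X i \<cdot> m (Suc i)"
      by (rule comp_eq[OF e(2,1) m(1) m(1)])
    have "b i = e \<cdot> m (Suc i)" unfolding b_def by (rule factor_mono_eq[OF m(1,2) h eq])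
    then show ?thesis using h eq by simp
  qed
  have I: "image_seq C X = Inv_Seq I b" by (simp add: image_seq_def I_def[abs_def] b_def[abs_def] m_def[abs_def])
  have "inverse_sequence C (Inv_Seq I b)" using b homs_objs(1)[OF m(1)] by (simp add: inverse_sequence_def)
  then have "nat_map (Inv_Seq I b) X m" using X m(1) b by (simp add: nat_map_def)
  moreover have incl: "image_incl C X = Seq_Map (Inv_Seq I b) X m"
    by (simp add: image_incl_def I m_def[abs_def])
  ultimately show "image_incl C X \<in> seq_homs (image_seq C X) X"
    unfolding I by (simp add: seq_homI)
  show "is_mono C (component (image_incl C X) i)" using m(2) by (simp add: incl)
  show "\<exists>e\<in>homs C (ob X (Suc i)) (ob (image_seq C X) i). is_epi C e \<and>
      component (image_incl C X) i \<cdot> e = bond X i"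
    using m(3) by (simp add: incl I)
qed

section \<open>The filtration of a fixed inverse sequence\<close>

context
  fixes S :: "('o, 'm) inv_seq"
  assumes S: "inverse_sequence C S"
begin

abbreviation filt :: "'u \<Rightarrow> ('o, 'm) inv_seq" where
  "filt \<alpha> \<equiv> map_src (filt_map C S \<alpha>)"

lemma filt_ord_zero: "filt ord_zero = S"
  unfolding filt_map_zero by (simp add: seq_cat_def)

abbreviation filt_trans :: "'u \<Rightarrow> 'u \<Rightarrow> ('o, 'm) seq_map" where
  "filt_trans \<beta> \<gamma> \<equiv> factor_mono (seq_cat C) (filt_map C S \<beta>) (filt_map C S \<gamma>)"

text \<open>The invariant of the transfinite induction. The clauses go together: the limit step is
  built from \<open>factor_mono\<close>, which makes sense only between monos over S for which a
  factorization exists.\<close>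

definition filt_ok :: "'u \<Rightarrow> bool" where
  "filt_ok \<gamma> \<longleftrightarrow> filt_map C S \<gamma> \<in> seq_homs (filt \<gamma>) S \<and>
     (\<forall>i. is_mono C (component (filt_map C S \<gamma>) i)) \<and>
     (\<forall>\<beta>\<le>\<gamma>. \<exists>h\<in>seq_homs (filt \<gamma>) (filt \<beta>). filt_map C S \<beta> \<odot> h = filt_map C S \<gamma>)"

lemma filt_trans_hom:
  assumes "filt_ok \<beta>" "filt_ok \<gamma>" "\<beta> \<le> \<gamma>"
  shows "filt_trans \<beta> \<gamma> \<in> seq_homs (filt \<gamma>) (filt \<beta>)"
    "filt_map C S \<beta> \<odot> filt_trans \<beta> \<gamma> = filt_map C S \<gamma>"
proof -
  obtain h where h: "h \<in> seq_homs (filt \<gamma>) (filt \<beta>)"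
      "filt_map C S \<beta> \<odot> h = filt_map C S \<gamma>"
    using assms unfolding filt_ok_def by blast
  have m: "filt_map C S \<beta> \<in> seq_homs (filt \<beta>) S" "\<And>i. is_mono C (component (filt_map C S \<beta>) i)"
    using assms(1) unfolding filt_ok_def by blast+
  have "filt_trans \<beta> \<gamma> = h"
    by (rule seq.factor_mono_eq[OF m(1) seq_mono[OF m] h])
  then show "filt_trans \<beta> \<gamma> \<in> seq_homs (filt \<gamma>) (filt \<beta>)"
    "filt_map C S \<beta> \<odot> filt_trans \<beta> \<gamma> = filt_map C S \<gamma>" using h by simp_all
qed

text \<open>Assumes the invariant below \<mu> only, since it is used within the induction that
  establishes the invariant and again afterwards.\<close>

lemma filt_limit:
  assumes \<mu>: "limit_ordinal \<mu>" and ok: "\<And>\<beta>. \<beta> < \<mu> \<Longrightarrow> filt_ok \<beta>"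
  shows "\<exists>\<pi>. \<pi> ord_zero = filt_map C S \<mu> \<and>
    (\<forall>\<beta><\<mu>. \<pi> \<beta> \<in> seq_homs (filt \<mu>) (filt \<beta>) \<and>
      filt_map C S \<beta> \<odot> \<pi> \<beta> = filt_map C S \<mu>) \<and>
    (\<forall>i. is_limit C {..<\<mu>} (\<lambda>\<beta>. ob (filt \<beta>) i) (\<lambda>\<beta> \<gamma>. component (filt_trans \<beta> \<gamma>) i)
      (ob (filt \<mu>) i) (\<lambda>\<beta>. component (\<pi> \<beta>) i))"
proof -
  define c where "c = limit_cone (seq_cat C) {..<\<mu>} filt filt_trans"
  define \<pi> where "\<pi> = snd c"
  have m: "filt_map C S \<beta> \<in> seq_homs (filt \<beta>) S" if "\<beta> < \<mu>" for \<beta>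
    using ok[OF that] unfolding filt_ok_def by blast
  have fi: "inverse_sequence C (filt \<beta>)" if "\<beta> \<in> {..<\<mu>}" for \<beta>
    using nat_mapD(1)[OF seq_homD(1)[OF m]] that by simp
  have tr: "filt_trans \<beta> \<gamma> \<in> seq_homs (filt \<gamma>) (filt \<beta>)"
    if "\<beta> \<in> {..<\<mu>}" "\<gamma> \<in> {..<\<mu>}" "\<beta> \<le> \<gamma>" for \<beta> \<gamma>
    using filt_trans_hom(1) ok that by simp
  note lim = seq_limit_cone[OF small_lessThan, of \<mu> filt filt_trans, OF fi tr, folded c_def \<pi>_def]
  have cone: "is_cone (seq_cat C) {..<\<mu>} filt filt_trans (fst c) \<pi>"
    using lim(1) unfolding is_limit_def by blast
  note L = seq_is_coneD[OF cone]
  have z: "ord_zero < \<mu>" by (rule limit_ordinal_pos[OF \<mu>])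
  have m0: "filt_map C S (ord_zero :: 'u) = ident (seq_cat C) S" by (rule filt_map_zero)
  have mu: "filt_map C S \<mu> = \<pi> ord_zero"
    unfolding \<pi>_def c_def by (rule filt_map_limit[OF \<mu>])
  have f\<mu>: "filt \<mu> = fst c" unfolding mu using seq_homD(2)[OF L(2)] z by simp
  have "filt_map C S \<beta> \<odot> \<pi> \<beta> = filt_map C S \<mu>" if \<beta>: "\<beta> < \<mu>" for \<beta>
  proof -
    note t = filt_trans_hom[OF ok[OF z] ok[OF \<beta>] ord_zero_le]
    \<comment> \<open>The zeroth term is S with the identity as inclusion, so the transition map
      down to it is the inclusion itself. Thus the zeroth leg of the limit cone is the canonical map
      to S.\<close>
    have "filt_trans ord_zero \<beta> = filt_map C S \<beta>"
      using seq.ident_left[OF t(1)[unfolded filt_ord_zero]] t(2) m0 by simp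
    then show ?thesis using L(3)[OF _ _ ord_zero_le, of \<beta>] z \<beta> mu by simp
  qed
  then show ?thesis
    using lim(2) L(2) by (intro exI[of _ \<pi>]) (simp add: mu f\<mu>[unfolded mu])
qed

lemma filt_ok_holds: "filt_ok \<gamma>"
proof (induction \<gamma> rule: less_induct)
  case (less \<alpha>)
  show ?case
  proof (rule ordinal_cases[of \<alpha>])
    assume \<alpha>: "\<alpha> = ord_zero"
    have m: "filt_map C S \<alpha> = ident (seq_cat C) S" unfolding \<alpha> by (rule filt_map_zero)
    then have f: "filt \<alpha> = S" by (simp add: seq_cat_def)
    have id: "ident (seq_cat C) S \<in> seq_homs S S" by (rule seq_ident[OF S])
    have "is_mono C (component (ident (seq_cat C) S) i)" for i
      unfolding seq_cat_simps mono_iff[OF ident_hom[OF ob_obj[OF S]]]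
      using ident_left by metis
    moreover have "\<beta> \<le> \<alpha> \<Longrightarrow> \<beta> = \<alpha>" for \<beta> using ord_zero_le[of \<beta>] \<alpha> by simp
    ultimately show "filt_ok \<alpha>"
      unfolding filt_ok_def using id seq.ident_left[OF id] m f by metis
  next
    fix \<beta> assume \<beta>: "ord_pred \<beta> \<alpha>"
    have ok: "filt_ok \<beta>" using less ord_pred_less[OF \<beta>] by blast
    then have m: "filt_map C S \<beta> \<in> seq_homs (filt \<beta>) S"
      and mono: "\<And>i. is_mono C (component (filt_map C S \<beta>) i)"
      unfolding filt_ok_def by blast+
    have fb: "inverse_sequence C (filt \<beta>)" by (rule nat_mapD(1)[OF seq_homD(1)[OF m]])
    note inc = image_incl[OF fb]
    have m\<alpha>: "filt_map C S \<alpha> = filt_map C S \<beta> \<odot> image_incl C (filt \<beta>)"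
      by (rule filt_map_succ[OF \<beta>])
    have f\<alpha>: "filt \<alpha> = image_seq C (filt \<beta>)" unfolding m\<alpha> using seq_homD(2)[OF inc(1)] by simp
    have h\<alpha>: "filt_map C S \<alpha> \<in> seq_homs (filt \<alpha>) S"
      unfolding f\<alpha> unfolding m\<alpha> by (rule seq.comp_hom[OF inc(1) m])
    have "is_mono C (component (filt_map C S \<alpha>) i)" for i
      unfolding m\<alpha> seq_cat_simps
      by (rule mono_comp[OF seq_component[OF inc(1)] seq_component[OF m] inc(2) mono])
    moreover have "\<exists>h\<in>seq_homs (filt \<alpha>) (filt \<gamma>). filt_map C S \<gamma> \<odot> h = filt_map C S \<alpha>"
      if "\<gamma> \<le> \<alpha>" for \<gamma>
    proof (cases "\<gamma> = \<alpha>")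
      case True
      then show ?thesis
        using seq_ident[OF nat_mapD(1)[OF seq_homD(1)[OF h\<alpha>]]] seq.ident_right[OF h\<alpha>] by blast
    next
      case False
      then have "\<gamma> \<le> \<beta>" using ord_pred_le[OF \<beta>] that by simp
      then obtain h where h: "h \<in> seq_homs (filt \<beta>) (filt \<gamma>)"
          "filt_map C S \<gamma> \<odot> h = filt_map C S \<beta>"
        using ok unfolding filt_ok_def by blast
      have "filt_ok \<gamma>" using less that False by simp
      then have "filt_map C S \<gamma> \<in> seq_homs (filt \<gamma>) S" unfolding filt_ok_def by blast
      then have "filt_map C S \<gamma> \<odot> (h \<odot> image_incl C (filt \<beta>)) = filt_map C S \<alpha>"
        unfolding m\<alpha> by (rule seq.comp_eq[OF h(2,1) _ inc(1)])
      then show ?thesis using seq.comp_hom[OF inc(1) h(1)] f\<alpha> by auto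
    qed
    ultimately show "filt_ok \<alpha>" unfolding filt_ok_def using h\<alpha> by blast
  next
    assume \<alpha>: "limit_ordinal \<alpha>"
    obtain \<pi> where \<pi>0: "\<pi> ord_zero = filt_map C S \<alpha>"
      and \<pi>: "\<And>\<beta>. \<beta> < \<alpha> \<Longrightarrow> \<pi> \<beta> \<in> seq_homs (filt \<alpha>) (filt \<beta>)"
      and m\<pi>: "\<And>\<beta>. \<beta> < \<alpha> \<Longrightarrow> filt_map C S \<beta> \<odot> \<pi> \<beta> = filt_map C S \<alpha>"
      and lim: "\<And>i. is_limit C {..<\<alpha>} (\<lambda>\<beta>. ob (filt \<beta>) i) (\<lambda>\<beta> \<gamma>. component (filt_trans \<beta> \<gamma>) i)
        (ob (filt \<alpha>) i) (\<lambda>\<beta>. component (\<pi> \<beta>) i)"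
      using filt_limit[OF \<alpha> less] by metis
    have z: "ord_zero < \<alpha>" by (rule limit_ordinal_pos[OF \<alpha>])
    have m: "filt_map C S \<beta> \<in> seq_homs (filt \<beta>) S" "is_mono C (component (filt_map C S \<beta>) i)"
      if "\<beta> < \<alpha>" for \<beta> i
      using less[OF that] unfolding filt_ok_def by blast+
    have h\<alpha>: "filt_map C S \<alpha> \<in> seq_homs (filt \<alpha>) S"
      using seq.comp_hom[OF \<pi>[OF z] m(1)[OF z]] m\<pi>[OF z] by simp
    \<comment> \<open>Maps that agree in S agree in all earlier terms, whose inclusions are mono,
      and hence agree in the limit.\<close>
    have "is_mono C (component (filt_map C S \<alpha>) i)" for i
      unfolding mono_iff[OF seq_component[OF h\<alpha>]]
    proof (intro allI ballI impI)
      fix W g h assume g: "g \<in> homs C W (ob (filt \<alpha>) i)" and h: "h \<in> homs C W (ob (filt \<alpha>) i)"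
        and eq: "component (filt_map C S \<alpha>) i \<cdot> g = component (filt_map C S \<alpha>) i \<cdot> h"
      show "g = h"
      proof (rule limit_ext[OF lim _ g h])
        show "component (filt_trans \<beta> \<gamma>) i \<in> homs C (ob (filt \<gamma>) i) (ob (filt \<beta>) i)"
          if "\<beta> \<in> {..<\<alpha>}" "\<gamma> \<in> {..<\<alpha>}" "\<beta> \<le> \<gamma>" for \<beta> \<gamma>
          using seq_component[OF filt_trans_hom(1)] less that by simp
        fix \<beta> assume "\<beta> \<in> {..<\<alpha>}"
        then have \<beta>: "\<beta> < \<alpha>" by simp
        note mi = nat_mapD(3)[OF seq_homD(1)[OF m(1)[OF \<beta>]], of i]
          and pi = nat_mapD(3)[OF seq_homD(1)[OF \<pi>[OF \<beta>]], of i]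
        have mp: "component (filt_map C S \<beta>) i \<cdot> component (\<pi> \<beta>) i = component (filt_map C S \<alpha>) i"
          using arg_cong[OF m\<pi>[OF \<beta>], of "\<lambda>\<phi>. component \<phi> i"] by simp
        have "component (filt_map C S \<beta>) i \<cdot> (component (\<pi> \<beta>) i \<cdot> g) =
            component (filt_map C S \<beta>) i \<cdot> (component (\<pi> \<beta>) i \<cdot> h)"
          using comp_eq[OF mp pi mi g] comp_eq[OF mp pi mi h] eq by simp
        then show "component (\<pi> \<beta>) i \<cdot> g = component (\<pi> \<beta>) i \<cdot> h"
          by (rule monoD[OF m(2)[OF \<beta>] mi comp_hom[OF g pi] comp_hom[OF h pi]])
      qed
    qed
    moreover have "\<exists>h\<in>seq_homs (filt \<alpha>) (filt \<gamma>). filt_map C S \<gamma> \<odot> h = filt_map C S \<alpha>"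
      if "\<gamma> \<le> \<alpha>" for \<gamma>
    proof (cases "\<gamma> = \<alpha>")
      case True
      then show ?thesis
        using seq_ident[OF nat_mapD(1)[OF seq_homD(1)[OF h\<alpha>]]] seq.ident_right[OF h\<alpha>] by blast
    next
      case False
      then show ?thesis using \<pi> m\<pi> that by (metis le_less)
    qed
    ultimately show "filt_ok \<alpha>" unfolding filt_ok_def using h\<alpha> by blast
  qed
qed

abbreviation filt_in :: "'u \<Rightarrow> nat \<Rightarrow> 'm" where "filt_in \<alpha> \<equiv> component (filt_map C S \<alpha>)"
abbreviation quot_pr :: "'u \<Rightarrow> nat \<Rightarrow> 'm" where "quot_pr \<alpha> \<equiv> component (quot_map C S \<alpha>)"
abbreviation quot_seq :: "'u \<Rightarrow> ('o, 'm) inv_seq" where "quot_seq \<alpha> \<equiv> quot C S \<alpha>"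

section \<open>Which maps into S are killed by S -> S^\<alpha>\<close>

lemma filt_hom: "filt_map C S \<alpha> \<in> seq_homs (filt \<alpha>) S"
  using filt_ok_holds[of \<alpha>] unfolding filt_ok_def by blast

lemma filt_in_nat: "nat_map (filt \<alpha>) S (filt_in \<alpha>)"
  by (rule seq_homD(1)[OF filt_hom])

lemmas filt_in_comp = nat_mapD(3)[OF filt_in_nat]

lemma filt_in_mono: "is_mono C (filt_in \<alpha> i)"
  using filt_ok_holds[of \<alpha>] unfolding filt_ok_def by blast

lemma quot_hom: "quot_map C S \<alpha> \<in> seq_homs S (quot_seq \<alpha>)"
  unfolding quot_def quot_map_def by (rule seq_coker(1)[OF filt_hom])

lemma quot_pr_nat: "nat_map S (quot_seq \<alpha>) (quot_pr \<alpha>)"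
  by (rule seq_homD(1)[OF quot_hom])

lemmas quot_pr_comp = nat_mapD(3)[OF quot_pr_nat]

lemma quot_pr_cokernel: "is_cokernel C (filt_in \<alpha> i) (quot_pr \<alpha> i)"
  unfolding quot_map_def by (rule seq_coker(2)[OF filt_hom])

lemma quot_pr_epi: "is_epi C (quot_pr \<alpha> i)"
  by (rule cokernel_epi[OF quot_pr_cokernel])

text \<open>By normality I^\<alpha> is the kernel of its own cokernel. Being killed by
  \<open>quot_pr \<alpha>\<close> thus means lying in I^\<alpha>, and the chases use only this
  form.\<close>

lemma quot_pr_zeroD:
  assumes "s \<in> homs C T (ob S i)" "quot_pr \<alpha> i \<cdot> s = arr_zero C T (ob (quot_seq \<alpha>) i)"
  shows "\<exists>x\<in>homs C T (ob (filt \<alpha>) i). filt_in \<alpha> i \<cdot> x = s"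
  using kernelD(3)[OF mono_kernel_cokernel[OF filt_in_mono quot_pr_cokernel] quot_pr_comp assms]
    hom_arr(2)[OF filt_in_comp] by auto

lemma quot_pr_fm:
  assumes "x \<in> homs C T (ob (filt \<alpha>) i)"
  shows "quot_pr \<alpha> i \<cdot> (filt_in \<alpha> i \<cdot> x) = arr_zero C T (ob (quot_seq \<alpha>) i)"
  by (rule cokernel_comp_zero[OF quot_pr_cokernel filt_in_comp quot_pr_comp assms])

lemma quot_pr_mono:
  assumes "\<beta> \<le> \<gamma>" and s: "s \<in> homs C T (ob S i)" and 0: "quot_pr \<gamma> i \<cdot> s = arr_zero C T (ob (quot_seq \<gamma>) i)"
  shows "quot_pr \<beta> i \<cdot> s = arr_zero C T (ob (quot_seq \<beta>) i)"
proof -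
  obtain x where x: "x \<in> homs C T (ob (filt \<gamma>) i)" "filt_in \<gamma> i \<cdot> x = s" using quot_pr_zeroD[OF s 0] by blast
  note t = filt_trans_hom[OF filt_ok_holds filt_ok_holds assms(1)]
  have "filt_in \<beta> i \<cdot> component (filt_trans \<beta> \<gamma>) i = filt_in \<gamma> i"
    using arg_cong[OF t(2), of "\<lambda>\<phi>. component \<phi> i"] by simp
  then have "filt_in \<beta> i \<cdot> (component (filt_trans \<beta> \<gamma>) i \<cdot> x) = s"
    using comp_eq[OF _ seq_component[OF t(1)] filt_in_comp x(1)] x(2) by simp
  then show ?thesis using quot_pr_fm[OF nat_map_comp[OF seq_homD(1)[OF t(1)] x(1)]] by simp
qed

lemma quot_pr_ord_zero:
  assumes "s \<in> homs C T (ob S i)"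
  shows "quot_pr ord_zero i \<cdot> s = arr_zero C T (ob (quot_seq ord_zero) i)"
proof -
  have m: "filt_map C S (ord_zero :: 'u) = ident (seq_cat C) S" by (rule filt_map_zero)
  then show ?thesis using filt_ord_zero quot_pr_fm[of s T ord_zero i] assms ident_left[OF assms] m by simp
qed

text \<open>The bond of I^\<beta> factors through its image, which is I^\<alpha>.\<close>

lemma quot_pr_succI:
  assumes \<beta>: "ord_pred \<beta> \<alpha>" and s: "s \<in> homs C T (ob S (Suc i))"
    and 0: "quot_pr \<beta> (Suc i) \<cdot> s = arr_zero C T (ob (quot_seq \<beta>) (Suc i))"
  shows "quot_pr \<alpha> i \<cdot> (bond S i \<cdot> s) = arr_zero C T (ob (quot_seq \<alpha>) i)"
proof -
  note fb = nat_mapD(1)[OF filt_in_nat[of \<beta>]]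
  note inc = image_incl[OF fb]
  have m\<alpha>: "filt_map C S \<alpha> = filt_map C S \<beta> \<odot> image_incl C (filt \<beta>)"
    by (rule filt_map_succ[OF \<beta>])
  have f\<alpha>: "filt \<alpha> = image_seq C (filt \<beta>)" unfolding m\<alpha> using seq_homD(2)[OF inc(1)] by simp
  obtain x where x: "x \<in> homs C T (ob (filt \<beta>) (Suc i))" "filt_in \<beta> (Suc i) \<cdot> x = s"
    using quot_pr_zeroD[OF s 0] by blast
  obtain e where e: "e \<in> homs C (ob (filt \<beta>) (Suc i)) (ob (filt \<alpha>) i)"
      "component (image_incl C (filt \<beta>)) i \<cdot> e = bond (filt \<beta>) i"
    using inc(3) f\<alpha> by auto
  note ii = nat_mapD(3)[OF seq_homD(1)[OF inc(1)], of i, folded f\<alpha>]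
  have ex: "e \<cdot> x \<in> homs C T (ob (filt \<alpha>) i)" by (rule comp_hom[OF x(1) e(1)])
  have "filt_in \<alpha> i \<cdot> (e \<cdot> x) = filt_in \<beta> i \<cdot> (component (image_incl C (filt \<beta>)) i \<cdot> (e \<cdot> x))"
    using comp_assoc[OF ex ii filt_in_comp] by (simp add: m\<alpha>)
  also have "\<dots> = filt_in \<beta> i \<cdot> (bond (filt \<beta>) i \<cdot> x)"
    using comp_eq[OF e(2,1) ii x(1)] by simp
  also have "\<dots> = bond S i \<cdot> s" using nat_map_bond[OF filt_in_nat x(1)] x(2) by simp
  finally show ?thesis using quot_pr_fm[OF ex] by simp
qed

text \<open>I^\<alpha> is an epimorphic image of the next object of I^\<beta>. A preimage exists
  after pulling this epimorphism back, whence the cover \<open>v\<close>.\<close>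

lemma quot_pr_succD:
  assumes \<beta>: "ord_pred \<beta> \<alpha>" and s: "s \<in> homs C T (ob S i)"
    and 0: "quot_pr \<alpha> i \<cdot> s = arr_zero C T (ob (quot_seq \<alpha>) i)"
  shows "\<exists>V v s'. v \<in> homs C V T \<and> is_epi C v \<and> s' \<in> homs C V (ob S (Suc i)) \<and>
    quot_pr \<beta> (Suc i) \<cdot> s' = arr_zero C V (ob (quot_seq \<beta>) (Suc i)) \<and> bond S i \<cdot> s' = s \<cdot> v"
proof -
  note fb = nat_mapD(1)[OF filt_in_nat[of \<beta>]]
  note inc = image_incl[OF fb]
  have m\<alpha>: "filt_map C S \<alpha> = filt_map C S \<beta> \<odot> image_incl C (filt \<beta>)"
    by (rule filt_map_succ[OF \<beta>])
  have f\<alpha>: "filt \<alpha> = image_seq C (filt \<beta>)" unfolding m\<alpha> using seq_homD(2)[OF inc(1)] by simp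
  obtain x where x: "x \<in> homs C T (ob (filt \<alpha>) i)" "filt_in \<alpha> i \<cdot> x = s" using quot_pr_zeroD[OF s 0] by blast
  obtain e where e: "e \<in> homs C (ob (filt \<beta>) (Suc i)) (ob (filt \<alpha>) i)" "is_epi C e"
      "component (image_incl C (filt \<beta>)) i \<cdot> e = bond (filt \<beta>) i"
    using inc(3) f\<alpha> by auto
  note ii = nat_mapD(3)[OF seq_homD(1)[OF inc(1)], of i, folded f\<alpha>]
  obtain V v y where v: "v \<in> homs C V T" "is_epi C v" and y: "y \<in> homs C V (ob (filt \<beta>) (Suc i))"
      "e \<cdot> y = x \<cdot> v"
    using pullback_epi[OF e(1) x(1) e(2)] by blast
  have ms: "filt_in \<beta> (Suc i) \<cdot> y \<in> homs C V (ob S (Suc i))" by (rule nat_map_comp[OF filt_in_nat y(1)])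
  have "bond S i \<cdot> (filt_in \<beta> (Suc i) \<cdot> y) = filt_in \<beta> i \<cdot> (bond (filt \<beta>) i \<cdot> y)"
    using nat_map_bond[OF filt_in_nat y(1)] by simp
  also have "\<dots> = filt_in \<beta> i \<cdot> (component (image_incl C (filt \<beta>)) i \<cdot> (x \<cdot> v))"
    using comp_eq[OF e(3,1) ii y(1)] y(2) by simp
  also have "\<dots> = filt_in \<alpha> i \<cdot> (x \<cdot> v)"
    using comp_assoc[OF comp_hom[OF v(1) x(1)] ii filt_in_comp] by (simp add: m\<alpha>)
  also have "\<dots> = s \<cdot> v" using comp_eq[OF x(2,1) filt_in_comp v(1)] .
  finally show ?thesis using v ms quot_pr_fm[OF y(1)] by blast
qed

text \<open>I^\<mu> is the intersection of the earlier terms: factorizations of \<open>s\<close>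
  through all I^\<beta> form a cone, because compatibility can be tested in S, where the inclusions
  are mono.\<close>

lemma quot_pr_limit:
  assumes \<mu>: "limit_ordinal \<mu>" and s: "s \<in> homs C T (ob S i)"
  shows "quot_pr \<mu> i \<cdot> s = arr_zero C T (ob (quot_seq \<mu>) i) \<longleftrightarrow>
    (\<forall>\<beta>\<in>{..<\<mu>}. quot_pr \<beta> i \<cdot> s = arr_zero C T (ob (quot_seq \<beta>) i))"
proof (intro iffI ballI)
  show "quot_pr \<beta> i \<cdot> s = arr_zero C T (ob (quot_seq \<beta>) i)"
    if "quot_pr \<mu> i \<cdot> s = arr_zero C T (ob (quot_seq \<mu>) i)" "\<beta> \<in> {..<\<mu>}" for \<beta>
    using quot_pr_mono[OF _ s that(1)] that(2) by simp
  assume all: "\<forall>\<beta>\<in>{..<\<mu>}. quot_pr \<beta> i \<cdot> s = arr_zero C T (ob (quot_seq \<beta>) i)"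
  have T: "T \<in> objs C" using s homs_objs by blast
  have "\<exists>x. \<forall>\<beta>\<in>{..<\<mu>}. x \<beta> \<in> homs C T (ob (filt \<beta>) i) \<and> filt_in \<beta> i \<cdot> x \<beta> = s"
    using quot_pr_zeroD[OF s] all by (intro bchoice) blast
  then obtain x where x: "\<And>\<beta>. \<beta> \<in> {..<\<mu>} \<Longrightarrow> x \<beta> \<in> homs C T (ob (filt \<beta>) i)"
      "\<And>\<beta>. \<beta> \<in> {..<\<mu>} \<Longrightarrow> filt_in \<beta> i \<cdot> x \<beta> = s" by blast
  obtain \<pi> where \<pi>0: "\<pi> ord_zero = filt_map C S \<mu>"
    and lim: "\<And>i. is_limit C {..<\<mu>} (\<lambda>\<beta>. ob (filt \<beta>) i) (\<lambda>\<beta> \<gamma>. component (filt_trans \<beta> \<gamma>) i)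
        (ob (filt \<mu>) i) (\<lambda>\<beta>. component (\<pi> \<beta>) i)"
    using filt_limit[OF \<mu> filt_ok_holds] by blast
  have "\<exists>h. h \<in> homs C T (ob (filt \<mu>) i) \<and> (\<forall>\<beta>\<in>{..<\<mu>}. component (\<pi> \<beta>) i \<cdot> h = x \<beta>)"
  proof (rule limit_lift[OF lim T x(1)])
    fix \<beta> \<gamma> assume b: "\<beta> \<in> {..<\<mu>}" "\<gamma> \<in> {..<\<mu>}" "\<beta> \<le> \<gamma>"
    note t = filt_trans_hom[OF filt_ok_holds filt_ok_holds b(3)]
    note ti = nat_mapD(3)[OF seq_homD(1)[OF t(1)], of i]
    have "filt_in \<beta> i \<cdot> component (filt_trans \<beta> \<gamma>) i = filt_in \<gamma> i"
      using arg_cong[OF t(2), of "\<lambda>\<phi>. component \<phi> i"] by simp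
    then have "filt_in \<beta> i \<cdot> (component (filt_trans \<beta> \<gamma>) i \<cdot> x \<gamma>) = filt_in \<beta> i \<cdot> x \<beta>"
      using comp_eq[OF _ ti filt_in_comp x(1)[OF b(2)]] x(2) b by simp
    then show "component (filt_trans \<beta> \<gamma>) i \<cdot> x \<gamma> = x \<beta>"
      by (rule monoD[OF filt_in_mono filt_in_comp comp_hom[OF x(1)[OF b(2)] ti] x(1)[OF b(1)]])
  qed
  then obtain h where h: "h \<in> homs C T (ob (filt \<mu>) i)"
      "\<And>\<beta>. \<beta> \<in> {..<\<mu>} \<Longrightarrow> component (\<pi> \<beta>) i \<cdot> h = x \<beta>" by blast
  have z: "ord_zero \<in> {..<\<mu>}" using limit_ordinal_pos[OF \<mu>] by simp
  have m: "filt_map C S (ord_zero :: 'u) = ident (seq_cat C) S" by (rule filt_map_zero)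
  \<comment> \<open>Since I^0 = S, the zeroth member of the cone is \<open>s\<close> itself; so the
    induced map to I^\<mu> really lifts \<open>s\<close>.\<close>
  have "x ord_zero = s" using filt_ord_zero x[OF z] m ident_left[of "x ord_zero"] by auto
  then have "filt_in \<mu> i \<cdot> h = s" using h(2)[OF z] \<pi>0 by simp
  then show "quot_pr \<mu> i \<cdot> s = arr_zero C T (ob (quot_seq \<mu>) i)" using quot_pr_fm[OF h(1)] by simp
qed

section \<open>Transition maps of the quotients, completions and their cokernels\<close>

abbreviation quot_trans :: "'u \<Rightarrow> 'u \<Rightarrow> ('o, 'm) seq_map" where
  "quot_trans \<beta> \<gamma> \<equiv> factor_epi (seq_cat C) (quot_map C S \<gamma>) (quot_map C S \<beta>)"
abbreviation compl_seq :: "'u \<Rightarrow> ('o, 'm) inv_seq" where "compl_seq \<mu> \<equiv> completion C S \<mu>"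
abbreviation compl_pr :: "'u \<Rightarrow> 'u \<Rightarrow> ('o, 'm) seq_map" where
  "compl_pr \<mu> \<equiv> snd (completion_cone C S \<mu>)"

lemma quot_trans:
  assumes "\<beta> \<le> \<gamma>"
  shows "quot_trans \<beta> \<gamma> \<in> seq_homs (quot_seq \<gamma>) (quot_seq \<beta>)"
    "quot_trans \<beta> \<gamma> \<odot> quot_map C S \<gamma> = quot_map C S \<beta>"
proof -
  have "\<exists>k. k \<in> homs C (ob (quot_seq \<gamma>) i) (ob (quot_seq \<beta>) i) \<and> k \<cdot> quot_pr \<gamma> i = quot_pr \<beta> i" for i
  proof -
    note m = filt_in_comp[of \<gamma> i]
    have x: "ident C (ob (map_src (filt_map C S \<gamma>)) i) \<in>
        homs C (ob (map_src (filt_map C S \<gamma>)) i) (ob (map_src (filt_map C S \<gamma>)) i)"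
      by (rule ident_hom[OF homs_objs(1)[OF m]])
    have "quot_pr \<beta> i \<cdot> filt_in \<gamma> i = arr_zero C (ob (map_src (filt_map C S \<gamma>)) i) (ob (quot_seq \<beta>) i)"
      using quot_pr_mono[OF assms m] quot_pr_fm[OF x] ident_right[OF m] by simp
    then have "\<exists>!k. k \<in> homs C (tgt C (quot_pr \<gamma> i)) (ob (quot_seq \<beta>) i) \<and> k \<cdot> quot_pr \<gamma> i = quot_pr \<beta> i"
      by (rule cokernelD(3)[OF quot_pr_cokernel m quot_pr_comp])
    then show ?thesis unfolding hom_arr(3)[OF quot_pr_comp] by (rule ex1_implies_ex)
  qed
  then obtain k where k: "\<And>i. k i \<in> homs C (ob (quot_seq \<gamma>) i) (ob (quot_seq \<beta>) i)" "\<And>i. k i \<cdot> quot_pr \<gamma> i = quot_pr \<beta> i"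
    by metis
  have K: "Seq_Map (quot_seq \<gamma>) (quot_seq \<beta>) k \<in> seq_homs (quot_seq \<gamma>) (quot_seq \<beta>)"
    by (rule seq_homI[OF nat_map_factor_epi[OF quot_pr_nat quot_pr_epi quot_pr_nat k]])
  have eq: "Seq_Map (quot_seq \<gamma>) (quot_seq \<beta>) k \<odot> quot_map C S \<gamma> = quot_map C S \<beta>"
    by (rule seq_hom_ext[OF seq.comp_hom[OF quot_hom K] quot_hom]) (simp add: k(2))
  have "quot_trans \<beta> \<gamma> = Seq_Map (quot_seq \<gamma>) (quot_seq \<beta>) k"
    by (rule seq.factor_epi_eq[OF quot_hom seq_epi[OF quot_hom quot_pr_epi] K eq])
  then show "quot_trans \<beta> \<gamma> \<in> seq_homs (quot_seq \<gamma>) (quot_seq \<beta>)"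
    "quot_trans \<beta> \<gamma> \<odot> quot_map C S \<gamma> = quot_map C S \<beta>" using K eq by simp_all
qed

lemma quot_trans_qm: "\<beta> \<le> \<gamma> \<Longrightarrow> component (quot_trans \<beta> \<gamma>) i \<cdot> quot_pr \<gamma> i = quot_pr \<beta> i"
  using arg_cong[OF quot_trans(2), of \<beta> \<gamma> "\<lambda>\<phi>. component \<phi> i"] by simp

lemma completion_limit:
  "is_limit (seq_cat C) {..<\<mu>} quot_seq quot_trans (compl_seq \<mu>) (compl_pr \<mu>)"
  "is_limit C {..<\<mu>} (\<lambda>\<beta>. ob (quot_seq \<beta>) i) (\<lambda>\<beta> \<gamma>. component (quot_trans \<beta> \<gamma>) i) (ob (compl_seq \<mu>) i)
    (\<lambda>\<beta>. component (compl_pr \<mu> \<beta>) i)"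
  unfolding completion_def completion_cone_def
  using seq_limit_cone[OF small_lessThan, of \<mu> quot_seq quot_trans,
      OF nat_mapD(2)[OF quot_pr_nat] quot_trans(1)] by blast+

lemma completion_seq: "inverse_sequence C (compl_seq \<mu>)"
  using completion_limit(1)[of \<mu>] unfolding is_limit_def is_cone_def by simp

lemma compl_pr_nat: "\<beta> < \<mu> \<Longrightarrow> nat_map (compl_seq \<mu>) (quot_seq \<beta>) (component (compl_pr \<mu> \<beta>))"
  using completion_limit(1)[of \<mu>] seq_homD(1) unfolding is_limit_def is_cone_def by blast

lemma completion_map_hom:
  "completion_map C S \<mu> \<in> seq_homs S (compl_seq \<mu>)"
  "\<beta> < \<mu> \<Longrightarrow> compl_pr \<mu> \<beta> \<odot> completion_map C S \<mu> = quot_map C S \<beta>"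
proof -
  have "is_cone (seq_cat C) {..<\<mu>} quot_seq quot_trans S (quot_map C S)"
    by (rule seq_is_coneI[OF S quot_hom quot_trans(2)])
  from completion_limit(1)[of \<mu>, unfolded is_limit_def, THEN conjunct2, rule_format, OF this]
  have "\<exists>!h. h \<in> seq_homs S (compl_seq \<mu>) \<and>
      (\<forall>\<beta><\<mu>. compl_pr \<mu> \<beta> \<odot> h = quot_map C S \<beta>)"
    by (simp add: Ball_def)
  from theI'[OF this, folded completion_map_def]
  show "completion_map C S \<mu> \<in> seq_homs S (compl_seq \<mu>)"
    "\<beta> < \<mu> \<Longrightarrow> compl_pr \<mu> \<beta> \<odot> completion_map C S \<mu> = quot_map C S \<beta>" by blast+
qed

abbreviation compl_in :: "'u \<Rightarrow> nat \<Rightarrow> 'm" where "compl_in \<mu> \<equiv> component (completion_map C S \<mu>)"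
abbreviation coker_pr :: "'u \<Rightarrow> nat \<Rightarrow> 'm" where
  "coker_pr \<mu> \<equiv> component (coker (seq_cat C) (completion_map C S \<mu>))"
abbreviation coker_seq :: "'u \<Rightarrow> ('o, 'm) inv_seq" where "coker_seq \<mu> \<equiv> completion_coker C S \<mu>"

lemma compl_in_nat: "nat_map S (compl_seq \<mu>) (compl_in \<mu>)"
  by (rule seq_homD(1)[OF completion_map_hom(1)])

lemmas compl_in_comp = nat_mapD(3)[OF compl_in_nat]

lemma compl_pr_hm: "\<beta> < \<mu> \<Longrightarrow> component (compl_pr \<mu> \<beta>) i \<cdot> compl_in \<mu> i = quot_pr \<beta> i"
  using arg_cong[OF completion_map_hom(2), of \<beta> \<mu> "\<lambda>\<phi>. component \<phi> i"] by simp

lemma coker_pr_hom: "coker (seq_cat C) (completion_map C S \<mu>) \<in> seq_homs (compl_seq \<mu>) (coker_seq \<mu>)"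
  unfolding completion_coker_def by (rule seq_coker(1)[OF completion_map_hom(1)])

lemma coker_pr_nat: "nat_map (compl_seq \<mu>) (coker_seq \<mu>) (coker_pr \<mu>)"
  by (rule seq_homD(1)[OF coker_pr_hom])

lemmas coker_pr_comp = nat_mapD(3)[OF coker_pr_nat]

lemma coker_pr_cokernel: "is_cokernel C (compl_in \<mu> i) (coker_pr \<mu> i)"
  by (rule seq_coker(2)[OF completion_map_hom(1)])

lemma compl_ext:
  assumes "s \<in> homs C T (ob (compl_seq \<mu>) i)" "t \<in> homs C T (ob (compl_seq \<mu>) i)"
    "\<And>\<beta>. \<beta> < \<mu> \<Longrightarrow> component (compl_pr \<mu> \<beta>) i \<cdot> s = component (compl_pr \<mu> \<beta>) i \<cdot> t"
  shows "s = t"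
proof (rule limit_ext[OF completion_limit(2) _ assms(1,2)])
  show "component (quot_trans \<beta> \<gamma>) i \<in> homs C (ob (quot_seq \<gamma>) i) (ob (quot_seq \<beta>) i)" if "\<beta> \<le> \<gamma>" for \<beta> \<gamma>
    by (rule seq_component[OF quot_trans(1)[OF that]])
  show "component (compl_pr \<mu> \<beta>) i \<cdot> s = component (compl_pr \<mu> \<beta>) i \<cdot> t" if "\<beta> \<in> {..<\<mu>}" for \<beta>
    using assms(3) that by simp
qed

section \<open>Vanishing of lim and lim^1 along the quotients\<close>

lemma quot_ord_zero: "is_zero_object C (ob (quot_seq ord_zero) i)"
proof -
  note q = quot_pr_comp[of ord_zero i]
  have o: "ob (quot_seq ord_zero) i \<in> objs C" by (rule homs_objs(2)[OF q])
  have "quot_pr ord_zero i = arr_zero C (ob S i) (ob (quot_seq ord_zero) i)"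
    using quot_pr_ord_zero[OF ident_hom[OF ob_obj[OF S]], of i] ident_right[OF q] by simp
  then have "ident C (ob (quot_seq ord_zero) i) \<cdot> quot_pr ord_zero i = arr_zero C (ob S i) (ob (quot_seq ord_zero) i)"
    using ident_left[OF q] by simp
  then have "ident C (ob (quot_seq ord_zero) i) = arr_zero C (ob (quot_seq ord_zero) i) (ob (quot_seq ord_zero) i)"
    by (rule epi_zero[OF quot_pr_epi q ident_hom[OF o]])
  then show ?thesis using zero_object_iff[OF o] by blast
qed

lemma lim0_quot: "lim0 (quot_seq \<alpha>)"
proof (induction \<alpha> rule: less_induct)
  case (less \<alpha>)
  note qn = quot_pr_nat
  show ?case
  proof (rule ordinal_cases[of \<alpha>])
    assume "\<alpha> = ord_zero"
    then show "lim0 (quot_seq \<alpha>)"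
      unfolding lim0_def using zero_object_homs(1)[OF quot_ord_zero] by blast
  next
    fix \<beta> assume \<beta>: "ord_pred \<beta> \<alpha>"
    show "lim0 (quot_seq \<alpha>)"
      by (rule lim0_succ[OF qn quot_pr_epi qn quot_pr_mono[OF less_imp_le[OF ord_pred_less[OF \<beta>]]]
            quot_pr_succI[OF \<beta>] less[OF ord_pred_less[OF \<beta>]]])
  next
    assume \<alpha>: "limit_ordinal \<alpha>"
    show "lim0 (quot_seq \<alpha>)"
      by (rule lim0_limit[OF qn quot_pr_epi qn quot_pr_limit[OF \<alpha>]]) (simp_all add: less)
  qed
qed

lemma lim0_completion: "lim0 (compl_seq \<mu>)"
proof (rule lim0_joint_mono[of "{..<\<mu>}" _ quot_seq "\<lambda>\<beta>. component (compl_pr \<mu> \<beta>)"])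
  show "nat_map (compl_seq \<mu>) (quot_seq \<beta>) (component (compl_pr \<mu> \<beta>))" if "\<beta> \<in> {..<\<mu>}" for \<beta>
    using compl_pr_nat that by simp
  show "s = t" if "s \<in> homs C T (ob (compl_seq \<mu>) i)" "t \<in> homs C T (ob (compl_seq \<mu>) i)"
    "\<forall>\<beta>\<in>{..<\<mu>}. component (compl_pr \<mu> \<beta>) i \<cdot> s = component (compl_pr \<mu> \<beta>) i \<cdot> t" for i T s t
    by (rule compl_ext[OF that(1,2)]) (use that(3) in simp)
qed (rule completion_seq lim0_quot)+

text \<open>The forward direction of the theorem: the limit of the completion always vanishes, so
  lim^1 S is the only obstruction.\<close>

lemma lim0_completion_coker:
  assumes "lim1_zero S"
  shows "lim0 (coker_seq \<mu>)"
  by (rule lim0_cokernel[OF compl_in_nat coker_pr_nat coker_pr_cokernel assms lim0_completion])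

text \<open>At a limit ordinal lim^1 vanishes first on the completion, a limit of earlier quotients.
  The hypothesis on the cokernel then brings this down to S^\<alpha>, the image of S in the
  completion.\<close>

lemma lim1_zero_quot:
  assumes l: "\<And>\<mu>. limit_ordinal \<mu> \<Longrightarrow> lim0 (coker_seq \<mu>)"
  shows "lim1_zero (quot_seq \<alpha>)"
proof (induction \<alpha> rule: less_induct)
  case (less \<alpha>)
  note qn = quot_pr_nat
  show ?case
  proof (rule ordinal_cases[of \<alpha>])
    assume \<alpha>: "\<alpha> = ord_zero"
    show "lim1_zero (quot_seq \<alpha>)"
      unfolding \<alpha>
    proof (rule lim1_zero_epi_bonds[OF nat_mapD(2)[OF qn]])
      show "is_epi C (bond (quot_seq ord_zero) i)" for i
        by (rule epiI[OF bond_hom[OF nat_mapD(2)[OF qn]]])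
          (rule zero_object_homs(2)[OF quot_ord_zero])
    qed
  next
    fix \<beta> assume \<beta>: "ord_pred \<beta> \<alpha>"
    show "lim1_zero (quot_seq \<alpha>)"
      by (rule lim1_zero_succ[OF qn quot_pr_epi qn quot_pr_epi
            quot_pr_succI[OF \<beta>] less[OF ord_pred_less[OF \<beta>]]])
  next
    assume \<alpha>: "limit_ordinal \<alpha>"
    have "lim1_zero (compl_seq \<alpha>)"
      by (rule lim1_zero_limit[OF _ _ completion_limit(2) completion_seq lim0_quot])
        (auto intro: compl_pr_nat seq_homD(1)[OF quot_trans(1)] less)
    then show "lim1_zero (quot_seq \<alpha>)"
    proof (rule lim1_zero_image[OF compl_in_nat coker_pr_nat coker_pr_cokernel _ l[OF \<alpha>] qn quot_pr_epi])
      fix i T s assume s: "s \<in> homs C T (ob S i)" and 0: "compl_in \<alpha> i \<cdot> s = arr_zero C T (ob (compl_seq \<alpha>) i)"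
      have T: "T \<in> objs C" using s homs_objs by blast
      \<comment> \<open>What dies in the completion dies under each of its projections, that is, in
        every earlier quotient.\<close>
      have "quot_pr \<beta> i \<cdot> s = arr_zero C T (ob (quot_seq \<beta>) i)" if \<beta>: "\<beta> \<in> {..<\<alpha>}" for \<beta>
      proof -
        have \<beta>': "\<beta> < \<alpha>" using \<beta> by simp
        note pn = nat_mapD(3)[OF compl_pr_nat[OF \<beta>'], of i]
        show ?thesis
          using comp_eq[OF compl_pr_hm[OF \<beta>'] compl_in_comp pn s] 0 comp_zero[OF pn T] by simp
      qed
      then show "quot_pr \<alpha> i \<cdot> s = arr_zero C T (ob (quot_seq \<alpha>) i)"
        using quot_pr_limit[OF \<alpha> s] by blast
    qed
  qed
qed

text \<open>Each map from the generator into some S_i that leaves the filtration does so at a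
  definite ordinal. There is only a small set of such maps, so these ordinals have a common bound
  \<alpha>.\<close>

lemma filtration_stabilizes:
  "\<exists>\<alpha>::'u. \<forall>\<beta> i T s. s \<in> homs C T (ob S i) \<longrightarrow> quot_pr \<alpha> i \<cdot> s = arr_zero C T (ob (quot_seq \<alpha>) i) \<longrightarrow>
    quot_pr \<beta> i \<cdot> s = arr_zero C T (ob (quot_seq \<beta>) i)"
proof -
  obtain G where gen: "is_generator C G" using generator by blast
  then have G: "G \<in> objs C" by (simp add: is_generator_def)
  define z where "z \<beta> i g \<longleftrightarrow> quot_pr \<beta> i \<cdot> g = arr_zero C G (ob (quot_seq \<beta>) i)" for \<beta> i g
  \<comment> \<open>The first ordinal whose term no longer contains \<open>g\<close>. If there is
    none, \<open>LEAST\<close> yields an unspecified value, which the bound simply covers as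
    well.\<close>
  define \<rho> where "\<rho> i g = (LEAST \<beta>. \<not> z \<beta> i g)" for i g
  have "\<exists>\<alpha>. \<rho> i ` homs C G (ob S i) \<subseteq> {..<\<alpha>}" for i
  proof -
    have "small TYPE('u) (homs C G (ob S i))"
      using locally_small G ob_obj[OF S] unfolding locally_small_def by blast
    from small_image[OF this] show ?thesis using universe_bounded[OF univ] by metis
  qed
  then obtain a where a: "\<And>i. \<rho> i ` homs C G (ob S i) \<subseteq> {..<a i}" by metis
  have "small TYPE('u) (a ` UNIV)" by (rule small_image[OF universe_nat_small[OF univ]])
  then obtain \<alpha> where \<alpha>: "a ` UNIV \<subseteq> {..<\<alpha>}" using universe_bounded[OF univ] by metis
  have zz: "z \<beta> i g" if g: "g \<in> homs C G (ob S i)" and zg: "z \<alpha> i g" for \<beta> i g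
  proof (rule ccontr)
    assume "\<not> z \<beta> i g"
    then have "\<not> z (\<rho> i g) i g" unfolding \<rho>_def by (rule LeastI)
    moreover have "\<rho> i g \<le> \<alpha>" using a[of i] g \<alpha> by (meson image_subset_iff lessThan_iff less_imp_le less_trans UNIV_I)
    ultimately show False using quot_pr_mono[OF _ g] zg unfolding z_def by blast
  qed
  show ?thesis
  proof (intro exI[of _ \<alpha>] allI impI)
    fix \<beta> i T s assume s: "s \<in> homs C T (ob S i)" and 0: "quot_pr \<alpha> i \<cdot> s = arr_zero C T (ob (quot_seq \<alpha>) i)"
    obtain x where x: "x \<in> homs C T (ob (map_src (filt_map C S \<alpha>)) i)" "filt_in \<alpha> i \<cdot> x = s"
      using quot_pr_zeroD[OF s 0] by blast
    note m = filt_in_comp[of \<alpha> i] and q = quot_pr_comp[of \<beta> i]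
    let ?I = "ob (map_src (filt_map C S \<alpha>)) i" and ?Q = "ob (quot_seq \<beta>) i"
    have I: "?I \<in> objs C" and Q: "?Q \<in> objs C" using homs_objs m q by blast+
    note qmh = comp_hom[OF m q]
    \<comment> \<open>The composite I^\<alpha> -> S -> S^\<beta> is tested on maps from the
      generator and so is zero; this passes from the generator to arbitrary sources.\<close>
    have "(quot_pr \<beta> i \<cdot> filt_in \<alpha> i) \<cdot> g = arr_zero C ?I ?Q \<cdot> g" if g: "g \<in> homs C G ?I" for g
    proof -
      have "z \<alpha> i (filt_in \<alpha> i \<cdot> g)" unfolding z_def by (rule quot_pr_fm[OF g])
      then have "z \<beta> i (filt_in \<alpha> i \<cdot> g)" by (rule zz[OF comp_hom[OF g m]])
      then show ?thesis unfolding z_def using comp_assoc[OF g m q] zero_comp[OF g Q] by simp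
    qed
    then have "quot_pr \<beta> i \<cdot> filt_in \<alpha> i = arr_zero C ?I ?Q"
      using gen qmh zero_hom[OF I Q] unfolding is_generator_def by blast
    then show "quot_pr \<beta> i \<cdot> s = arr_zero C T ?Q"
      using comp_eq[OF _ m q x(1)] x(2) zero_comp[OF x(1) Q] by metis
  qed
qed

text \<open>At a stable \<alpha> the term I^\<alpha> equals its own image sequence, which says that
  its bonds are epi. Then S is an extension of S^\<alpha> by a sequence with vanishing
  lim^1.\<close>

lemma lim1_zero_of_quots:
  assumes l: "\<And>\<alpha>. lim1_zero (quot_seq \<alpha>)"
  shows "lim1_zero S"
proof -
  obtain \<alpha> :: 'u where stable: "\<And>\<beta> i T s. s \<in> homs C T (ob S i) \<Longrightarrow>
      quot_pr \<alpha> i \<cdot> s = arr_zero C T (ob (quot_seq \<alpha>) i) \<Longrightarrow> quot_pr \<beta> i \<cdot> s = arr_zero C T (ob (quot_seq \<beta>) i)"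
    using filtration_stabilizes by blast
  obtain \<beta> where \<beta>: "ord_pred \<alpha> \<beta>" using ord_succ_exists by blast
  define I where "I = map_src (filt_map C S \<alpha>)"
  note mn = filt_in_nat[of \<alpha>, folded I_def]
  note I = nat_mapD(1)[OF mn]
  note m = nat_mapD(3)[OF mn]
  have "is_epi C (bond I i)" for i
  proof -
    note idI = ident_hom[OF ob_obj[OF I], of i]
    have "quot_pr \<alpha> i \<cdot> filt_in \<alpha> i = arr_zero C (ob I i) (ob (quot_seq \<alpha>) i)"
      using quot_pr_fm[OF idI[unfolded I_def]] ident_right[OF m] unfolding I_def by metis
    \<comment> \<open>Applied to the generic element of I^\<alpha>, its inclusion into S, which by
      stability also lies in the successor term.\<close>
    from quot_pr_succD[OF \<beta> m stable[OF m this]] obtain V v s where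
      v: "v \<in> homs C V (ob I i)" "is_epi C v" and s: "s \<in> homs C V (ob S (Suc i))"
      "quot_pr \<alpha> (Suc i) \<cdot> s = arr_zero C V (ob (quot_seq \<alpha>) (Suc i))" "bond S i \<cdot> s = filt_in \<alpha> i \<cdot> v" by blast
    obtain x where x: "x \<in> homs C V (ob I (Suc i))" "filt_in \<alpha> (Suc i) \<cdot> x = s"
      using quot_pr_zeroD[OF s(1,2)] unfolding I_def by blast
    have "filt_in \<alpha> i \<cdot> (bond I i \<cdot> x) = filt_in \<alpha> i \<cdot> v"
      using nat_map_bond[OF mn x(1)] x(2) s(3) by simp
    then have "bond I i \<cdot> x = v"
      by (rule monoD[OF filt_in_mono m bond_comp[OF I x(1)] v(1)])
    then show "is_epi C (bond I i)" using epi_of_comp[OF x(1) bond_hom[OF I]] v(2) by simp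
  qed
  then have "lim1_zero I" by (rule lim1_zero_epi_bonds[OF I])
  from lim1_zero_extension[OF mn quot_pr_nat quot_pr_epi quot_pr_zeroD[of _ _ _ \<alpha>, folded I_def] this l]
  show ?thesis .
qed

lemma lim1_zero_iff: "lim1_zero S \<longleftrightarrow> (\<forall>\<mu>. limit_ordinal \<mu> \<longrightarrow> lim0 (coker_seq \<mu>))"
  using lim0_completion_coker lim1_zero_quot lim1_zero_of_quots by blast

text \<open>An epimorphism cancels against its own cokernel, so the cokernel map is zero; being epi
  in each component, it has a zero target.\<close>

lemma complete_at_lim0:
  assumes "complete_at C S \<mu>"
  shows "lim0 (coker_seq \<mu>)"
proof -
  note h = completion_map_hom(1)[of \<mu>] and p = coker_pr_hom[of \<mu>]
  note Z = nat_mapD(2)[OF coker_pr_nat[of \<mu>]]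
  have z: "arr_zero (seq_cat C) (compl_seq \<mu>) (coker_seq \<mu>) \<in> seq_homs (compl_seq \<mu>) (coker_seq \<mu>)"
    by (rule seq_zero[OF completion_seq Z])
  have ph: "coker_pr \<mu> i \<cdot> compl_in \<mu> i = arr_zero C (ob S i) (ob (coker_seq \<mu>) i)" for i
    using cokernelD(2)[OF coker_pr_cokernel compl_in_comp] hom_arr(3)[OF coker_pr_comp]
    by metis
  have "coker (seq_cat C) (completion_map C S \<mu>) \<odot> completion_map C S \<mu> =
      arr_zero (seq_cat C) (compl_seq \<mu>) (coker_seq \<mu>) \<odot> completion_map C S \<mu>"
    by (rule seq_hom_ext[OF seq.comp_hom[OF h p] seq.comp_hom[OF h z]])
      (simp add: ph zero_comp[OF compl_in_comp ob_obj[OF Z]])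
  then have "coker (seq_cat C) (completion_map C S \<mu>) = arr_zero (seq_cat C) (compl_seq \<mu>) (coker_seq \<mu>)"
    by (rule seq.epiD[OF assms[unfolded complete_at_def] h p z])
  from arg_cong[OF this, of component]
  have p0: "coker_pr \<mu> i = arr_zero C (ob (compl_seq \<mu>) i) (ob (coker_seq \<mu>) i)" for i by simp
  have "is_zero_object C (ob (coker_seq \<mu>) i)" for i
  proof -
    note pi = coker_pr_comp[of \<mu> i]
    note o = homs_objs(2)[OF pi]
    have "ident C (ob (coker_seq \<mu>) i) \<cdot> coker_pr \<mu> i = arr_zero C (ob (compl_seq \<mu>) i) (ob (coker_seq \<mu>) i)"
      using ident_left[OF pi] p0 by simp
    then show ?thesis
      using epi_zero[OF cokernel_epi[OF coker_pr_cokernel] pi ident_hom[OF o]] zero_object_iff[OF o] by blast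
  qed
  then show ?thesis unfolding lim0_def using zero_object_homs(1) by blast
qed

text \<open>A cofinal sequence presents the completion as a countable tower, so the cokernel has epi
  bonds; a zero limit then makes all its objects vanish, and the completion map is epi
  componentwise.\<close>

lemma complete_at_countable_cofinality:
  assumes \<mu>: "limit_ordinal \<mu>" and cof: "countable {..<cofinality \<mu>}" and l: "lim0 (coker_seq \<mu>)"
  shows "complete_at C S \<mu>"
proof -
  obtain b :: "nat \<Rightarrow> 'u" where b: "\<And>n. b n < \<mu>"
    and bs: "\<And>n. \<exists>\<gamma>. ord_pred (b n) \<gamma> \<and> \<gamma> \<le> b (Suc n)"
    and bc: "\<And>\<beta>. \<beta> < \<mu> \<Longrightarrow> \<exists>n. \<beta> \<le> b n"
    using countable_cofinality_sequence[OF \<mu> cof] by metis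
  have bm: "b n \<le> b (Suc n)" for n using bs[of n] ord_pred_less by (meson less_imp_le order_trans)
  have bmono: "b m \<le> b n" if "m \<le> n" for m n using lift_Suc_mono_le[of b, OF bm that] .
  note tn = seq_homD(1)[OF quot_trans(1)]
  note tp = limitD(3)[OF completion_limit(2), of _ \<mu>]
  have "is_epi C (bond (coker_seq \<mu>) i)" for i
  proof (rule completion_cokernel_bond_epi[OF compl_in_nat coker_pr_nat coker_pr_cokernel quot_pr_nat quot_pr_epi,
        where t = "\<lambda>n. component (quot_trans (b n) (b (Suc n)))"])
    show "nat_map (compl_seq \<mu>) (quot_seq (b n)) (component (compl_pr \<mu> (b n)))" for n by (rule compl_pr_nat[OF b])
    show "component (compl_pr \<mu> (b n)) i \<cdot> compl_in \<mu> i = quot_pr (b n) i" for n i by (rule compl_pr_hm[OF b])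
    show "nat_map (quot_seq (b (Suc n))) (quot_seq (b n)) (component (quot_trans (b n) (b (Suc n))))" for n
      by (rule tn[OF bm])
    show "component (quot_trans (b n) (b (Suc n))) i \<cdot> quot_pr (b (Suc n)) i = quot_pr (b n) i" for n i
      by (rule quot_trans_qm[OF bm])
    show "component (quot_trans (b n) (b (Suc n))) i \<cdot> component (compl_pr \<mu> (b (Suc n))) i =
        component (compl_pr \<mu> (b n)) i" for n i
      by (rule tp) (simp_all add: b bm)
    show "s = s'" if "s \<in> homs C T (ob (compl_seq \<mu>) i)" "s' \<in> homs C T (ob (compl_seq \<mu>) i)"
      "\<And>n. component (compl_pr \<mu> (b n)) i \<cdot> s = component (compl_pr \<mu> (b n)) i \<cdot> s'" for i T s s'
    proof (rule compl_ext[OF that(1,2)])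
      fix \<beta> assume \<beta>: "\<beta> < \<mu>"
      obtain n where n: "\<beta> \<le> b n" using bc[OF \<beta>] by blast
      have t: "component (quot_trans \<beta> (b n)) i \<cdot> component (compl_pr \<mu> (b n)) i =
          component (compl_pr \<mu> \<beta>) i"
        by (rule tp) (simp_all add: b \<beta> n)
      note c = comp_eq[OF t nat_mapD(3)[OF compl_pr_nat[OF b]] nat_mapD(3)[OF tn[OF n]]]
      show "component (compl_pr \<mu> \<beta>) i \<cdot> s = component (compl_pr \<mu> \<beta>) i \<cdot> s'"
        using c[OF that(1)] c[OF that(2)] that(3)[of n] by simp
    qed
    show "\<exists>V v s'. v \<in> homs C V T \<and> is_epi C v \<and> s' \<in> homs C V (ob S (Suc i)) \<and>
        quot_pr (b n) (Suc i) \<cdot> s' = arr_zero C V (ob (quot_seq (b n)) (Suc i)) \<and> bond S i \<cdot> s' = s \<cdot> v"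
      if s: "s \<in> homs C T (ob S i)" and 0: "quot_pr (b (Suc n)) i \<cdot> s = arr_zero C T (ob (quot_seq (b (Suc n))) i)"
      for n i T s
    proof -
      \<comment> \<open>The successor between \<open>b n\<close> and \<open>b (Suc n)\<close> pays
        for the one bond preimage that is taken.\<close>
      obtain \<gamma> where \<gamma>: "ord_pred (b n) \<gamma>" "\<gamma> \<le> b (Suc n)" using bs by blast
      show ?thesis by (rule quot_pr_succD[OF \<gamma>(1) s quot_pr_mono[OF \<gamma>(2) s 0]])
    qed
    \<comment> \<open>The completion is a limit over all \<beta> < \<mu>, so a compatible family on
      the cofinal sequence has to be extended to all of them.\<close>
    show "\<exists>y\<in>homs C T (ob (compl_seq \<mu>) i). \<forall>n. component (compl_pr \<mu> (b n)) i \<cdot> y = x n"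
      if T: "T \<in> objs C" and x: "\<And>n. x n \<in> homs C T (ob (quot_seq (b n)) i)"
        and xc: "\<And>n. component (quot_trans (b n) (b (Suc n))) i \<cdot> x (Suc n) = x n" for i T x
    proof -
      have tt: "component (quot_trans \<beta> \<gamma>) i \<cdot> component (quot_trans \<gamma> \<delta>) i = component (quot_trans \<beta> \<delta>) i"
        if g: "\<beta> \<le> \<gamma>" "\<gamma> \<le> \<delta>" for \<beta> \<gamma> \<delta>
      proof -
        note t1 = nat_mapD(3)[OF tn[OF g(1)], of i] and t2 = nat_mapD(3)[OF tn[OF g(2)], of i]
          and t3 = nat_mapD(3)[OF tn[OF order_trans[OF g]], of i] and q = quot_pr_comp[of \<delta> i]
        have "(component (quot_trans \<beta> \<gamma>) i \<cdot> component (quot_trans \<gamma> \<delta>) i) \<cdot> quot_pr \<delta> i =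
            component (quot_trans \<beta> \<delta>) i \<cdot> quot_pr \<delta> i"
          using comp_assoc[OF q t2 t1] quot_trans_qm g order_trans[OF g] by simp
        then show ?thesis by (rule epiD[OF quot_pr_epi q comp_hom[OF t2 t1] t3])
      qed
      have xmn: "component (quot_trans (b m) (b n)) i \<cdot> x n = x m" if "m \<le> n" for m n
        using that
      proof (induction n rule: dec_induct)
        case base
        have "component (quot_trans (b m) (b m)) i = ident C (ob (quot_seq (b m)) i)"
          using epiD[OF quot_pr_epi quot_pr_comp nat_mapD(3)[OF tn[OF order_refl]]
              ident_hom[OF homs_objs(2)[OF quot_pr_comp]]]
            quot_trans_qm[OF order_refl] ident_left[OF quot_pr_comp] by simp
        then show ?case using ident_left[OF x] by simp
      next
        case (step n)
        note t = nat_mapD(3)[OF tn[OF bm], of n i] and t' = nat_mapD(3)[OF tn[OF bmono[OF step.hyps(1)]], of i]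
        show ?case
          using comp_eq[OF tt[OF bmono[OF step.hyps(1)] bm] t t' x] xc[of n] step.IH by simp
      qed
      have "\<exists>N. \<forall>\<beta>. \<beta> < \<mu> \<longrightarrow> \<beta> \<le> b (N \<beta>)" using bc by metis
      then obtain N where N: "\<And>\<beta>. \<beta> < \<mu> \<Longrightarrow> \<beta> \<le> b (N \<beta>)" by blast
      \<comment> \<open>The value at \<beta> is pushed down from some term of the sequence above
        \<beta>; \<open>yn\<close> shows that the choice of the term is irrelevant.\<close>
      define y where "y \<beta> = component (quot_trans \<beta> (b (N \<beta>))) i \<cdot> x (N \<beta>)" for \<beta>
      have yn: "y \<beta> = component (quot_trans \<beta> (b n)) i \<cdot> x n" if \<beta>: "\<beta> < \<mu>" and n: "\<beta> \<le> b n" for \<beta> n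
      proof -
        have *: "component (quot_trans \<beta> (b (max m k))) i \<cdot> x (max m k) = component (quot_trans \<beta> (b m)) i \<cdot> x m"
          if m: "\<beta> \<le> b m" for m k
        proof -
          have mk: "m \<le> max m k" by simp
          show ?thesis
            using comp_eq[OF tt[OF m bmono[OF mk]] nat_mapD(3)[OF tn[OF bmono[OF mk]]] nat_mapD(3)[OF tn[OF m]] x]
              xmn[OF mk] by simp
        qed
        show ?thesis
          unfolding y_def using *[OF n, of "N \<beta>"] *[OF N[OF \<beta>], of n] by (simp add: max.commute)
      qed
      have "\<exists>h. h \<in> homs C T (ob (compl_seq \<mu>) i) \<and> (\<forall>\<beta>\<in>{..<\<mu>}. component (compl_pr \<mu> \<beta>) i \<cdot> h = y \<beta>)"
      proof (rule limit_lift[OF completion_limit(2) T])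
        show "y \<beta> \<in> homs C T (ob (quot_seq \<beta>) i)" if "\<beta> \<in> {..<\<mu>}" for \<beta>
          unfolding y_def by (rule nat_map_comp[OF tn[OF N] x]) (use that in simp)
        fix \<beta> \<gamma> assume bg: "\<beta> \<in> {..<\<mu>}" "\<gamma> \<in> {..<\<mu>}" "\<beta> \<le> \<gamma>"
        then have \<gamma>N: "\<gamma> \<le> b (N \<gamma>)" using N by simp
        have "component (quot_trans \<beta> \<gamma>) i \<cdot> y \<gamma> = component (quot_trans \<beta> (b (N \<gamma>))) i \<cdot> x (N \<gamma>)"
          unfolding y_def by (rule comp_eq[OF tt[OF bg(3) \<gamma>N] nat_mapD(3)[OF tn[OF \<gamma>N]] nat_mapD(3)[OF tn[OF bg(3)]] x])
        then show "component (quot_trans \<beta> \<gamma>) i \<cdot> y \<gamma> = y \<beta>"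
          using yn[of \<beta> "N \<gamma>"] bg order_trans[OF bg(3) \<gamma>N] by simp
      qed
      then obtain h where h: "h \<in> homs C T (ob (compl_seq \<mu>) i)"
        "\<And>\<beta>. \<beta> < \<mu> \<Longrightarrow> component (compl_pr \<mu> \<beta>) i \<cdot> h = y \<beta>" by auto
      have "component (compl_pr \<mu> (b n)) i \<cdot> h = x n" for n
        using h(2)[OF b] yn[OF b order_refl] xmn[OF order_refl] by simp
      then show ?thesis using h(1) by blast
    qed
  qed
  then have zero: "is_zero_object C (ob (coker_seq \<mu>) i)" for i
    using epi_bonds_lim0_zero[OF nat_mapD(2)[OF coker_pr_nat] _ l]
      zero_object_iff[OF ob_obj[OF nat_mapD(2)[OF coker_pr_nat]]] by blast
  have "is_epi C (compl_in \<mu> i)" for i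
  proof (rule epiI[OF compl_in_comp])
    fix Z u assume u: "u \<in> homs C (ob (compl_seq \<mu>) i) Z" and 0: "u \<cdot> compl_in \<mu> i = arr_zero C (ob S i) Z"
    note pi = coker_pr_comp[of \<mu> i]
    obtain k where k: "k \<in> homs C (ob (coker_seq \<mu>) i) Z" "k \<cdot> coker_pr \<mu> i = u"
      using cokernelD(3)[OF coker_pr_cokernel compl_in_comp u 0] hom_arr(3)[OF pi] by auto
    have "k = arr_zero C (ob (coker_seq \<mu>) i) Z" using zero_object_homs(2)[OF zero k(1)] .
    then show "u = arr_zero C (ob (compl_seq \<mu>) i) Z" using k zero_comp[OF pi homs_objs(2)[OF u]] by simp
  qed
  then show ?thesis unfolding complete_at_def by (rule seq_epi[OF completion_map_hom(1)])
qed

end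

end

theorem theorem3p1:
  fixes A :: "('o, 'm) precat" and S :: "('o, 'm) inv_seq"
  assumes "universe TYPE('u::wellorder)"
    and "abelian_category A"
    and "locally_small TYPE('u) A"
    and "\<exists>G. is_generator A G"
    and "has_small_coproducts TYPE('u) A"
    and "has_small_products TYPE('u) A"
    and "small_products_exact TYPE('u) A"
    and "inverse_sequence A S"
  shows "(is_zero_object A (seq_lim1 A S) \<longleftrightarrow>
      (\<forall>\<mu>::'u. limit_ordinal \<mu> \<longrightarrow> is_zero_object A (seq_lim A (completion_coker A S \<mu>))))
    \<and> (is_zero_object A (seq_lim1 A S) \<longleftrightarrow>
      (\<forall>\<mu>::'u. limit_ordinal \<mu> \<longrightarrow>
        (countable {..<cofinality \<mu>} \<longrightarrow> complete_at A S \<mu>) \<and>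
        (uncountable {..<cofinality \<mu>} \<longrightarrow>
          is_zero_object A (seq_lim A (completion_coker A S \<mu>)))))"
proof -
  interpret abelian_category A by fact
  interpret complete_abelian_category A "TYPE('u)"
    by unfold_locales (fact assms)+
  note S = assms(8)
  have lim: "is_zero_object A (seq_lim A (completion_coker A S \<mu>)) \<longleftrightarrow> lim0 (completion_coker A S \<mu>)" for \<mu> :: 'u
    by (rule seq_lim_zero_iff[OF nat_mapD(2)[OF coker_pr_nat[OF S]]])
  \<comment> \<open>For each \<mu> of countable cofinality completeness and vanishing of the limit
    imply each other, so the second equivalence follows from the first, one ordinal at a
    time.\<close>
  show ?thesis
    unfolding lim seq_lim1_zero_iff[OF S] lim1_zero_iff[OF S]
    using complete_at_lim0[OF S] complete_at_countable_cofinality[OF S] by blast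
qed

end
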